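(* Let $\Omega\subset\mathbb{R}^d$ be an $\varepsilon$-uniform domain with admissible Whitney covering $\mathcal W$, let $0<s<1$, $1\le p<\infty$ and $1\le q\le\infty$. For $f\in L^1_{loc}(\Omega)$, $$\left(\sum_{Q\in\mathcal W}\int_Q\left(\int_{\mathbf{Sh}(Q)}\frac{|f(x)-f(y)|^q}{|x-y|^{sq+d}}dy\right)^{p/q}dx\right)^{1/p}\approx\left(\int_\Omega\left(\int_\Omega\frac{|f(x)-f(y)|^q}{|x-y|^{sq+d}}dy\right)^{p/q}dx\right)^{1/p},$$ with constants independent of $f$ (for $q=\infty$ each inner expression $(\int\dots dy)^{p/q}$ is replaced by the essential supremum over the same domain of $|f(x)-f(y)|^p/|x-y|^{sp}$).
   Context: $\ell(Q)$ side length, $\mathrm D(Q,S)=\ell(Q)+\mathrm{dist}(Q,S)+\ell(S)$, $\mathrm D(Q,\partial\Omega)=\ell(Q)+\mathrm{dist}(Q,\partial\Omega)$. A Whitney covering of $\Omega$ is a family $\mathcal W$ of pairwise disjoint open dyadic cubes whose closures have union $\Omega$, with $C_{\mathcal W}\ell(Q)\le\mathrm D(Q,\partial\Omega)\le4C_{\mathcal W}\ell(Q)$, $\{50Q\}$ of finite overlap, $S\subset5Q\Rightarrow\ell(S)\ge\ell(Q)/2$. A chain $[Q,S]=(Q_1,\dots,Q_M)$ from $Q$ to $S$ consists of cubes of $\mathcal W$ with consecutive ones neighbors (closures meeting); it is $\varepsilon$-admissible if $\sum\ell(Q_j)\le\varepsilon^{-1}\mathrm D(Q,S)$ and some $j_0<M$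 has $\ell(Q_j)\ge\varepsilon\mathrm D(Q_1,Q_j)$ for $j\le j_0$ and $\ell(Q_j)\ge\varepsilon\mathrm D(Q_j,Q_M)$ for $j\ge j_0$; $Q_S:=Q_{j_0}$ is the central cube. $\Omega$ is $\varepsilon$-uniform with admissible covering $\mathcal W$ if every pair of cubes of $\mathcal W$ is joined by an $\varepsilon$-admissible chain. Shadows: for $P\in\mathcal W$ with center $x_P$ and $\rho>0$, $\mathbf{SH}_\rho(P):=\{Q\in\mathcal W: Q\subset B(x_P,\rho\ell(P))\}$ and $\mathbf{Sh}_\rho(P):=\bigcup_{Q\in\mathbf{SH}_\rho(P)}Q$. Fix $\rho_\varepsilon>1$ such that (i) for every $\varepsilon$-admissible chain $[Q,S]$ and every cube $P$ of the subchain $(Q_1,\dots,Q_{j_0})$ from $Q$ to $Q_S$, $Q\in\mathbf{SH}_{\rho_\varepsilon}(P)$; (ii) every cube of an $\varepsilon$-admissible chain $[Q,S]$ belongs to $\mathbf{SH}_{\rho_\varepsilon}(Q_S)$. Then $\mathbf{Sh}(Q):=\mathbf{Sh}_{\rho_\varepsilon}(Q)$. *)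

theory Defs
  imports "HOL-Analysis.Analysis" "HOL-Probability.Essential_Supremum"
begin

definition dyadic_cube :: "'a::euclidean_space set \<Rightarrow> bool" where
  "dyadic_cube Q \<longleftrightarrow> (\<exists>(k::int) a. (\<forall>i\<in>Basis. \<exists>m::int. a \<bullet> i = 2 powr k * of_int m)
       \<and> Q = box a (a + (2 powr k) *\<^sub>R One))"

definition side :: "'a::euclidean_space set \<Rightarrow> real" where
  "side Q = (THE l. l > 0 \<and> (\<exists>a. Q = box a (a + l *\<^sub>R One)))"

definition center :: "'a::euclidean_space set \<Rightarrow> 'a" where
  "center Q = (THE c. \<exists>a. Q = box a (a + side Q *\<^sub>R One) \<and> c = a + (side Q / 2) *\<^sub>R One)"

definition dilate :: "real \<Rightarrow> 'a::euclidean_space set \<Rightarrow> 'a set" where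
  "dilate r Q = box (center Q - (r * side Q / 2) *\<^sub>R One) (center Q + (r * side Q / 2) *\<^sub>R One)"

definition DD :: "'a::euclidean_space set \<Rightarrow> 'a set \<Rightarrow> real" where
  "DD Q S = side Q + setdist Q S + side S"

definition Dbd :: "'a::euclidean_space set \<Rightarrow> 'a set \<Rightarrow> real" where
  "Dbd \<Omega> Q = side Q + setdist Q (frontier \<Omega>)"

definition whitney_covering :: "'a::euclidean_space set \<Rightarrow> 'a set set \<Rightarrow> bool" where
  "whitney_covering \<Omega> W \<longleftrightarrow>
     (\<forall>Q\<in>W. dyadic_cube Q) \<and>
     pairwise disjnt W \<and>
     \<Union>(closure ` W) = \<Omega> \<and>
     (\<exists>C>0. \<forall>Q\<in>W. C * side Q \<le> Dbd \<Omega> Q \<and> Dbd \<Omega> Q \<le> 4 * C * side Q) \<and>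
     (\<exists>N::nat. \<forall>x. finite {Q\<in>W. x \<in> dilate 50 Q} \<and> card {Q\<in>W. x \<in> dilate 50 Q} \<le> N) \<and>
     (\<forall>Q\<in>W. \<forall>S\<in>W. S \<subseteq> dilate 5 Q \<longrightarrow> side S \<ge> side Q / 2)"

definition is_chain :: "'a::euclidean_space set set \<Rightarrow> 'a set \<Rightarrow> 'a set \<Rightarrow> 'a set list \<Rightarrow> bool" where
  "is_chain W Q S cs \<longleftrightarrow> cs \<noteq> [] \<and> set cs \<subseteq> W \<and> hd cs = Q \<and> last cs = S \<and>
     (\<forall>j. Suc j < length cs \<longrightarrow> closure (cs ! j) \<inter> closure (cs ! Suc j) \<noteq> {})"

text \<open>j0 (0-indexed) witnesses epsilon-admissibility; cs ! j0 is then the central cube.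
  The 1-indexed condition j0 < M becomes Suc j0 < M.\<close>
definition admissible_center :: "real \<Rightarrow> 'a::euclidean_space set list \<Rightarrow> nat \<Rightarrow> bool" where
  "admissible_center \<epsilon> cs j0 \<longleftrightarrow> Suc j0 < length cs \<and>
     (\<forall>j\<le>j0. side (cs ! j) \<ge> \<epsilon> * DD (hd cs) (cs ! j)) \<and>
     (\<forall>j. j0 \<le> j \<and> j < length cs \<longrightarrow> side (cs ! j) \<ge> \<epsilon> * DD (cs ! j) (last cs))"

definition admissible_chain :: "real \<Rightarrow> 'a::euclidean_space set set \<Rightarrow> 'a set \<Rightarrow> 'a set \<Rightarrow> 'a set list \<Rightarrow> bool" where
  "admissible_chain \<epsilon> W Q S cs \<longleftrightarrow> is_chain W Q S cs \<and>
     (\<Sum>j<length cs. side (cs ! j)) \<le> DD Q S / \<epsilon> \<and>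
     (\<exists>j0. admissible_center \<epsilon> cs j0)"

definition uniform_domain :: "real \<Rightarrow> 'a::euclidean_space set \<Rightarrow> 'a set set \<Rightarrow> bool" where
  "uniform_domain \<epsilon> \<Omega> W \<longleftrightarrow> open \<Omega> \<and> connected \<Omega> \<and> \<Omega> \<noteq> {} \<and> 0 < \<epsilon> \<and> whitney_covering \<Omega> W \<and>
     (\<forall>Q\<in>W. \<forall>S\<in>W. \<exists>cs. admissible_chain \<epsilon> W Q S cs)"

definition SHr :: "'a::euclidean_space set set \<Rightarrow> real \<Rightarrow> 'a set \<Rightarrow> 'a set set" where
  "SHr W \<rho> P = {Q\<in>W. Q \<subseteq> ball (center P) (\<rho> * side P)}"

definition Shr :: "'a::euclidean_space set set \<Rightarrow> real \<Rightarrow> 'a set \<Rightarrow> 'a set" where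
  "Shr W \<rho> P = \<Union>(SHr W \<rho> P)"

definition shadow_param :: "real \<Rightarrow> 'a::euclidean_space set set \<Rightarrow> real \<Rightarrow> bool" where
  "shadow_param \<epsilon> W \<rho> \<longleftrightarrow> \<rho> > 1 \<and>
     (\<forall>Q\<in>W. \<forall>S\<in>W. \<forall>cs j0. admissible_chain \<epsilon> W Q S cs \<and> admissible_center \<epsilon> cs j0 \<longrightarrow>
        (\<forall>j\<le>j0. Q \<in> SHr W \<rho> (cs ! j)) \<and>
        (\<forall>j<length cs. cs ! j \<in> SHr W \<rho> (cs ! j0)))"

definition enn_powr :: "ennreal \<Rightarrow> real \<Rightarrow> ennreal" where
  "enn_powr x r = (if x = \<infinity> then \<infinity> else ennreal (enn2real x powr r))"

definition locally_integrable :: "'a::euclidean_space set \<Rightarrow> ('a \<Rightarrow> real) \<Rightarrow> bool" where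
  "locally_integrable \<Omega> f \<longleftrightarrow> (\<forall>K. compact K \<and> K \<subseteq> \<Omega> \<longrightarrow> set_integrable lebesgue K f)"

definition inner_term :: "real \<Rightarrow> real \<Rightarrow> ereal \<Rightarrow> ('a::euclidean_space \<Rightarrow> real) \<Rightarrow> 'a set \<Rightarrow> 'a \<Rightarrow> ennreal" where
  "inner_term s p q f A x =
     (if q = \<infinity> then esssup (lebesgue_on A) (\<lambda>y. ennreal (\<bar>f x - f y\<bar> powr p / dist x y powr (s * p)))
      else enn_powr (\<integral>\<^sup>+ y\<in>A. ennreal (\<bar>f x - f y\<bar> powr (real_of_ereal q)
                       / dist x y powr (s * real_of_ereal q + real DIM('a))) \<partial>lebesgue)
             (p / real_of_ereal q))"

end

(* Neighbouring cubes have sides of ratio at most 2, and eps <= 1/3, because otherwise the domain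
   would be a finite union of closed cubes; hence every neighbour of Q lies in the shadow of Q.
   So if x is in Q and y is in a cube S outside the shadow of Q, then |x - y| is comparable to the side of the
   central cube P of an admissible chain [Q, S], and both Q and S lie in the shadow of P.  In each cube R choose
   a point z_R at which the inner term over Sh(R) does not exceed its average H_R^p over R.  Then
   |f(x) - f(y)| <= |f(x) - f(z_P)| + |f(z_P) - f(y)|, where the second summand is controlled by H_P and the
   first telescopes along the chain from Q to P, each R of which has Q in its shadow.  This bounds the full inner
   term at x by the one over Sh(Q) plus (sum of H_R^q over the R that have Q in their shadow)^(p/q).  For p <= q
   subadditivity allows one to integrate this; for p > q Hoelder's inequality costs weights (side R / side Q)^eta, which
   are integrable over Sh(R) because the small cubes accumulate only on a porous set. *)
theory Submission
  imports Defs
begin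

section \<open>Dyadic cubes\<close>

text \<open>The kernel is singular on the diagonal and no chain helps there: for neighbouring
  \<open>Q\<close> and \<open>S\<close> the distance |x - y| may be far below both sides, so
  neighbours have to belong to the shadow. Shadows are described only through admissible chains,
  hence \<epsilon> must be bounded before the two-cube chain is available. The number of cubes in a
  chain is not bounded, so powers of sums must not cost a factor of its length. What saves the
  estimates: the cubes with \<open>Q\<close> in their shadow have sides at least side Q / (2
  \<rho>), and boundedly many of them share one side, so all sums along chains are geometric series.
  Sampling at points, instead of averaging f, gives estimates that read the same for finite and
  infinite q, with \<open>H\<close> independent of x. The exponent \<eta> meets two opposite
  demands: Hoelder needs \<eta> > 0, while a shadow may contain arbitrarily small cubes, so that
  integrating (side R / side Q)^\<eta> over it needs \<eta> small. Porosity fixes \<eta> first, from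
  \<epsilon>, \<rho> and the dimension alone.\<close>

lemma box_translate_One_eq:
  fixes a b :: "'a::euclidean_space"
  assumes "l > 0" "m > 0" "box a (a + l *\<^sub>R One) = box b (b + m *\<^sub>R One)"
  shows "a = b \<and> l = m"
proof -
  have ne: "box a (a + l *\<^sub>R One) \<noteq> {}"
    using assms(1) by (auto simp: box_ne_empty inner_simps)
  have ab: "a = b" "a + l *\<^sub>R One = b + m *\<^sub>R One"
    using ne assms(3) unfolding eq_box by auto
  then have "l *\<^sub>R (One::'a) = m *\<^sub>R One" by simp
  then have "l = m" by (simp add: scaleR_cancel_right)
  with ab show ?thesis by simp
qed

lemma side_cube:
  fixes a :: "'a::euclidean_space"
  assumes "l > 0"
  shows "side (box a (a + l *\<^sub>R One)) = l"
  unfolding side_def using assms box_translate_One_eq by (intro the_equality) blast+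

lemma center_cube:
  fixes a :: "'a::euclidean_space"
  assumes "l > 0"
  shows "center (box a (a + l *\<^sub>R One)) = a + (l / 2) *\<^sub>R One"
  unfolding center_def side_cube[OF assms]
  by (rule the_equality, blast) (metis assms box_translate_One_eq)

lemma dyadic_cube_side:
  assumes "dyadic_cube Q"
  obtains k :: int where "side Q = 2 powr k"
  using assms unfolding dyadic_cube_def by (metis side_cube powr_gt_zero zero_neq_numeral)

lemma dyadic_cube_side_pos: "dyadic_cube Q \<Longrightarrow> side Q > 0"
  by (metis dyadic_cube_side powr_gt_zero zero_neq_numeral)

lemma dyadic_cube_eq_box:
  fixes Q :: "'a::euclidean_space set"
  assumes "dyadic_cube Q"
  shows "Q = box (center Q - (side Q / 2) *\<^sub>R One) (center Q + (side Q / 2) *\<^sub>R One)"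
proof -
  obtain k :: int and a where Q: "Q = box a (a + (2 powr k) *\<^sub>R One)"
    using assms unfolding dyadic_cube_def by auto
  then have "side Q = 2 powr k" "center Q = a + (2 powr k / 2) *\<^sub>R One"
    using side_cube[of "2 powr k" a] center_cube[of "2 powr k" a] by auto
  then show ?thesis using Q by (simp add: algebra_simps flip: scaleR_add_left)
qed

lemma dyadic_cube_corner:
  fixes Q :: "'a::euclidean_space set"
  assumes "dyadic_cube Q" "i \<in> Basis"
  obtains m :: int where "center Q \<bullet> i - side Q / 2 = side Q * of_int m"
proof -
  obtain k :: int and a where Q: "Q = box a (a + (2 powr k) *\<^sub>R One)"
    and a: "\<forall>i\<in>Basis. \<exists>m::int. a \<bullet> i = 2 powr k * of_int m"
    using assms unfolding dyadic_cube_def by auto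
  then have "side Q = 2 powr k" "center Q = a + (2 powr k / 2) *\<^sub>R One"
    using side_cube[of "2 powr k" a] center_cube[of "2 powr k" a] by auto
  then show ?thesis using a assms(2) that by (force simp: inner_simps)
qed

lemma mem_dyadic_cube:
  fixes Q :: "'a::euclidean_space set"
  assumes "dyadic_cube Q"
  shows "x \<in> Q \<longleftrightarrow> (\<forall>i\<in>Basis. \<bar>(x - center Q) \<bullet> i\<bar> < side Q / 2)"
  unfolding subst[OF dyadic_cube_eq_box[OF assms], of "\<lambda>Q'. x \<in> Q \<longleftrightarrow> x \<in> Q'", OF refl] mem_box
  by (intro ball_cong refl) (simp add: inner_simps abs_diff_less_iff del: less_divide_eq_numeral1)

lemma mem_closure_dyadic_cube:
  fixes Q :: "'a::euclidean_space set"
  assumes "dyadic_cube Q"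
  shows "x \<in> closure Q \<longleftrightarrow> (\<forall>i\<in>Basis. \<bar>(x - center Q) \<bullet> i\<bar> \<le> side Q / 2)"
proof -
  have "box (center Q - (side Q / 2) *\<^sub>R One) (center Q + (side Q / 2) *\<^sub>R One) \<noteq> {}"
    using dyadic_cube_side_pos[OF assms] by (auto simp: box_ne_empty inner_simps)
  then have "closure Q = cbox (center Q - (side Q / 2) *\<^sub>R One) (center Q + (side Q / 2) *\<^sub>R One)"
    by (metis dyadic_cube_eq_box[OF assms] closure_box)
  then show ?thesis
    by (simp add: mem_box inner_simps abs_diff_le_iff del: le_divide_eq_numeral1 cong: ball_cong)
qed

lemma dyadic_cube_center_mem: "dyadic_cube Q \<Longrightarrow> center Q \<in> Q"
  by (simp add: mem_dyadic_cube dyadic_cube_side_pos)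

lemma dyadic_cube_open: "dyadic_cube Q \<Longrightarrow> open Q"
  by (metis dyadic_cube_eq_box open_box)

lemma mem_dilate: "x \<in> dilate r Q \<longleftrightarrow> (\<forall>i\<in>Basis. \<bar>(x - center Q) \<bullet> i\<bar> < r * side Q / 2)"
  by (simp add: dilate_def mem_box inner_simps abs_diff_less_iff del: less_divide_eq_numeral1 cong: ball_cong)

lemma dyadic_cube_measure:
  fixes Q :: "'a::euclidean_space set"
  assumes "dyadic_cube Q"
  shows "measure lebesgue Q = side Q ^ DIM('a)" "Q \<in> lmeasurable"
proof -
  have "measure lebesgue Q = (\<Prod>i\<in>(Basis::'a set). side Q)"
    using dyadic_cube_side_pos[OF assms]
    by (subst dyadic_cube_eq_box[OF assms]) (simp add: measure_lborel_box_eq inner_simps)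
  then show "measure lebesgue Q = side Q ^ DIM('a)" by simp
  show "Q \<in> lmeasurable"
    by (metis dyadic_cube_eq_box[OF assms] lmeasurable_box)
qed

lemma dyadic_cube_frontier_null:
  fixes Q :: "'a::euclidean_space set"
  assumes "dyadic_cube Q"
  shows "closure Q - Q \<in> null_sets lebesgue"
proof -
  have "convex Q" by (subst dyadic_cube_eq_box[OF assms]) (rule convex_box)
  then have "negligible (frontier Q)" by (rule negligible_convex_frontier)
  moreover have "closure Q - Q = frontier Q"
    using dyadic_cube_open[OF assms] by (simp add: frontier_def interior_open)
  ultimately show ?thesis by (simp add: negligible_iff_null_sets)
qed

lemma box_closures_meet:
  fixes c c' :: "'a::euclidean_space"
  assumes "\<And>i. i \<in> Basis \<Longrightarrow> \<bar>(c - c') \<bullet> i\<bar> \<le> r + r'" "0 \<le> r" "0 \<le> r'"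
  obtains z where "\<And>i. i \<in> Basis \<Longrightarrow> \<bar>(z - c) \<bullet> i\<bar> \<le> r \<and> \<bar>(z - c') \<bullet> i\<bar> \<le> r'"
proof
  \<comment> \<open>In each coordinate, the point of the interval of radius r about c that is
    nearest to c'.\<close>
  define z where "z = (\<Sum>i\<in>Basis. (max (c \<bullet> i - r) (min (c \<bullet> i + r) (c' \<bullet> i))) *\<^sub>R i)"
  fix i :: 'a assume i: "i \<in> Basis"
  have "z \<bullet> i = max (c \<bullet> i - r) (min (c \<bullet> i + r) (c' \<bullet> i))"
    unfolding z_def using i by simp
  then show "\<bar>(z - c) \<bullet> i\<bar> \<le> r \<and> \<bar>(z - c') \<bullet> i\<bar> \<le> r'"
    using assms(1)[OF i] assms(2,3) unfolding inner_diff_left by linarith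
qed

text \<open>Coordinatewise, the gap between two dyadic intervals of lengths \<open>l\<close> and \<open>l\<close> or \<open>l/2\<close>
  is a multiple of \<open>l/2\<close>.\<close>
lemma dyadic_cube_gap:
  fixes Q S :: "'a::euclidean_space set"
  assumes Q: "dyadic_cube Q" and S: "dyadic_cube S"
    and le: "side Q \<le> side S" "side S / 2 \<le> side Q"
    and near: "\<And>i. i \<in> Basis \<Longrightarrow> \<bar>(center Q - center S) \<bullet> i\<bar> < side Q / 2 + side S"
  shows "closure Q \<inter> closure S \<noteq> {}"
proof -
  have pos: "side Q > 0" "side S > 0" using Q S dyadic_cube_side_pos by auto
  have ratio: "side S = side Q \<or> side S = 2 * side Q"
  proof -
    obtain k l :: int where kl: "side Q = 2 powr k" "side S = 2 powr l"
      using Q S dyadic_cube_side by metis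
    have "k \<le> l" using le(1) kl by simp
    moreover have "2 powr (l - 1) \<le> 2 powr k"
      using le(2) kl by (simp add: powr_diff)
    then have "l \<le> k + 1" by simp
    ultimately have "l = k \<or> l = k + 1" by linarith
    then show ?thesis using kl by (auto simp: powr_add)
  qed
  have "\<bar>(center Q - center S) \<bullet> i\<bar> \<le> side Q / 2 + side S / 2" if i: "i \<in> Basis" for i
  proof -
    obtain m n :: int where m: "center Q \<bullet> i - side Q / 2 = side Q * of_int m"
      and n: "center S \<bullet> i - side S / 2 = side S * of_int n"
      using dyadic_cube_corner[OF Q i] dyadic_cube_corner[OF S i] by metis
    define l where "l = side S / 2"
    have l: "l > 0" using pos l_def by simp
    \<comment> \<open>Both cubes have their corners on the grid of mesh l: \<open>a\<close> is side
      Q and \<open>b\<close> the lower corner of \<open>Q\<close> in units of l, while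
      \<open>S\<close> has lower corner 2 n and side 2.\<close>
    obtain a b :: int where ab: "a = 1 \<or> a = 2" "side Q = l * of_int a" "center Q \<bullet> i - side Q / 2 = l * of_int b"
    proof (cases "side S = side Q")
      case True then show ?thesis using m that[of 2 "2*m"] by (simp add: l_def)
    next
      case False then show ?thesis using m ratio that[of 1 m] by (simp add: l_def)
    qed
    have S': "center S \<bullet> i = l * of_int (2 * n + 1)" "side S = 2 * l" using n by (auto simp: l_def algebra_simps)
    have Q': "center Q \<bullet> i = l * (of_int b + of_int a / 2)" using ab by (auto simp: algebra_simps)
    have factor: "\<bar>l * (of_int b + of_int a / 2) - l * of_int (2 * n + 1)\<bar> = l * \<bar>of_int b + of_int a / 2 - of_int (2 * n + 1)\<bar>"
      using l by (simp only: right_diff_distrib[symmetric] abs_mult abs_of_pos)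
    have "\<bar>l * (of_int b + of_int a / 2) - l * of_int (2 * n + 1)\<bar> < l * of_int a / 2 + 2 * l"
      using near[OF i] unfolding inner_diff_left Q' S' ab(2) by simp
    moreover note factor
    moreover have "l * of_int a / 2 + 2 * l = l * (of_int a / 2 + 2)" by (simp add: algebra_simps)
    ultimately have "\<bar>of_int b + of_int a / 2 - of_int (2 * n + 1)\<bar> < (of_int a / 2 + 2 :: real)"
      using l by (metis mult_less_cancel_left_pos)
    then have "real_of_int (2*n+1) - of_int b < of_int a + 2" "real_of_int b - of_int (2*n+1) < 2"
      by linarith+
    \<comment> \<open>A strict inequality between integers gains a whole unit: a gap below one mesh
      is no gap.\<close>
    then have "2*n+1 - b < a + 2" "b - (2*n+1) < 2" by linarith+
    then have "2*n+1-b \<le> a + 1" "b - (2*n+1) \<le> 1" by linarith+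
    then have "real_of_int (2*n+1) - of_int b \<le> of_int a + 1" "real_of_int b - of_int (2*n+1) \<le> 1"
      by linarith+
    then have "\<bar>of_int b + of_int a / 2 - of_int (2 * n + 1)\<bar> \<le> (of_int a / 2 + 1 :: real)" by linarith
    then have "l * \<bar>of_int b + of_int a / 2 - of_int (2 * n + 1)\<bar> \<le> l * (of_int a / 2 + 1)"
      using l by simp
    moreover note factor
    moreover have "l * of_int a / 2 + l = l * (of_int a / 2 + 1)" by (simp add: algebra_simps)
    ultimately have "\<bar>l * (of_int b + of_int a / 2) - l * of_int (2 * n + 1)\<bar> \<le> l * of_int a / 2 + l"
      by metis
    then show ?thesis unfolding inner_diff_left Q' S' ab(2) by simp
  qed
  then obtain z where "\<And>i. i \<in> Basis \<Longrightarrow> \<bar>(z - center Q) \<bullet> i\<bar> \<le> side Q / 2 \<and> \<bar>(z - center S) \<bullet> i\<bar> \<le> side S / 2"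
    using box_closures_meet[of "center Q" "center S" "side Q / 2" "side S / 2"] pos by auto
  then show ?thesis using mem_closure_dyadic_cube Q S by blast
qed

section \<open>Whitney cubes, chains and shadows\<close>

abbreviation meet :: "'a::euclidean_space set \<Rightarrow> 'a set \<Rightarrow> bool" where
  "meet Q S \<equiv> closure Q \<inter> closure S \<noteq> {}"

locale uniform_shadow =
  fixes \<Omega> :: "'a::euclidean_space set" and W :: "'a set set" and \<epsilon> \<rho> :: real
  assumes unif: "uniform_domain \<epsilon> \<Omega> W"
    and rho: "shadow_param \<epsilon> W \<rho>"
begin

abbreviation SH where "SH \<equiv> SHr W \<rho>"

lemma eps_pos: "\<epsilon> > 0" and rho_gt1: "\<rho> > 1"
  using unif rho unfolding uniform_domain_def shadow_param_def by auto

lemma whitney: "whitney_covering \<Omega> W"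
  using unif unfolding uniform_domain_def by auto

lemma W_dyadic: "Q \<in> W \<Longrightarrow> dyadic_cube Q"
  using whitney unfolding whitney_covering_def by auto

lemma W_disjoint: "pairwise disjnt W"
  using whitney unfolding whitney_covering_def by auto

lemma W_cover: "\<Union>(closure ` W) = \<Omega>"
  using whitney unfolding whitney_covering_def by auto

lemma W_subset: "Q \<in> W \<Longrightarrow> Q \<subseteq> \<Omega>"
  using W_cover closure_subset by blast

lemma W_five: "Q \<in> W \<Longrightarrow> S \<in> W \<Longrightarrow> S \<subseteq> dilate 5 Q \<Longrightarrow> side S \<ge> side Q / 2"
  using whitney unfolding whitney_covering_def by auto

lemma side_pos: "Q \<in> W \<Longrightarrow> side Q > 0"
  using W_dyadic dyadic_cube_side_pos by blast

lemma W_open: "Q \<in> W \<Longrightarrow> open Q"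
  using W_dyadic dyadic_cube_open by blast

lemma W_countable: "countable W"
  using countable_disjoint_open_subsets W_open W_disjoint by blast

lemma W_measure: "Q \<in> W \<Longrightarrow> measure lebesgue Q = side Q ^ DIM('a)" "Q \<in> W \<Longrightarrow> Q \<in> lmeasurable"
  using W_dyadic dyadic_cube_measure by blast+

lemma W_mem: "Q \<in> W \<Longrightarrow> x \<in> Q \<longleftrightarrow> (\<forall>i\<in>Basis. \<bar>(x - center Q) \<bullet> i\<bar> < side Q / 2)"
  using W_dyadic mem_dyadic_cube by blast

lemma center_mem: "Q \<in> W \<Longrightarrow> center Q \<in> Q"
  using W_dyadic dyadic_cube_center_mem by blast

lemma setdist_W_ltE:
  assumes "setdist P Q < b" "P \<in> W" "Q \<in> W"
  obtains u v where "u \<in> P" "v \<in> Q" "dist u v < b"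
  using setdist_ltE[OF assms(1)] center_mem[OF assms(2)] center_mem[OF assms(3)] by blast

text \<open>A gap below half the larger side puts \<open>Q\<close> inside \<open>dilate 5 S\<close>,
  so the Whitney condition bounds the ratio of the sides by 2; dyadic alignment then closes the
  gap.\<close>

lemma close_cubes:
  assumes "Q \<in> W" "S \<in> W" "side Q \<le> side S"
    and near: "\<And>i. i \<in> Basis \<Longrightarrow> \<bar>(center Q - center S) \<bullet> i\<bar> < side Q / 2 + side S"
  shows "side S / 2 \<le> side Q \<and> meet Q S"
proof -
  have "Q \<subseteq> dilate 5 S"
  proof
    fix x assume x: "x \<in> Q"
    show "x \<in> dilate 5 S"
      unfolding mem_dilate
    proof
      fix i :: 'a assume i: "i \<in> Basis"
      have "\<bar>(x - center Q) \<bullet> i\<bar> < side Q / 2" using x i assms(1) W_mem by blast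
      then show "\<bar>(x - center S) \<bullet> i\<bar> < 5 * side S / 2"
        using near[OF i] assms(3) unfolding inner_diff_left by linarith
    qed
  qed
  then have "side S / 2 \<le> side Q" using W_five assms by blast
  then show ?thesis using dyadic_cube_gap[of Q S] assms W_dyadic by blast
qed

lemma meet_centers:
  assumes "Q \<in> W" "S \<in> W" "meet Q S" "i \<in> Basis"
  shows "\<bar>(center Q - center S) \<bullet> i\<bar> \<le> side Q / 2 + side S / 2"
proof -
  obtain z where "z \<in> closure Q" "z \<in> closure S" using assms by blast
  then have "\<bar>(z - center Q) \<bullet> i\<bar> \<le> side Q / 2" "\<bar>(z - center S) \<bullet> i\<bar> \<le> side S / 2"
    using assms mem_closure_dyadic_cube W_dyadic by blast+
  then show ?thesis unfolding inner_diff_left by linarith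
qed

lemma meet_side:
  assumes "Q \<in> W" "S \<in> W" "meet Q S"
  shows "side S \<le> 2 * side Q"
proof (cases "side Q \<le> side S")
  case True
  then have "side S / 2 \<le> side Q"
    using close_cubes[of Q S] meet_centers[of Q S] assms side_pos[of S] by force
  then show ?thesis by simp
next
  case False then show ?thesis using side_pos[OF assms(1)] by simp
qed

text \<open>By \<open>close_cubes\<close>, cubes that do not meet are separated in some coordinate
  by at least half the larger side. The auxiliary fact treats side Q \<le> side S, the other case is
  symmetric.\<close>

lemma not_meet_dist:
  assumes "Q \<in> W" "S \<in> W" "\<not> meet Q S" "x \<in> Q" "y \<in> S"
  shows "side Q \<le> 2 * dist x y" "side S \<le> 2 * dist x y"
proof -
  have *: "side Q \<le> 2 * dist x y \<and> side S \<le> 2 * dist x y"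
    if "Q \<in> W" "S \<in> W" "\<not> meet Q S" "x \<in> Q" "y \<in> S" "side Q \<le> side S" for Q S x y
  proof -
    have "\<exists>i\<in>Basis. \<bar>(center Q - center S) \<bullet> i\<bar> \<ge> side Q / 2 + side S"
    proof (rule ccontr)
      assume "\<not> ?thesis"
      then have "\<bar>(center Q - center S) \<bullet> i\<bar> < side Q / 2 + side S" if "i \<in> Basis" for i
        using that by (simp add: not_le)
      then show False using close_cubes[OF that(1,2,6)] that(3) by blast
    qed
    then obtain i where i: "i \<in> Basis" "\<bar>(center Q - center S) \<bullet> i\<bar> \<ge> side Q / 2 + side S"
      by blast
    have "\<bar>(x - center Q) \<bullet> i\<bar> < side Q / 2" "\<bar>(y - center S) \<bullet> i\<bar> < side S / 2"
      using that i W_mem by blast+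
    then have "side S / 2 \<le> \<bar>(x - y) \<bullet> i\<bar>" using i unfolding inner_diff_left by linarith
    also have "\<dots> \<le> dist x y" using Basis_le_norm i(1) by (auto simp: dist_norm)
    finally show ?thesis using that by auto
  qed
  show "side Q \<le> 2 * dist x y" "side S \<le> 2 * dist x y"
    using *[OF assms] *[of S Q y x] assms by (cases "side Q \<le> side S"; simp add: dist_commute Int_commute)+
qed

text \<open>Packing by volume: the cubes are disjoint and each fills at least m^d of the
  ball.\<close>

lemma card_cubes_le:
  assumes F: "F \<subseteq> W" and m: "0 < m" "\<And>Q. Q \<in> F \<Longrightarrow> m \<le> side Q" and r: "0 \<le> r" "\<And>Q. Q \<in> F \<Longrightarrow> Q \<subseteq> ball c r"
  shows "finite F" "real (card F) \<le> unit_ball_vol (real DIM('a)) * (r / m) ^ DIM('a)"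
proof -
  have FW: "Q \<in> lmeasurable" "Q \<in> sets lebesgue" if "Q \<in> F" for Q
    using that F W_measure(2) fmeasurableD by blast+
  have bd: "real (card G) \<le> unit_ball_vol (real DIM('a)) * (r / m) ^ DIM('a)" if G: "G \<subseteq> F" "finite G" for G
  proof -
    have "real (card G) * m ^ DIM('a) = (\<Sum>Q\<in>G. m ^ DIM('a))" by simp
    also have "\<dots> \<le> (\<Sum>Q\<in>G. measure lebesgue Q)"
    proof (rule sum_mono)
      fix Q assume "Q \<in> G"
      then have "Q \<in> W" "m \<le> side Q" using G F m by auto
      then show "m ^ DIM('a) \<le> measure lebesgue Q" using W_measure m(1) by (simp add: power_mono)
    qed
    also have "\<dots> = measure lebesgue (\<Union>Q\<in>G. Q)"
      using G F W_measure pairwise_subset[OF W_disjoint, of G] by (intro measure_UNION'[symmetric]) auto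
    also have "\<dots> \<le> measure lebesgue (ball c r)"
      using G r FW by (intro measure_mono_fmeasurable sets.finite_UN) auto
    also have "\<dots> = unit_ball_vol (real DIM('a)) * r ^ DIM('a)"
      using r by (simp add: content_ball)
    finally show ?thesis using m by (simp add: field_simps)
  qed
  have "finite F \<and> card F \<le> nat \<lfloor>unit_ball_vol (real DIM('a)) * (r / m) ^ DIM('a)\<rfloor>"
    by (rule finite_if_finite_subsets_card_bdd) (use bd le_nat_floor in blast)
  then show "finite F" by blast
  then show "real (card F) \<le> unit_ball_vol (real DIM('a)) * (r / m) ^ DIM('a)" using bd by blast
qed

lemma chain_exists:
  assumes "Q \<in> W" "S \<in> W"
  obtains cs j where "admissible_chain \<epsilon> W Q S cs" "admissible_center \<epsilon> cs j"
  using unif assms unfolding uniform_domain_def admissible_chain_def by blast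

lemma center_DD:
  assumes "admissible_chain \<epsilon> W Q S cs" "admissible_center \<epsilon> cs j"
  shows "cs ! j \<in> W" "\<epsilon> * DD Q (cs ! j) \<le> side (cs ! j)" "\<epsilon> * DD (cs ! j) S \<le> side (cs ! j)"
proof -
  have cs: "set cs \<subseteq> W" "hd cs = Q" "last cs = S"
    using assms(1) unfolding admissible_chain_def is_chain_def by auto
  have j: "Suc j < length cs" "\<epsilon> * DD (hd cs) (cs ! j) \<le> side (cs ! j)" "\<epsilon> * DD (cs ! j) (last cs) \<le> side (cs ! j)"
    using assms(2) unfolding admissible_center_def by auto
  show "cs ! j \<in> W" using cs(1) j(1) by (meson Suc_lessD nth_mem subsetD)
  show "\<epsilon> * DD Q (cs ! j) \<le> side (cs ! j)" "\<epsilon> * DD (cs ! j) S \<le> side (cs ! j)" using cs j by auto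
qed

text \<open>If \<epsilon> > 1/3, the ends of every chain lie in \<open>dilate 5 P\<close> for its
  central cube \<open>P\<close>, so the Whitney condition makes their sides comparable to that of
  \<open>P\<close>. All cubes are then comparable to a fixed one and stay in a fixed ball, so
  packing leaves finitely many; \<Omega> would be compact besides open and nonempty.\<close>

lemma eps_le_third: "\<epsilon> \<le> 1/3"
proof (rule ccontr)
  assume "\<not> \<epsilon> \<le> 1/3"
  then have e: "\<epsilon> > 1/3" by simp
  have third: "DD A B < 3 * side A" if AB: "A \<in> W" "B \<in> W" "\<epsilon> * DD A B \<le> side A" for A B
  proof -
    have "DD A B > 0" unfolding DD_def using side_pos[OF AB(1)] side_pos[OF AB(2)] setdist_pos_le[of A B] by linarith
    from mult_strict_right_mono[OF e this] show ?thesis using AB(3) by linarith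
  qed
  have near: "side P \<le> 2 * side Q \<and> setdist P Q < 2 * side P"
    if "Q \<in> W" "P \<in> W" "\<epsilon> * DD P Q \<le> side P" for P Q
  proof -
    have pos: "side Q > 0" "side P > 0" using that side_pos by auto
    have *: "setdist P Q < 2 * side P - side Q"
      using third[OF \<open>P \<in> W\<close> \<open>Q \<in> W\<close> that(3)] unfolding DD_def by linarith
    then obtain u v where uv: "u \<in> P" "v \<in> Q" "dist u v < 2 * side P - side Q"
      using setdist_W_ltE[OF * \<open>P \<in> W\<close> \<open>Q \<in> W\<close>] by blast
    \<comment> \<open>The distances add up to side Q + (2 side P - side Q) + side P / 2, exactly the
      half side of \<open>dilate 5 P\<close>.\<close>
    have "Q \<subseteq> dilate 5 P"
    proof
      fix x assume x: "x \<in> Q"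
      show "x \<in> dilate 5 P" unfolding mem_dilate
      proof
        fix i :: 'a assume i: "i \<in> Basis"
        have "\<bar>(x - center Q) \<bullet> i\<bar> < side Q / 2" "\<bar>(v - center Q) \<bullet> i\<bar> < side Q / 2"
          "\<bar>(u - center P) \<bullet> i\<bar> < side P / 2"
          using x uv i that W_mem by blast+
        moreover have "\<bar>(u - v) \<bullet> i\<bar> < 2 * side P - side Q"
          using Basis_le_norm[OF i, of "u - v"] uv(3) by (simp add: dist_norm)
        ultimately show "\<bar>(x - center P) \<bullet> i\<bar> < 5 * side P / 2"
          unfolding inner_diff_left by linarith
      qed
    qed
    then show ?thesis using W_five[of P Q] that * pos by auto
  qed
  have DDc: "DD A B = DD B A" for A B :: "'a set" by (simp add: DD_def setdist_sym)
  obtain Q where Q: "Q \<in> W"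
    using unif W_cover unfolding uniform_domain_def by fastforce
  \<comment> \<open>Since side P \<le> 2 side Q and side T < 4 side Q, the path from the center of
    \<open>Q\<close> through \<open>P\<close> into \<open>T\<close> crosses three diameters,
    together at most 7 d side Q, and two gaps of at most 4 side Q each.\<close>
  define C where "C = ball (center Q) ((7 * real DIM('a) + 8) * side Q)"
  have all: "side Q / 4 \<le> side T \<and> closure T \<subseteq> C" if T: "T \<in> W" for T
  proof -
    obtain cs j where cs: "admissible_chain \<epsilon> W Q T cs" "admissible_center \<epsilon> cs j"
      using chain_exists Q T by blast
    define P where "P = cs ! j"
    have P: "P \<in> W" "\<epsilon> * DD P Q \<le> side P" "\<epsilon> * DD P T \<le> side P"
      using center_DD[OF cs] DDc unfolding P_def by auto
    have pos: "side Q > 0" "side P > 0" "side T > 0" using side_pos P T Q by auto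
    have 1: "side P \<le> 2 * side Q" "setdist P Q < 2 * side P" using near[of Q P] Q P by auto
    have 2: "side P \<le> 2 * side T" "setdist P T < 2 * side P" using near[of T P] T P by auto
    have "side T < 2 * side P" using third[OF P(1) T P(3)] setdist_pos_le[of P T] unfolding DD_def by linarith
    then have T4: "side T < 4 * side Q" using 1 by simp
    have "side Q < 2 * side P" using third[OF P(1) Q P(2)] setdist_pos_le[of P Q] unfolding DD_def by linarith
    then have T5: "side Q / 4 \<le> side T" using 2 by simp
    obtain u v where uv: "u \<in> P" "v \<in> Q" "dist u v < 2 * side P"
      using setdist_W_ltE[OF 1(2) P(1) Q] by blast
    obtain u' w where uw: "u' \<in> P" "w \<in> T" "dist u' w < 2 * side P"
      using setdist_W_ltE[OF 2(2) P(1) T] by blast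
    have diam: "dist a b \<le> real DIM('a) * side R" if "R \<in> W" "a \<in> closure R" "b \<in> closure R" for a b R
    proof -
      have *: "\<forall>i\<in>Basis. \<bar>(a - center R) \<bullet> i\<bar> \<le> side R / 2" "\<forall>i\<in>Basis. \<bar>(b - center R) \<bullet> i\<bar> \<le> side R / 2"
        using that mem_closure_dyadic_cube W_dyadic by blast+
      have "norm (a - b) \<le> (\<Sum>i\<in>Basis. \<bar>(a - b) \<bullet> i\<bar>)" by (rule norm_le_l1)
      also have "\<dots> \<le> (\<Sum>i\<in>(Basis::'a set). side R)"
      proof (rule sum_mono)
        fix i :: 'a assume i: "i \<in> Basis"
        show "\<bar>(a - b) \<bullet> i\<bar> \<le> side R" using *[THEN bspec, OF i] unfolding inner_diff_left by linarith
      qed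
      finally show ?thesis by (simp add: dist_norm)
    qed
    have "z \<in> C" if z: "z \<in> closure T" for z
    proof -
      have w: "w \<in> closure T" "u \<in> closure P" "u' \<in> closure P" "v \<in> closure Q" "center Q \<in> closure Q"
        using uv uw closure_subset Q center_mem by blast+
      let ?d = "real DIM('a)"
      have "dist (center Q) z \<le> dist (center Q) v + dist v u + dist u u' + dist u' w + dist w z"
        using dist_triangle[of "center Q" z v] dist_triangle[of v z u] dist_triangle[of u z u'] dist_triangle[of u' z w]
        by linarith
      also have "\<dots> < ?d * side Q + 2 * side P + ?d * side P + 2 * side P + ?d * side T"
        using diam[OF Q w(5,4)] diam[OF P(1) w(2,3)] diam[OF T w(1) z] uv uw by (simp add: dist_commute)
      also have "\<dots> \<le> ?d * side Q + 4 * (2 * side Q) + ?d * (2 * side Q) + ?d * (4 * side Q)"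
        using 1(1) mult_left_mono[OF 1(1), of ?d] mult_left_mono[OF less_imp_le[OF T4], of ?d] by linarith
      also have "\<dots> = (7 * ?d + 8) * side Q" by (simp add: algebra_simps)
      finally show ?thesis by (simp add: C_def)
    qed
    then show ?thesis using T5 by blast
  qed
  have "finite W"
    using all side_pos[OF Q] closure_subset unfolding C_def
    by (intro card_cubes_le(1)[of W "side Q / 4" "(7 * real DIM('a) + 8) * side Q" "center Q"]) fastforce+
  then have "closed \<Omega>" unfolding W_cover[symmetric] by (intro closed_Union) auto
  moreover have "bounded \<Omega>" using all unfolding W_cover[symmetric] C_def
    by (intro bounded_subset[OF bounded_ball]) blast
  ultimately show False using unif clopen[of \<Omega>] not_bounded_UNIV unfolding uniform_domain_def by blast
qed

section \<open>Shadows of neighbours and of central cubes\<close>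

lemma self_SH:
  assumes "Q \<in> W" shows "Q \<in> SH Q"
proof -
  obtain cs j where cs: "admissible_chain \<epsilon> W Q Q cs" "admissible_center \<epsilon> cs j"
    using chain_exists assms by blast
  \<comment> \<open>Property (i) of the shadow parameter at the first member of the chain, which is
    \<open>Q\<close> itself.\<close>
  then have "Q \<in> SH (cs ! 0)" using rho assms unfolding shadow_param_def by blast
  moreover have "cs ! 0 = Q" using cs unfolding admissible_chain_def is_chain_def by (auto simp: hd_conv_nth)
  ultimately show ?thesis by simp
qed

lemma SH_iff: "Q \<in> SH P \<longleftrightarrow> Q \<in> W \<and> Q \<subseteq> ball (center P) (\<rho> * side P)"
  by (simp add: SHr_def)

lemma SH_side:
  assumes "Q \<in> SH P" "P \<in> W"
  shows "side Q \<le> 2 * \<rho> * side P"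
proof -
  have Q: "Q \<in> W" "Q \<subseteq> ball (center P) (\<rho> * side P)" using assms by (auto simp: SH_iff)
  have pos: "side Q > 0" using side_pos Q by auto
  obtain i :: 'a where i: "i \<in> Basis" using nonempty_Basis by blast
  \<comment> \<open>Midpoints of two opposite faces, at distance exactly side Q.\<close>
  let ?a = "center Q + (side Q / 2) *\<^sub>R i" and ?b = "center Q - (side Q / 2) *\<^sub>R i"
  have "?a \<in> closure Q" "?b \<in> closure Q"
    using pos i by (auto simp: mem_closure_dyadic_cube[OF W_dyadic[OF Q(1)]] inner_Basis)
  then have "dist (center P) ?a \<le> \<rho> * side P" "dist (center P) ?b \<le> \<rho> * side P"
    using closure_minimal[OF subset_trans[OF Q(2) ball_subset_cball] closed_cball] by auto
  then have "dist ?a ?b \<le> 2 * (\<rho> * side P)"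
    using dist_triangle3[of ?a ?b "center P"] by linarith
  moreover have "?a - ?b = side Q *\<^sub>R i" by (simp flip: scaleR_add_left)
  then have "dist ?a ?b = side Q" unfolding dist_norm using i pos by simp
  ultimately show ?thesis by simp
qed

text \<open>The list \<open>[Q, S]\<close> with \<open>Q\<close> as central cube is shown to be an
  admissible chain, and property (ii) of the shadow parameter then applies. The condition at
  \<open>Q\<close> asks for \<epsilon> (side Q + side S) \<le> side Q; it follows from \<epsilon>
  \<le> 1/3 because side S \<le> 2 side Q.\<close>

lemma meet_SH:
  assumes "Q \<in> W" "S \<in> W" "meet Q S"
  shows "S \<in> SH Q"
proof -
  have sd: "side S \<le> 2 * side Q" "side Q > 0" "side S > 0"
    by (rule meet_side[OF assms], rule side_pos[OF assms(1)], rule side_pos[OF assms(2)])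
  obtain z where "z \<in> closure Q" "z \<in> closure S" using assms(3) by blast
  then have "setdist (closure Q) (closure S) = 0" by (rule setdist_eq_0I)
  then have "setdist Q S = 0" by (simp add: setdist_closure_1 setdist_closure_2)
  then have D: "DD Q S = side Q + side S" by (simp add: DD_def)
  have DDs: "DD A A = 2 * side A" if "A \<in> W" for A
    using setdist_eq_0I[OF center_mem[OF that] center_mem[OF that]] by (simp add: DD_def)
  have e3: "\<epsilon> * t \<le> t / 3" if "t \<ge> 0" for t using mult_right_mono[OF eps_le_third that] by simp
  have c: "admissible_center \<epsilon> [Q, S] 0" "(\<Sum>j<length [Q, S]. side ([Q, S] ! j)) \<le> DD Q S / \<epsilon>"
  proof -
    have "\<epsilon> * (2 * side Q) \<le> side Q" "\<epsilon> * (2 * side S) \<le> side S" "\<epsilon> * (side Q + side S) \<le> side Q"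
      using e3[of "2 * side Q"] e3[of "2 * side S"] e3[of "side Q + side S"] sd by argo+
    then show "admissible_center \<epsilon> [Q, S] 0"
      unfolding admissible_center_def using D DDs[OF assms(1)] DDs[OF assms(2)] by (auto simp: less_Suc_eq)
    have "\<epsilon> * (side Q + side S) \<le> side Q + side S" using e3[of "side Q + side S"] sd by argo
    then show "(\<Sum>j<length [Q, S]. side ([Q, S] ! j)) \<le> DD Q S / \<epsilon>"
      unfolding D using eps_pos by (simp add: lessThan_Suc pos_le_divide_eq field_simps)
  qed
  have "admissible_chain \<epsilon> W Q S [Q, S]"
    unfolding admissible_chain_def is_chain_def using assms c by auto
  then have "\<forall>j<length [Q, S]. [Q, S] ! j \<in> SH ([Q, S] ! 0)"
    using c rho assms unfolding shadow_param_def by blast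
  then show ?thesis by (auto dest: spec[of _ 1])
qed

lemma not_SH_dist:
  assumes "Q \<in> W" "S \<in> W" "S \<notin> SH Q" "x \<in> Q" "y \<in> S"
  shows "side Q \<le> 2 * dist x y" "side S \<le> 2 * dist x y" "DD Q S \<le> 5 * dist x y"
proof -
  show "side Q \<le> 2 * dist x y" "side S \<le> 2 * dist x y"
    using not_meet_dist assms meet_SH by blast+
  moreover have "setdist Q S \<le> dist x y" using assms by (intro setdist_le_dist)
  ultimately show "DD Q S \<le> 5 * dist x y" unfolding DD_def by linarith
qed

text \<open>The length of the chain bounds side P from above, admissibility towards \<open>S\<close>
  bounds it from below. Only the half from \<open>Q\<close> to \<open>P\<close> is recorded, because
  \<open>S\<close> is linked to \<open>P\<close> directly by the shadow of \<open>P\<close>.\<close>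

lemma central_cube:
  assumes "Q \<in> W" "S \<in> W"
  obtains P cs where "P \<in> W" "Q \<in> SH P" "S \<in> SH P" "\<epsilon> * side P \<le> DD Q S" "\<epsilon> * side S \<le> side P"
    "cs \<noteq> []" "hd cs = Q" "last cs = P" "successively meet cs" "set cs \<subseteq> W"
    "\<And>R. R \<in> set cs \<Longrightarrow> Q \<in> SH R \<and> side R \<le> 2 * \<rho> * side P"
proof -
  obtain cs j where cs: "admissible_chain \<epsilon> W Q S cs" "admissible_center \<epsilon> cs j"
    using chain_exists assms by blast
  have ch: "cs \<noteq> []" "set cs \<subseteq> W" "hd cs = Q" "last cs = S"
      "\<And>j. Suc j < length cs \<Longrightarrow> meet (cs ! j) (cs ! Suc j)"
      "(\<Sum>j<length cs. side (cs ! j)) \<le> DD Q S / \<epsilon>"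
    using cs(1) unfolding admissible_chain_def is_chain_def by auto
  have j: "Suc j < length cs" using cs(2) unfolding admissible_center_def by auto
  have sh: "\<And>i. i \<le> j \<Longrightarrow> Q \<in> SH (cs ! i)" "\<And>i. i < length cs \<Longrightarrow> cs ! i \<in> SH (cs ! j)"
    using cs rho assms unfolding shadow_param_def by blast+
  define P where "P = cs ! j"
  \<comment> \<open>The index j counts from 0, so \<open>Suc j\<close> members are taken and the
    central cube comes last.\<close>
  define ds where "ds = take (Suc j) cs"
  have P: "P \<in> W" "\<epsilon> * DD P S \<le> side P" using center_DD[OF cs] unfolding P_def by auto
  have "side P \<le> (\<Sum>j<length cs. side (cs ! j))"
    unfolding P_def using j by (intro member_le_sum) (auto intro!: less_imp_le side_pos subsetD[OF ch(2)])
  then have "side P \<le> DD Q S / \<epsilon>" using ch(6) by simp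
  then have 1: "\<epsilon> * side P \<le> DD Q S" using eps_pos by (simp add: field_simps)
  have "\<epsilon> * side S \<le> \<epsilon> * DD P S"
    using eps_pos side_pos[OF P(1)] setdist_pos_le[of P S] unfolding DD_def by (intro mult_left_mono) auto
  then have 2: "\<epsilon> * side S \<le> side P" using P by simp
  have S: "S \<in> SH P" using sh(2)[of "length cs - 1"] ch j unfolding P_def by (simp add: last_conv_nth)
  show thesis
  proof (rule that[of P ds])
    show "P \<in> W" "Q \<in> SH P" "S \<in> SH P" "\<epsilon> * side P \<le> DD Q S" "\<epsilon> * side S \<le> side P"
      using P 1 2 S sh(1)[of j] unfolding P_def by auto
    show "ds \<noteq> []" using ch j by (auto simp: ds_def)
    show "hd ds = Q" using ch by (simp add: ds_def)
    show "last ds = P" using j by (simp add: ds_def P_def last_conv_nth min_def take_Suc_conv_app_nth)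
    show "set ds \<subseteq> W" using ch(2) set_take_subset unfolding ds_def by fast
    show "successively meet ds" using ch(5) j by (simp add: ds_def successively_conv_nth)
    show "Q \<in> SH R \<and> side R \<le> 2 * \<rho> * side P" if R: "R \<in> set ds" for R
    proof -
      obtain i where "i \<le> j" "R = cs ! i" using R j unfolding ds_def by (auto simp: in_set_conv_nth less_Suc_eq_le)
      then show ?thesis using sh(1)[of i] sh(2)[of i] j SH_side[OF _ P(1)] unfolding P_def by auto
    qed
  qed
qed

definition up :: "'a set \<Rightarrow> 'a set set" where
  "up Q = {R \<in> W. Q \<in> SH R}"

definition upmult :: real where "upmult = unit_ball_vol (real DIM('a)) * (2 * \<rho>) ^ DIM('a)"

lemma upmult_nonneg: "upmult \<ge> 0" using rho_gt1 unfolding upmult_def by simp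

text \<open>A cube lies in its own shadow ball, so a cube of side l with \<open>Q\<close> in its
  shadow stays within 2 \<rho> l of the center of \<open>Q\<close>; packing bounds the number of
  such cubes.\<close>

lemma card_up_level:
  assumes "Q \<in> W" "F \<subseteq> up Q" "\<And>R. R \<in> F \<Longrightarrow> side R = l"
  shows "finite F" "real (card F) \<le> upmult"
proof -
  have *: "finite F \<and> real (card F) \<le> upmult" if ne: "F \<noteq> {}"
  proof -
    have l: "l > 0" using ne assms side_pos unfolding up_def by auto
    have sub: "R \<subseteq> ball (center Q) (2 * \<rho> * l)" if R: "R \<in> F" for R
    proof
      have RW: "R \<in> W" "Q \<in> SH R" "side R = l" using R assms unfolding up_def by auto
      fix z assume "z \<in> R"
      then have "dist (center R) z < \<rho> * l" using self_SH[OF RW(1)] RW(3) unfolding SH_iff by auto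
      moreover have "dist (center R) (center Q) < \<rho> * l"
        using RW center_mem[OF assms(1)] unfolding SH_iff by auto
      ultimately have "dist (center Q) z < 2 * (\<rho> * l)"
        using dist_triangle3[of "center Q" z "center R"] by linarith
      then show "z \<in> ball (center Q) (2 * \<rho> * l)" by simp
    qed
    show ?thesis
      using card_cubes_le[of F l "2 * \<rho> * l" "center Q"] l assms sub rho_gt1
      unfolding upmult_def up_def by (auto simp: subset_iff)
  qed
  show "finite F" "real (card F) \<le> upmult" using * upmult_nonneg by (cases "F = {}"; auto)+
qed

end

section \<open>Sums over the cubes of a shadow\<close>

text \<open>Induction on the largest element b: the other powers of two are at most b / 2, so the
  series is geometric. Being a set, \<open>A\<close> counts every scale once.\<close>

lemma sum_powers_of_two_le:
  fixes A :: "real set" and s :: real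
  assumes "finite A" "s > 0" "\<And>l. l \<in> A \<Longrightarrow> \<exists>k::int. l = 2 powr k" "\<And>l. l \<in> A \<Longrightarrow> l \<le> \<mu>" "\<mu> > 0"
  shows "(\<Sum>l\<in>A. l powr s) \<le> \<mu> powr s / (1 - 2 powr - s)"
  using assms(1,3,4,5)
proof (induction A arbitrary: \<mu> rule: finite_linorder_max_induct)
  case empty
  have "2 powr - s \<le> 2 powr 0" using assms(2) by (intro powr_mono) auto
  then show ?case by simp
next
  case (insert b A)
  have "2 powr - s < 2 powr 0" using assms(2) by (intro powr_less_mono) auto
  then have k: "2 powr - s < 1" by simp
  obtain m :: int where m: "b = 2 powr m" using insert.prems(1)[of b] by auto
  have "l \<le> b / 2" if "l \<in> A" for l
  proof -
    obtain n :: int where n: "l = 2 powr n" using insert.prems(1)[of l] \<open>l \<in> A\<close> by auto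
    moreover have "l < b" using insert.hyps(2) that by auto
    ultimately have "n \<le> m - 1" using m by simp
    then have "2 powr real_of_int n \<le> 2 powr (real_of_int m - 1)" by (intro powr_mono) auto
    then show ?thesis using n m by (simp add: powr_diff)
  qed
  then have "(\<Sum>l\<in>A. l powr s) \<le> (b / 2) powr s / (1 - 2 powr - s)"
    using insert m by (intro insert.IH) auto
  also have "\<dots> = b powr s * (2 powr - s / (1 - 2 powr - s))"
    using m by (simp add: powr_divide powr_minus field_simps)
  finally have "(\<Sum>l\<in>insert b A. l powr s) \<le> b powr s * (1 + 2 powr - s / (1 - 2 powr - s))"
    using insert by (subst sum.insert) (auto simp: algebra_simps)
  also have "1 + 2 powr - s / (1 - 2 powr - s) = 1 / (1 - 2 powr - s)"
  proof -
    have "1 + x / (1 - x) = 1 / (1 - x)" if "x < 1" for x :: real using that by (simp add: divide_simps)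
    then show ?thesis using k .
  qed
  also have "b powr s * (1 / (1 - 2 powr - s)) \<le> \<mu> powr s * (1 / (1 - 2 powr - s))"
    using insert.prems m k assms(2) by (intro mult_right_mono powr_mono2) auto
  finally show ?case by simp
qed

text \<open>Jensen's inequality for x^t with the normalised weights w i / M, multiplied out.\<close>

lemma powr_sum_weighted_le:
  fixes w b :: "'i \<Rightarrow> real"
  assumes F: "finite F" and t: "t \<ge> 1" and w: "\<And>i. i \<in> F \<Longrightarrow> w i > 0" and b: "\<And>i. i \<in> F \<Longrightarrow> b i \<ge> 0"
  shows "(\<Sum>i\<in>F. w i * b i) powr t \<le> (\<Sum>i\<in>F. w i) powr (t - 1) * (\<Sum>i\<in>F. w i * b i powr t)"
proof -
  \<comment> \<open>Zero terms are dropped, so that convexity is needed only on the open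
    half-line.\<close>
  define G where "G = {i \<in> F. b i > 0}"
  have G: "finite G" "G \<subseteq> F" "\<And>i. i \<in> G \<Longrightarrow> b i > 0" using F unfolding G_def by auto
  have bG: "b i = 0" if "i \<in> F - G" for i using that b[of i] unfolding G_def by auto
  have FG: "(\<Sum>i\<in>F. w i * b i) = (\<Sum>i\<in>G. w i * b i)" "(\<Sum>i\<in>F. w i * b i powr t) = (\<Sum>i\<in>G. w i * b i powr t)"
    using F G bG by (auto intro!: sum.mono_neutral_right)
  define M where "M = (\<Sum>i\<in>G. w i)"
  have "(\<Sum>i\<in>G. w i * b i) powr t \<le> M powr (t - 1) * (\<Sum>i\<in>G. w i * b i powr t)"
  proof (cases "G = {}")
    case False
    have M: "M > 0" unfolding M_def using G w False by (intro sum_pos) auto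
    have "(\<Sum>i\<in>G. (w i / M) *\<^sub>R b i) powr t \<le> (\<Sum>i\<in>G. (w i / M) * (b i powr t))"
    proof (rule convex_on_sum[OF _ _ powr_convex[OF t]])
      show "(\<Sum>i\<in>G. w i / M) = 1" using M by (simp add: M_def flip: sum_divide_distrib)
      show "w i / M \<ge> 0" if "i \<in> G" for i using that G w[of i] M by (auto simp: less_imp_le)
    qed (use G False in auto)
    then have "((\<Sum>i\<in>G. w i * b i) / M) powr t \<le> (\<Sum>i\<in>G. w i * b i powr t) / M"
      by (simp add: sum_divide_distrib)
    moreover have "((\<Sum>i\<in>G. w i * b i) / M) powr t = (\<Sum>i\<in>G. w i * b i) powr t / M powr t"
      using M by (simp add: powr_divide)
    moreover have "M powr t = M * M powr (t - 1)"
      using M by (simp add: powr_diff)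
    ultimately have "(\<Sum>i\<in>G. w i * b i) powr t / (M * M powr (t - 1)) \<le> (\<Sum>i\<in>G. w i * b i powr t) / M" by simp
    then have "(\<Sum>i\<in>G. w i * b i) powr t / (M * M powr (t - 1)) * (M * M powr (t - 1))
        \<le> (\<Sum>i\<in>G. w i * b i powr t) / M * (M * M powr (t - 1))"
      using M by (intro mult_right_mono) auto
    then show ?thesis using M by (simp add: mult.commute)
  qed auto
  also have "\<dots> \<le> (\<Sum>i\<in>F. w i) powr (t - 1) * (\<Sum>i\<in>G. w i * b i powr t)"
    using F G t w unfolding M_def
    by (intro mult_right_mono powr_mono2 sum_mono2 sum_nonneg) (auto intro!: mult_nonneg_nonneg less_imp_le[OF w])
  finally show ?thesis unfolding FG .
qed

lemma powr_add_le:
  fixes a b t :: real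
  assumes "a \<ge> 0" "b \<ge> 0" "t \<ge> 1"
  shows "(a + b) powr t \<le> 2 powr t * (a powr t + b powr t)"
proof -
  have "(a + b) powr t \<le> (2 * max a b) powr t" using assms by (intro powr_mono2) auto
  also have "\<dots> = 2 powr t * max a b powr t" using assms by (simp add: powr_mult)
  also have "max a b powr t \<le> a powr t + b powr t" by (simp add: max_def)
  finally show ?thesis using assms by simp
qed

text \<open>Every b i is at most the total M, hence b i \<le> M^(1 - r) (b i)^r; it remains to sum
  and to divide by M^(1 - r).\<close>

lemma powr_sum_subadd:
  fixes b :: "'i \<Rightarrow> real"
  assumes "finite F" "0 < r" "r \<le> 1" "\<And>i. i \<in> F \<Longrightarrow> b i \<ge> 0"
  shows "(\<Sum>i\<in>F. b i) powr r \<le> (\<Sum>i\<in>F. b i powr r)"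
proof -
  define M where "M = (\<Sum>i\<in>F. b i)"
  show ?thesis
  proof (cases "M = 0")
    case True
    then show ?thesis unfolding M_def by (simp add: sum_nonneg)
  next
    case False
    then have M: "M > 0" unfolding M_def using assms by (simp add: sum_nonneg less_le)
    have "M = (\<Sum>i\<in>F. b i)" by (simp add: M_def)
    have "b i \<le> M powr (1 - r) * b i powr r" if i: "i \<in> F" for i
    proof (cases "b i = 0")
      case False
      then have bi: "b i > 0" using assms i by (simp add: less_le)
      have "b i \<le> M" unfolding M_def using assms i by (intro member_le_sum) auto
      then have "b i powr (1 - r) \<le> M powr (1 - r)" using assms bi by (intro powr_mono2) auto
      then have "b i powr (1 - r) * b i powr r \<le> M powr (1 - r) * b i powr r" by (intro mult_right_mono) auto
      then show ?thesis using bi by (simp flip: powr_add)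
    qed simp
    then have "M \<le> M powr (1 - r) * (\<Sum>i\<in>F. b i powr r)"
      unfolding M_def sum_distrib_left by (intro sum_mono)
    moreover have "M = M powr (1 - r) * M powr r" using M by (simp flip: powr_add)
    ultimately have "M powr (1 - r) * M powr r \<le> M powr (1 - r) * (\<Sum>i\<in>F. b i powr r)" by simp
    then show ?thesis using M unfolding M_def[symmetric] by simp
  qed
qed

lemma cbox_grid_cover:
  fixes a x :: "'a::euclidean_space"
  assumes x: "x \<in> cbox a (a + L *\<^sub>R One)" and L: "L > 0" and K: "K > (0::nat)"
  shows "\<exists>z\<in>Basis \<rightarrow>\<^sub>E {..<K}. x \<in> cbox (a + (L / K) *\<^sub>R (\<Sum>i\<in>Basis. real (z i) *\<^sub>R i))
            (a + (L / K) *\<^sub>R (\<Sum>i\<in>Basis. real (z i) *\<^sub>R i) + (L / K) *\<^sub>R One)"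
proof -
  have ex: "\<exists>n<K. a \<bullet> i + (L / K) * real n \<le> x \<bullet> i \<and> x \<bullet> i \<le> a \<bullet> i + (L / K) * real n + L / K"
    if i: "i \<in> Basis" for i
  proof -
    define y where "y = (x \<bullet> i - a \<bullet> i) / (L / K)"
    have LK: "L / K > 0" using L K by simp
    have y: "0 \<le> y" "y \<le> K" "x \<bullet> i = a \<bullet> i + (L / K) * y"
    proof -
      have nz: "L / K \<noteq> 0" using L K by simp
      have xi: "a \<bullet> i \<le> x \<bullet> i" "x \<bullet> i \<le> a \<bullet> i + L" using x i unfolding mem_box by (auto simp: inner_simps)
      show "0 \<le> y" unfolding y_def using xi LK by simp
      have "x \<bullet> i - a \<bullet> i \<le> real K * (L / K)" using xi K by simp
      then show "y \<le> K" unfolding y_def using LK by (simp only: pos_divide_le_eq)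
      show "x \<bullet> i = a \<bullet> i + (L / K) * y" unfolding y_def using nonzero_mult_div_cancel_left[OF nz, of "x \<bullet> i - a \<bullet> i"] by (simp only: times_divide_eq_right)
    qed
    \<comment> \<open>The minimum with K - 1 puts the right end point y = K into the last
      cell.\<close>
    define n where "n = min (nat \<lfloor>y\<rfloor>) (K - 1)"
    have n: "n < K" "real n \<le> y" "y \<le> real n + 1"
      using y K unfolding n_def by (auto simp: min_def of_nat_diff) linarith+
    then have "(L / K) * real n \<le> (L / K) * y" "(L / K) * y \<le> (L / K) * (real n + 1)"
      using LK by (auto intro!: mult_left_mono simp del: times_divide_eq_left)
    then show ?thesis using n y(3) by (intro exI[of _ n]) (auto simp: distrib_left)
  qed
  define z where "z = (\<lambda>i\<in>Basis. SOME n. n < K \<and> a \<bullet> i + (L / K) * real n \<le> x \<bullet> i \<and> x \<bullet> i \<le> a \<bullet> i + (L / K) * real n + L / K)"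
  have z: "z i < K \<and> a \<bullet> i + (L / K) * real (z i) \<le> x \<bullet> i \<and> x \<bullet> i \<le> a \<bullet> i + (L / K) * real (z i) + L / K"
    if "i \<in> Basis" for i
    unfolding z_def using someI_ex[OF ex[OF that]] that by simp
  show ?thesis
  proof (rule bexI[of _ z])
    show "z \<in> Basis \<rightarrow>\<^sub>E {..<K}" using z by (auto simp: z_def)
    show "x \<in> cbox (a + (L / K) *\<^sub>R (\<Sum>i\<in>Basis. real (z i) *\<^sub>R i))
            (a + (L / K) *\<^sub>R (\<Sum>i\<in>Basis. real (z i) *\<^sub>R i) + (L / K) *\<^sub>R One)"
      unfolding mem_box using z by (simp add: inner_simps del: times_divide_eq_left)
  qed
qed

section \<open>Geometric sums over the cubes whose shadow contains a given cube\<close>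

context uniform_shadow
begin

text \<open>Grouping by side turns a sum over cubes into one over distinct powers of two, at the
  price of the number of cubes per side.\<close>

lemma card_fibre_sum_le:
  fixes g :: "real \<Rightarrow> real"
  assumes "Q \<in> W" "F \<subseteq> up Q" "finite F" "\<And>l. g l \<ge> 0"
  shows "(\<Sum>R\<in>F. g (side R)) \<le> upmult * (\<Sum>l\<in>side ` F. g l)"
proof -
  have "(\<Sum>R\<in>F. g (side R)) = (\<Sum>l\<in>side ` F. \<Sum>R\<in>{R \<in> F. side R = l}. g (side R))"
    using assms(3) by (rule sum.image_gen)
  also have "\<dots> \<le> (\<Sum>l\<in>side ` F. upmult * g l)"
  proof (rule sum_mono)
    fix l
    have "(\<Sum>R\<in>{R \<in> F. side R = l}. g (side R)) = real (card {R \<in> F. side R = l}) * g l" by simp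
    also have "\<dots> \<le> upmult * g l"
      using assms by (intro mult_right_mono card_up_level(2)[OF assms(1)]) auto
    finally show "(\<Sum>R\<in>{R \<in> F. side R = l}. g (side R)) \<le> upmult * g l" .
  qed
  finally show ?thesis by (simp add: sum_distrib_left)
qed

text \<open>With the next lemma, the two tails of the series over sides: below \<mu> with positive
  powers of the side, above \<mu> with negative ones.\<close>

lemma up_sum_small:
  assumes "Q \<in> W" "F \<subseteq> up Q" "finite F" "s > 0" "\<mu> > 0" "\<And>R. R \<in> F \<Longrightarrow> side R \<le> \<mu>"
  shows "(\<Sum>R\<in>F. (side R / \<mu>) powr s) \<le> upmult / (1 - 2 powr - s)"
proof -
  have "(\<Sum>R\<in>F. side R powr s) \<le> upmult * (\<Sum>l\<in>side ` F. l powr s)"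
    using assms by (intro card_fibre_sum_le) auto
  also have "\<dots> \<le> upmult * (\<mu> powr s / (1 - 2 powr - s))"
  proof (intro mult_left_mono upmult_nonneg sum_powers_of_two_le)
    fix l assume "l \<in> side ` F"
    then obtain R where "R \<in> W" "l = side R" using assms unfolding up_def by auto
    then show "\<exists>k::int. l = 2 powr k" using W_dyadic dyadic_cube_side by metis
  qed (use assms in auto)
  finally have *: "(\<Sum>R\<in>F. side R powr s) \<le> upmult / (1 - 2 powr - s) * \<mu> powr s" by simp
  have "(\<Sum>R\<in>F. (side R / \<mu>) powr s) = (\<Sum>R\<in>F. side R powr s) / \<mu> powr s"
    using assms unfolding up_def by (auto simp: powr_divide sum_divide_distrib less_imp_le[OF side_pos] intro!: sum.cong)
  also have "\<dots> \<le> upmult / (1 - 2 powr - s)"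
    using * assms(5) by (simp add: pos_divide_le_eq)
  finally show ?thesis .
qed

lemma up_sum_large:
  assumes "Q \<in> W" "F \<subseteq> up Q" "finite F" "s > 0" "\<mu> > 0" "\<And>R. R \<in> F \<Longrightarrow> \<mu> \<le> side R"
  shows "(\<Sum>R\<in>F. (\<mu> / side R) powr s) \<le> upmult / (1 - 2 powr - s)"
proof -
  have sp: "side R > 0" if "R \<in> F" for R using that assms side_pos unfolding up_def by auto
  have "(\<Sum>R\<in>F. (1 / side R) powr s) \<le> upmult * (\<Sum>l\<in>side ` F. (1 / l) powr s)"
    using assms by (intro card_fibre_sum_le) auto
  \<comment> \<open>Reciprocals of the sides are powers of two again, now bounded by 1 /
    \<mu>.\<close>
  also have "(\<Sum>l\<in>side ` F. (1 / l) powr s) = (\<Sum>l\<in>(\<lambda>l. 1 / l) ` side ` F. l powr s)"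
    by (subst sum.reindex) (auto simp: inj_on_def)
  also have "upmult * \<dots> \<le> upmult * ((1 / \<mu>) powr s / (1 - 2 powr - s))"
  proof (intro mult_left_mono upmult_nonneg sum_powers_of_two_le)
    fix l assume l: "l \<in> (\<lambda>l. 1 / l) ` side ` F"
    then obtain R where R: "R \<in> F" "R \<in> W" "l = 1 / side R" using assms unfolding up_def by auto
    then obtain k :: int where "side R = 2 powr k" using W_dyadic dyadic_cube_side by metis
    then have "l = 2 powr (of_int (- k))" using R by (simp add: powr_minus divide_simps)
    then show "\<exists>k::int. l = 2 powr k" by blast
    show "l \<le> 1 / \<mu>" using R assms(5,6) sp by (simp add: frac_le)
  qed (use assms in auto)
  finally have *: "(\<Sum>R\<in>F. (1 / side R) powr s) \<le> upmult / (1 - 2 powr - s) * (1 / \<mu>) powr s" by simp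
  have "(\<Sum>R\<in>F. (\<mu> / side R) powr s) = (\<Sum>R\<in>F. \<mu> powr s * (1 / side R) powr s)"
  proof (rule sum.cong[OF refl])
    fix R assume "R \<in> F"
    then show "(\<mu> / side R) powr s = \<mu> powr s * (1 / side R) powr s"
      using sp[of R] assms(5) by (simp flip: powr_mult)
  qed
  also have "\<dots> = \<mu> powr s * (\<Sum>R\<in>F. (1 / side R) powr s)" by (simp add: sum_distrib_left)
  also have "\<dots> \<le> \<mu> powr s * (upmult / (1 - 2 powr - s) * (1 / \<mu>) powr s)"
    using * by (intro mult_left_mono) auto
  also have "\<dots> = upmult / (1 - 2 powr - s) * (\<mu> * (1 / \<mu>)) powr s"
    using assms(5) by (subst powr_mult) auto
  also have "\<dots> = upmult / (1 - 2 powr - s)" using assms(5) by simp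
  finally show ?thesis .
qed

section \<open>Porosity and the weighted mass of a shadow\<close>

lemma walk_intermediate_side:
  assumes "cs \<noteq> []" "successively meet cs" "set cs \<subseteq> W" "side (hd cs) < t" "t \<le> side (last cs)"
  obtains R where "R \<in> set cs" "t \<le> side R" "side R < 2 * t"
proof -
  \<comment> \<open>Sides at most double from one neighbour to the next, so the first that reaches t
    is still below 2 t.\<close>
  have "\<exists>R\<in>set cs. t \<le> side R \<and> side R < 2 * t"
    using assms
  proof (induction cs)
    case (Cons A cs)
    show ?case
    proof (cases "cs = []")
      case True then show ?thesis using Cons by simp
    next
      case False
      then obtain B ds where cs: "cs = B # ds" by (cases cs) auto
      show ?thesis
      proof (cases "side B < t")
        case True then show ?thesis using Cons cs by auto
      next
        case F: False
        have "side B \<le> 2 * side A" using Cons.prems cs by (intro meet_side) auto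
        then show ?thesis using F Cons.prems cs by auto
      qed
    qed
  qed simp
  then show thesis using that by blast
qed

text \<open>The first bound makes porosity * L at most \<epsilon> side P, hence at most the side of
  the central cube of any chain that ends at \<open>P\<close>. The second keeps the center of a cube
  of intermediate size within L / 8 of every point of its shadow.\<close>

definition porosity :: real where "porosity = min (\<epsilon> / (2 * \<rho>)) (1 / (16 * \<rho>))"

lemma porosity_bounds: "0 < porosity" "porosity \<le> \<epsilon> / (2 * \<rho>)" "porosity \<le> 1 / (16 * \<rho>)" "porosity < 1/16"
proof -
  show "0 < porosity" using eps_pos rho_gt1 unfolding porosity_def by simp
  show "porosity \<le> \<epsilon> / (2 * \<rho>)" "porosity \<le> 1 / (16 * \<rho>)" unfolding porosity_def by auto
  moreover have "1 / (16 * \<rho>) < 1/16" using rho_gt1 by (simp add: field_simps)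
  ultimately show "porosity < 1/16" by linarith
qed

text \<open>A cube of side at most comparable to some Whitney cube has a hole that no small Whitney cube enters:
  if a small cube enters the middle of it, then the chain from there to the large Whitney cube
  passes through a cube of intermediate size.\<close>
lemma porous:
  assumes P: "P \<in> W" and L: "0 < L" "L \<le> 2 * \<rho> * side P"
  obtains v where "v \<in> cbox a (a + L *\<^sub>R One)"
    "\<And>Q y. Q \<in> W \<Longrightarrow> y \<in> Q \<Longrightarrow> (\<And>i. i \<in> Basis \<Longrightarrow> \<bar>(y - v) \<bullet> i\<bar> < porosity * L / 2) \<Longrightarrow> porosity * L \<le> side Q"
proof -
  define c where "c = a + (L / 2) *\<^sub>R One"
  let ?t = "porosity * L"
  have t: "?t > 0" using porosity_bounds L by simp
  show thesis
  \<comment> \<open>Without a small cube near the middle \<open>c\<close> the hole is centered at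
    \<open>c\<close>; otherwise it sits at the center of a chain member whose side lies between t
    and 2 t.\<close>
  proof (cases "\<exists>Q\<in>W. \<exists>u\<in>Q. (\<forall>i\<in>Basis. \<bar>(u - c) \<bullet> i\<bar> < ?t / 2) \<and> side Q < ?t")
    case False
    show thesis
    proof (rule that)
      show "c \<in> cbox a (a + L *\<^sub>R One)" using L unfolding c_def mem_box by (simp add: inner_simps)
    qed (use False in \<open>force simp: not_less\<close>)
  next
    case True
    then obtain Q u where Q: "Q \<in> W" "u \<in> Q" "side Q < ?t" and u: "\<And>i. i \<in> Basis \<Longrightarrow> \<bar>(u - c) \<bullet> i\<bar> < ?t / 2" by blast
    obtain P' cs where P': "P' \<in> W" "\<epsilon> * side P \<le> side P'" and cs: "cs \<noteq> []" "hd cs = Q" "last cs = P'"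
      "successively meet cs" "set cs \<subseteq> W" "\<And>R. R \<in> set cs \<Longrightarrow> Q \<in> SH R \<and> side R \<le> 2 * \<rho> * side P'"
      using central_cube[OF Q(1) P] by metis
    have "?t \<le> (\<epsilon> / (2 * \<rho>)) * (2 * \<rho> * side P)"
      using porosity_bounds L eps_pos rho_gt1 by (intro mult_mono) auto
    also have "\<dots> = \<epsilon> * side P" using rho_gt1 by simp
    finally have "?t \<le> side P'" using P' by simp
    then obtain R where R: "R \<in> set cs" "?t \<le> side R" "side R < 2 * ?t"
      using walk_intermediate_side[OF cs(1,4,5), of ?t] cs(2,3) Q(3) by auto
    have RW: "R \<in> W" "Q \<in> SH R" using R cs by auto
    have "dist (center R) u < \<rho> * side R" using RW(2) Q(2) unfolding SH_iff by auto
    also have "\<dots> \<le> \<rho> * (2 * ?t)" using R rho_gt1 by simp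
    also have "\<dots> \<le> L / 8"
    proof -
      have "\<rho> * porosity \<le> \<rho> * (1 / (16 * \<rho>))" using porosity_bounds rho_gt1 by (intro mult_left_mono) auto
      also have "\<dots> = 1/16" using rho_gt1 by simp
      finally have "(\<rho> * porosity) * L \<le> (1/16) * L" using L by (intro mult_right_mono) auto
      then show ?thesis by (simp add: algebra_simps)
    qed
    finally have d: "dist (center R) u < L / 8" .
    have tL: "?t \<le> L / 16" using porosity_bounds(4) L by (simp add: field_simps)
    show thesis
    proof (rule that)
      show "center R \<in> cbox a (a + L *\<^sub>R One)"
        unfolding mem_box
      proof
        fix i :: 'a assume i: "i \<in> Basis"
        have 1: "\<bar>(center R - u) \<bullet> i\<bar> < L / 8" using Basis_le_norm[OF i, of "center R - u"] d by (simp add: dist_norm)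
        have 2: "c \<bullet> i = a \<bullet> i + L / 2" "(a + L *\<^sub>R One) \<bullet> i = a \<bullet> i + L" using i by (simp_all add: c_def inner_simps)
        show "a \<bullet> i \<le> center R \<bullet> i \<and> center R \<bullet> i \<le> (a + L *\<^sub>R One) \<bullet> i"
          using 1 u[OF i] tL L unfolding 2 inner_diff_left by linarith
      qed
      fix S y assume S: "S \<in> W" "y \<in> S" and y: "\<And>i. i \<in> Basis \<Longrightarrow> \<bar>(y - center R) \<bullet> i\<bar> < ?t / 2"
      \<comment> \<open>As side R \<ge> t, all points within t / 2 of its center in each coordinate
        belong to \<open>R\<close>; disjointness then excludes every other cube.\<close>
      have "y \<in> R" unfolding W_mem[OF RW(1)] using y R(2) by fastforce
      then have "S = R" using S RW W_disjoint unfolding pairwise_def disjnt_def by blast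
      then show "?t \<le> side S" using R by simp
    qed
  qed
qed

text \<open>The integral over \<open>D\<close> of the power -\<eta> of the side of the cube
  containing the point, restricted to finitely many cubes. Finiteness of \<open>F\<close> keeps it
  real and provides a smallest side at which the recursion ends.\<close>

definition wmass :: "real \<Rightarrow> 'a set set \<Rightarrow> 'a set \<Rightarrow> real" where
  "wmass \<eta> F D = (\<Sum>Q\<in>F. side Q powr - \<eta> * measure lebesgue (Q \<inter> D))"

lemma wmass_le:
  assumes F: "finite F" "F \<subseteq> W" and m: "m > 0" "\<eta> > 0" and D: "D \<in> lmeasurable"
    and big: "\<And>Q. Q \<in> F \<Longrightarrow> Q \<inter> D \<noteq> {} \<Longrightarrow> m \<le> side Q"
  shows "wmass \<eta> F D \<le> m powr - \<eta> * measure lebesgue D"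
proof -
  have QD: "Q \<inter> D \<in> lmeasurable" if "Q \<in> F" for Q
    using that F W_measure(2)[of Q] D by (intro fmeasurable.Int) auto
  have "wmass \<eta> F D \<le> (\<Sum>Q\<in>F. m powr - \<eta> * measure lebesgue (Q \<inter> D))"
    unfolding wmass_def
  proof (rule sum_mono)
    fix Q assume Q: "Q \<in> F"
    show "side Q powr - \<eta> * measure lebesgue (Q \<inter> D) \<le> m powr - \<eta> * measure lebesgue (Q \<inter> D)"
    proof (cases "Q \<inter> D = {}")
      case False
      then have "side Q powr - \<eta> \<le> m powr - \<eta>" using big[OF Q] m by (intro powr_mono2') auto
      then show ?thesis by (intro mult_right_mono) auto
    qed simp
  qed
  also have "\<dots> = m powr - \<eta> * (\<Sum>Q\<in>F. measure lebesgue (Q \<inter> D))" by (simp add: sum_distrib_left)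
  also have "(\<Sum>Q\<in>F. measure lebesgue (Q \<inter> D)) = measure lebesgue (\<Union>Q\<in>F. Q \<inter> D)"
  proof (intro measure_UNION'[symmetric] F QD)
    show "pairwise (\<lambda>A B. disjnt (A \<inter> D) (B \<inter> D)) F"
      using pairwise_subset[OF W_disjoint F(2)] unfolding pairwise_def disjnt_def by blast
  qed
  also have "\<dots> \<le> measure lebesgue D"
    using F QD D by (intro measure_mono_fmeasurable sets.finite_UN) auto
  finally show ?thesis by (simp add: mult_left_mono)
qed

lemma wmass_subadd:
  assumes F: "finite F" "F \<subseteq> W" and I: "finite I" "\<And>z. z \<in> I \<Longrightarrow> E z \<in> lmeasurable"
    and D: "D \<in> lmeasurable" "D \<subseteq> (\<Union>z\<in>I. E z)"
  shows "wmass \<eta> F D \<le> (\<Sum>z\<in>I. wmass \<eta> F (E z))"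
proof -
  have "wmass \<eta> F D \<le> (\<Sum>Q\<in>F. side Q powr - \<eta> * (\<Sum>z\<in>I. measure lebesgue (Q \<inter> E z)))"
    unfolding wmass_def
  proof (intro sum_mono mult_left_mono)
    fix Q assume Q: "Q \<in> F"
    then have QE: "Q \<inter> A \<in> lmeasurable" if "A \<in> lmeasurable" for A
      using that F W_measure(2)[of Q] by (intro fmeasurable.Int) auto
    have "measure lebesgue (Q \<inter> D) \<le> measure lebesgue (\<Union>z\<in>I. Q \<inter> E z)"
      using D I QE by (intro measure_mono_fmeasurable fmeasurable.finite_UN) auto
    also have "\<dots> \<le> (\<Sum>z\<in>I. measure lebesgue (Q \<inter> E z))"
      using I QE by (intro measure_UNION_le) auto
    finally show "measure lebesgue (Q \<inter> D) \<le> (\<Sum>z\<in>I. measure lebesgue (Q \<inter> E z))" .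
  qed auto
  also have "\<dots> = (\<Sum>z\<in>I. wmass \<eta> F (E z))"
    unfolding wmass_def sum_distrib_left by (rule sum.swap)
  finally show ?thesis .
qed

text \<open>Of the K^d subcubes of a cube one lies in a hole, where the weight is at most (\<tau>
  L)^-\<eta>. The others obey the same estimate at scale L / K, and since one of them is missing,
  their total falls short of the bound at scale L by enough to pay for the hole. Nothing in the
  constants depends on \<open>F\<close>.\<close>

lemma wmass_cube_le:
  obtains \<eta> C where "\<eta> > 0" "C > 0"
    "\<And>P a L F. P \<in> W \<Longrightarrow> 0 < L \<Longrightarrow> L \<le> 2 * \<rho> * side P \<Longrightarrow> finite F \<Longrightarrow> F \<subseteq> W \<Longrightarrow>
       wmass \<eta> F (cbox a (a + L *\<^sub>R One)) \<le> C * (L ^ DIM('a) * L powr - \<eta>)"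
proof -
  let ?d = "DIM('a)"
  define \<tau> where "\<tau> = porosity"
  have \<tau>: "0 < \<tau>" "\<tau> < 1" using porosity_bounds unfolding \<tau>_def by auto
  \<comment> \<open>This gives 1 / K < \<tau> / 2, so a subcube that contains the center v of the
    hole lies inside the hole.\<close>
  obtain K :: nat where K: "real K > 4 / \<tau>" using reals_Archimedean2 by blast
  have "4 / \<tau> > 4" using \<tau> by (simp add: field_simps)
  then have K1: "real K > 1" "K > 1" "K > 0" using K by linarith+
  have K\<tau>: "1 / real K < \<tau> / 2"
  proof -
    have "4 < \<tau> * real K" using K \<tau> by (simp add: field_simps)
    then show ?thesis using K1 by (simp add: field_simps)
  qed
  define c where "c = real K ^ ?d"
  have c: "c > 1" unfolding c_def using K1 by (intro one_less_power) auto
  define \<delta> where "\<delta> = 1 / c"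
  have \<delta>: "0 < \<delta>" "\<delta> < 1" using c unfolding \<delta>_def by auto
  have q1: "(1 - \<delta> / 2) / (1 - \<delta>) > 1" using \<delta> by (simp add: field_simps)
  \<comment> \<open>Chosen so that (1 - \<delta>) K^\<eta> = 1 - \<delta> / 2: each subdivision
    enlarges the weight by K^\<eta>, and leaving out the fraction \<delta> of the subcubes must
    still win.\<close>
  define \<eta> where "\<eta> = ln ((1 - \<delta> / 2) / (1 - \<delta>)) / ln K"
  have \<eta>: "\<eta> > 0" unfolding \<eta>_def using q1 K1 by simp
  have K\<eta>: "real K powr \<eta> = (1 - \<delta> / 2) / (1 - \<delta>)"
    unfolding \<eta>_def powr_def using K1 q1 by simp
  \<comment> \<open>Balances the recursion: the hole contributes \<delta> \<tau>^-\<eta> = C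
    \<delta> / 2, the other subcubes C (1 - \<delta> / 2).\<close>
  define C where "C = 2 * \<tau> powr - \<eta>"
  have "\<tau> powr - \<eta> \<ge> 1" using \<tau> \<eta> by (simp add: powr_minus powr_le1 one_le_inverse)
  then have C: "C \<ge> 1" unfolding C_def by simp
  have cub: "measure lebesgue (cbox a (a + L *\<^sub>R One)) = L ^ ?d" if "L > 0" for a :: 'a and L
    using that by (simp add: measure_lborel_cbox_eq inner_simps)
  \<comment> \<open>Induction on the number n of divisions by K that bring L below every side in
    \<open>F\<close>, where the estimate is immediate.\<close>
  have main: "\<forall>a L. 0 < L \<longrightarrow> L \<le> 2 * \<rho> * side P \<longrightarrow> (\<forall>Q\<in>F. L < real K ^ n * side Q) \<longrightarrow>
       wmass \<eta> F (cbox a (a + L *\<^sub>R One)) \<le> C * (L ^ ?d * L powr - \<eta>)"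
    if P: "P \<in> W" and F: "finite F" "F \<subseteq> W" for P F n
  proof (induction n)
    case 0
    show ?case
    proof (intro allI impI)
      fix a :: 'a and L :: real
      assume L: "0 < L" "\<forall>Q\<in>F. L < real K ^ 0 * side Q"
      then have "wmass \<eta> F (cbox a (a + L *\<^sub>R One)) \<le> L powr - \<eta> * measure lebesgue (cbox a (a + L *\<^sub>R One))"
        using F \<eta> by (intro wmass_le) auto
      also have "\<dots> = 1 * (L ^ ?d * L powr - \<eta>)" using cub L by simp
      also have "\<dots> \<le> C * (L ^ ?d * L powr - \<eta>)" using C L by (intro mult_right_mono) auto
      finally show "wmass \<eta> F (cbox a (a + L *\<^sub>R One)) \<le> C * (L ^ ?d * L powr - \<eta>)" .
    qed
  next
    case (Suc n)
    show ?case
    proof (intro allI impI)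
      fix a :: 'a and L :: real
      assume L: "0 < L" "L \<le> 2 * \<rho> * side P" "\<forall>Q\<in>F. L < real K ^ Suc n * side Q"
      define I where "I = ((Basis :: 'a set) \<rightarrow>\<^sub>E {..<K})"
      define b where "b z = a + (L / K) *\<^sub>R (\<Sum>i\<in>Basis. real (z i) *\<^sub>R i)" for z
      define E where "E z = cbox (b z) (b z + (L / K) *\<^sub>R One)" for z
      have I: "finite I" "card I = K ^ ?d" unfolding I_def by (auto simp: card_PiE finite_PiE)
      have LK: "L / K > 0" using L K1 by simp
      have sub: "cbox a (a + L *\<^sub>R One) \<subseteq> (\<Union>z\<in>I. E z)"
        using cbox_grid_cover[OF _ L(1) K1(3)] unfolding I_def E_def b_def by blast
      obtain v where v: "v \<in> cbox a (a + L *\<^sub>R One)"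
        "\<And>Q y. Q \<in> W \<Longrightarrow> y \<in> Q \<Longrightarrow> (\<And>i. i \<in> Basis \<Longrightarrow> \<bar>(y - v) \<bullet> i\<bar> < \<tau> * L / 2) \<Longrightarrow> \<tau> * L \<le> side Q"
        using porous[OF P L(1,2)] unfolding \<tau>_def by metis
      obtain z0 where z0: "z0 \<in> I" "v \<in> E z0" using v sub by blast
      have hole: "wmass \<eta> F (E z0) \<le> (\<tau> * L) powr - \<eta> * (L / K) ^ ?d"
      proof -
        have "wmass \<eta> F (E z0) \<le> (\<tau> * L) powr - \<eta> * measure lebesgue (E z0)"
        proof (rule wmass_le[OF F])
          fix Q assume Q: "Q \<in> F" "Q \<inter> E z0 \<noteq> {}"
          then obtain y where y: "y \<in> Q" "y \<in> E z0" by blast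
          show "\<tau> * L \<le> side Q"
          proof (rule v(2)[OF _ y(1)])
            fix i :: 'a assume i: "i \<in> Basis"
            have *: "(b z0 + (L / K) *\<^sub>R One) \<bullet> i = b z0 \<bullet> i + L / K" using i by (simp add: inner_simps)
            have "b z0 \<bullet> i \<le> y \<bullet> i" "y \<bullet> i \<le> b z0 \<bullet> i + L / K" "b z0 \<bullet> i \<le> v \<bullet> i" "v \<bullet> i \<le> b z0 \<bullet> i + L / K"
              using y(2) z0(2) i unfolding E_def mem_box *[symmetric] by auto
            then have "\<bar>(y - v) \<bullet> i\<bar> \<le> L / K" unfolding inner_diff_left by linarith
            also have "\<dots> < \<tau> * L / 2" using mult_strict_right_mono[OF K\<tau> L(1)] by simp
            finally show "\<bar>(y - v) \<bullet> i\<bar> < \<tau> * L / 2" .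
          qed (use Q F in auto)
        qed (use \<tau> L \<eta> in \<open>auto simp: E_def\<close>)
        also have "measure lebesgue (E z0) = (L / K) ^ ?d" unfolding E_def using cub[OF LK] by simp
        finally show ?thesis .
      qed
      have rest: "wmass \<eta> F (E z) \<le> C * ((L / K) ^ ?d * (L / K) powr - \<eta>)" for z
        unfolding E_def
      proof (rule Suc.IH[rule_format, OF LK])
        have "L / K \<le> L" using L K1 by (simp add: field_simps)
        then show "L / K \<le> 2 * \<rho> * side P" using L by simp
        fix Q assume "Q \<in> F"
        then show "L / K < real K ^ n * side Q" using L(3) K1 by (simp add: field_simps)
      qed
      have e1: "(L / K) ^ ?d = \<delta> * L ^ ?d" by (simp add: \<delta>_def c_def power_divide)
      have e2: "(L / K) powr - \<eta> = L powr - \<eta> * real K powr \<eta>"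
        using L K1 by (simp add: powr_divide powr_minus field_simps)
      have e3: "(\<tau> * L) powr - \<eta> = \<tau> powr - \<eta> * L powr - \<eta>" using \<tau> L by (simp add: powr_mult)
      have "wmass \<eta> F (cbox a (a + L *\<^sub>R One)) \<le> (\<Sum>z\<in>I. wmass \<eta> F (E z))"
        using I sub F by (intro wmass_subadd) (auto simp: E_def)
      also have "\<dots> = wmass \<eta> F (E z0) + (\<Sum>z\<in>I - {z0}. wmass \<eta> F (E z))"
        using I z0 by (intro sum.remove) auto
      also have "\<dots> \<le> (\<tau> * L) powr - \<eta> * (L / K) ^ ?d + (\<Sum>z\<in>I - {z0}. C * ((L / K) ^ ?d * (L / K) powr - \<eta>))"
        by (intro add_mono sum_mono hole rest)
      also have "(\<Sum>z\<in>I - {z0}. C * ((L / K) ^ ?d * (L / K) powr - \<eta>)) = (c - 1) * (C * ((L / K) ^ ?d * (L / K) powr - \<eta>))"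
      proof -
        have "real (card (I - {z0})) = c - 1"
          using I z0 c K1 unfolding c_def by (subst card_Diff_singleton) (auto simp: of_nat_diff)
        then show ?thesis by simp
      qed
      also have "(\<tau> * L) powr - \<eta> * (L / K) ^ ?d + (c - 1) * (C * ((L / K) ^ ?d * (L / K) powr - \<eta>))
          = (\<tau> powr - \<eta> * \<delta> + ((c - 1) * \<delta>) * C * real K powr \<eta>) * (L ^ ?d * L powr - \<eta>)"
        unfolding e1 e2 e3 by (simp add: algebra_simps)
      also have "(c - 1) * \<delta> = 1 - \<delta>" using c by (simp add: \<delta>_def field_simps)
      also have "\<tau> powr - \<eta> * \<delta> + (1 - \<delta>) * C * real K powr \<eta> = C"
      proof -
        have "(1 - \<delta>) * C * real K powr \<eta> = C * (1 - \<delta> / 2)" unfolding K\<eta> using \<delta> by simp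
        then show ?thesis unfolding C_def by (simp add: algebra_simps)
      qed
      finally show "wmass \<eta> F (cbox a (a + L *\<^sub>R One)) \<le> C * (L ^ ?d * L powr - \<eta>)" .
    qed
  qed
  show thesis
  proof (rule that[OF \<eta>])
    show "C > 0" using C by simp
    fix P a L F
    assume P: "P \<in> W" "0 < L" "L \<le> 2 * \<rho> * side P" and F: "finite F" "F \<subseteq> W"
    have "\<exists>n. \<forall>Q\<in>F. L < real K ^ n * side Q"
      using F
    proof (induction F)
      case (insert Q F)
      then obtain n where n: "\<forall>Q\<in>F. L < real K ^ n * side Q" by auto
      obtain m where m: "L / side Q < real K ^ m" using K1 real_arch_pow by blast
      have "L < real K ^ max n m * side S" if S: "S \<in> insert Q F" for S
      proof -
        have sp: "side S > 0" using S insert.prems side_pos by auto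
        have "L < real K ^ n * side S \<or> L < real K ^ m * side S"
          using S n m sp by (auto simp: pos_divide_less_eq)
        moreover have "real K ^ n * side S \<le> real K ^ max n m * side S" "real K ^ m * side S \<le> real K ^ max n m * side S"
          using K1 sp by (auto intro!: mult_right_mono power_increasing)
        ultimately show ?thesis by linarith
      qed
      then show ?case by blast
    qed simp
    then show "wmass \<eta> F (cbox a (a + L *\<^sub>R One)) \<le> C * (L ^ ?d * L powr - \<eta>)"
      using main[OF P(1) F] P by blast
  qed
qed

text \<open>The mass bound is applied to the cube of side 2 \<rho> side P about the center of
  \<open>P\<close>, which contains the shadow; side Q^d is the volume of \<open>Q\<close>. This
  estimate later absorbs the Hoelder weights.\<close>

lemma shadow_mass_le:
  obtains \<eta> C where "\<eta> > 0" "C > 0"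
    "\<And>P F. P \<in> W \<Longrightarrow> finite F \<Longrightarrow> F \<subseteq> SH P \<Longrightarrow>
       (\<Sum>Q\<in>F. side Q ^ DIM('a) * (side P / side Q) powr \<eta>) \<le> C * side P ^ DIM('a)"
proof -
  obtain \<eta> C where \<eta>: "\<eta> > 0" and C: "C > 0" and mass:
    "\<And>P a L F. P \<in> W \<Longrightarrow> 0 < L \<Longrightarrow> L \<le> 2 * \<rho> * side P \<Longrightarrow> finite F \<Longrightarrow> F \<subseteq> W \<Longrightarrow>
       wmass \<eta> F (cbox a (a + L *\<^sub>R One)) \<le> C * (L ^ DIM('a) * L powr - \<eta>)"
    using wmass_cube_le by blast
  show thesis
  proof (rule that[OF \<eta>])
    let ?C = "C * (2 * \<rho>) ^ DIM('a)"
    show "?C > 0" using C rho_gt1 by simp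
    fix P F assume P: "P \<in> W" and F: "finite F" "F \<subseteq> SH P"
    define a where "a = center P - (\<rho> * side P) *\<^sub>R One"
    define L where "L = 2 * \<rho> * side P"
    have sP: "side P > 0" using P side_pos by blast
    have L: "L > 0" unfolding L_def using sP rho_gt1 by simp
    have FW: "F \<subseteq> W" using F unfolding SHr_def by auto
    have sub: "Q \<subseteq> cbox a (a + L *\<^sub>R One)" if Q: "Q \<in> F" for Q
    proof
      fix x assume "x \<in> Q"
      moreover have "Q \<subseteq> ball (center P) (\<rho> * side P)" using Q F SH_iff by blast
      ultimately have d: "dist (center P) x < \<rho> * side P" by auto
      show "x \<in> cbox a (a + L *\<^sub>R One)" unfolding mem_box
      proof
        fix i :: 'a assume i: "i \<in> Basis"
        have 1: "\<bar>(center P - x) \<bullet> i\<bar> < \<rho> * side P" using Basis_le_norm[OF i, of "center P - x"] d by (simp add: dist_norm)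
        have 2: "a \<bullet> i = center P \<bullet> i - \<rho> * side P" "(a + L *\<^sub>R One) \<bullet> i = center P \<bullet> i + \<rho> * side P"
          using i by (simp_all add: a_def L_def inner_simps)
        show "a \<bullet> i \<le> x \<bullet> i \<and> x \<bullet> i \<le> (a + L *\<^sub>R One) \<bullet> i" using 1 unfolding 2 inner_diff_left by linarith
      qed
    qed
    have "(\<Sum>Q\<in>F. side Q ^ DIM('a) * (side P / side Q) powr \<eta>) = side P powr \<eta> * wmass \<eta> F (cbox a (a + L *\<^sub>R One))"
      unfolding wmass_def sum_distrib_left
    proof (rule sum.cong[OF refl])
      fix Q assume Q: "Q \<in> F"
      then have "Q \<inter> cbox a (a + L *\<^sub>R One) = Q" "Q \<in> W" using sub FW by auto
      then show "side Q ^ DIM('a) * (side P / side Q) powr \<eta> = side P powr \<eta> * (side Q powr - \<eta> * measure lebesgue (Q \<inter> cbox a (a + L *\<^sub>R One)))"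
        using W_measure(1)[of Q] side_pos[of Q] sP by (simp add: powr_divide powr_minus field_simps)
    qed
    also have "\<dots> \<le> side P powr \<eta> * (C * (L ^ DIM('a) * L powr - \<eta>))"
      using mass[OF P L _ F(1) FW] unfolding L_def by (intro mult_left_mono) auto
    also have "\<dots> = C * (L ^ DIM('a)) * (side P / L) powr \<eta>"
      using sP L by (simp add: powr_divide powr_minus field_simps)
    also have "\<dots> \<le> C * (L ^ DIM('a)) * 1"
    proof (intro mult_left_mono)
      have "side P / L \<le> 1" unfolding L_def using rho_gt1 sP by (simp add: field_simps)
      then show "(side P / L) powr \<eta> \<le> 1" using sP L \<eta> by (intro powr_le1) auto
    qed (use C L in auto)
    also have "\<dots> = ?C * side P ^ DIM('a)" unfolding L_def by (simp add: power_mult_distrib)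
    finally show "(\<Sum>Q\<in>F. side Q ^ DIM('a) * (side P / side Q) powr \<eta>) \<le> ?C * side P ^ DIM('a)" .
  qed
qed

end

section \<open>Pointwise control by the inner term\<close>

lemma powr_le_powrD:
  fixes a b t :: real
  assumes "a powr t \<le> b powr t" "b \<ge> 0" "t > 0"
  shows "a \<le> b"
  using assms powr_less_mono2[of t b a] by (meson not_le)

lemma enn_powr_ennreal: "a \<ge> 0 \<Longrightarrow> enn_powr (ennreal a) r = ennreal (a powr r)"
  by (simp add: enn_powr_def)

lemma enn_powr_mono:
  assumes "x \<le> y" "r \<ge> 0" shows "enn_powr x r \<le> enn_powr y r"
proof (cases "y = \<infinity>")
  case False
  then have "x \<noteq> \<infinity>" "enn2real x \<le> enn2real y" using assms by (auto simp: enn2real_mono less_top top_unique)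
  then show ?thesis using False assms by (auto simp: enn_powr_def intro!: ennreal_leI powr_mono2)
qed (simp add: enn_powr_def)

lemma enn_powr_cmult:
  assumes "c > 0" shows "enn_powr (ennreal c * x) r = ennreal (c powr r) * enn_powr x r"
proof (cases x)
  case (real a)
  then show ?thesis using assms
    by (simp add: enn_powr_ennreal powr_mult flip: ennreal_mult)
next
  case top
  then show ?thesis using assms by (simp add: enn_powr_def ennreal_mult_top)
qed

lemma enn_powr_eq_ennrealD:
  assumes "enn_powr x (p / q) = ennreal (h powr p)" "p > 0" "q > 0" "h \<ge> 0"
  shows "x = ennreal (h powr q)"
proof (cases x)
  case (real a)
  then have "a powr (p / q) = h powr p" using assms by (simp add: enn_powr_ennreal)
  then have "(a powr (p / q)) powr (q / p) = (h powr p) powr (q / p)" by simp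
  then have "a = h powr q" using assms real by (simp add: powr_powr)
  then show ?thesis using real by simp
next
  case top then show ?thesis using assms by (simp add: enn_powr_def)
qed

lemma measurable_enn_powr [measurable]: "(\<lambda>x. enn_powr x r) \<in> borel_measurable borel"
  unfolding enn_powr_def by measurable

lemma sigma_finite_lebesgue: "sigma_finite_measure (lebesgue :: 'a::euclidean_space measure)"
proof
  obtain A :: "'a set set" where A: "countable A" "A \<subseteq> sets lborel" "\<Union>A = space lborel" "\<forall>a\<in>A. emeasure lborel a \<noteq> \<infinity>"
    using lborel.sigma_finite_countable by blast
  then show "\<exists>A::'a set set. countable A \<and> A \<subseteq> sets lebesgue \<and> \<Union>A = space lebesgue \<and> (\<forall>a\<in>A. emeasure lebesgue a \<noteq> \<infinity>)"
    by (intro exI[of _ A]) (auto simp: subset_iff)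
qed

interpretation lebesgue: sigma_finite_measure "lebesgue :: 'a::euclidean_space measure"
  by (rule sigma_finite_lebesgue)

lemma id_lebesgue_borel [measurable]: "(\<lambda>x. x) \<in> lebesgue \<rightarrow>\<^sub>M (borel :: 'a::euclidean_space measure)"
  by (simp add: measurable_completion)

lemma difference_quotient_measurable:
  fixes f :: "'a::euclidean_space \<Rightarrow> real"
  assumes [measurable]: "f \<in> borel_measurable lebesgue"
  shows "(\<lambda>(x, y). \<bar>f x - f y\<bar> powr a / dist x y powr b) \<in> borel_measurable (lebesgue \<Otimes>\<^sub>M lebesgue)"
proof -
  have [measurable]: "fst \<in> lebesgue \<Otimes>\<^sub>M lebesgue \<rightarrow>\<^sub>M (borel :: 'a measure)" "snd \<in> lebesgue \<Otimes>\<^sub>M lebesgue \<rightarrow>\<^sub>M (borel :: 'a measure)"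
    using measurable_compose[OF measurable_fst id_lebesgue_borel] measurable_compose[OF measurable_snd id_lebesgue_borel]
    by auto
  show ?thesis unfolding split_beta by measurable
qed

lemma difference_quotient_measurable_section:
  fixes f :: "'a::euclidean_space \<Rightarrow> real"
  assumes "f \<in> borel_measurable lebesgue"
  shows "(\<lambda>y. \<bar>f x - f y\<bar> powr a / dist x y powr b) \<in> borel_measurable lebesgue"
  using measurable_Pair2[OF difference_quotient_measurable[OF assms, of a b], of x] by simp

text \<open>For q = \<infinity> the sublevel set at c consists of the x for which the set of y in
  \<open>A\<close> with quotient above c is null. It is the zero set of the integral of an indicator
  over y, which depends measurably on x.\<close>

lemma inner_term_measurable:
  fixes f :: "'a::euclidean_space \<Rightarrow> real"
  assumes f: "f \<in> borel_measurable lebesgue" and A [measurable]: "A \<in> sets lebesgue"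
  shows "inner_term s p q f A \<in> borel_measurable lebesgue"
proof (cases "q = \<infinity>")
  case False
  note [measurable] = difference_quotient_measurable[OF f, of "real_of_ereal q" "s * real_of_ereal q + real DIM('a)"]
  have [measurable]: "(\<lambda>x. indicator A (snd x) :: ennreal) \<in> borel_measurable (lebesgue \<Otimes>\<^sub>M lebesgue)"
    by measurable
  have "(\<lambda>(x, y). ennreal (\<bar>f x - f y\<bar> powr real_of_ereal q / dist x y powr (s * real_of_ereal q + real DIM('a))) * indicator A y)
      \<in> borel_measurable (lebesgue \<Otimes>\<^sub>M lebesgue)"
    using difference_quotient_measurable[OF f, of "real_of_ereal q" "s * real_of_ereal q + real DIM('a)"]
    unfolding split_beta by measurable
  from lebesgue.borel_measurable_nn_integral[OF this]
  show ?thesis using False unfolding inner_term_def by simp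
next
  case True
  define g where "g = (\<lambda>x y. ennreal (\<bar>f x - f y\<bar> powr p / dist x y powr (s * p)))"
  have g: "(\<lambda>(x, y). g x y) \<in> borel_measurable (lebesgue \<Otimes>\<^sub>M lebesgue)"
    using difference_quotient_measurable[OF f, of p "s * p"] unfolding g_def split_beta by measurable
  have g1: "g x \<in> borel_measurable lebesgue" for x
    using difference_quotient_measurable_section[OF f] unfolding g_def by measurable
  have g1A: "g x \<in> borel_measurable (lebesgue_on A)" for x
    using g1 by (rule measurable_restrict_space1)
  show ?thesis
  proof (rule borel_measurableI_le)
    fix c :: ennreal
    have le_iff: "inner_term s p q f A x \<le> c \<longleftrightarrow> (\<integral>\<^sup>+y. (if y \<in> A \<and> c < g x y then 1 else 0) \<partial>lebesgue) = 0" for x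
    proof -
      have "inner_term s p q f A x \<le> c \<longleftrightarrow> (AE y in lebesgue_on A. g x y \<le> c)"
        unfolding inner_term_def using True
        using esssup_AE[of "g x" "lebesgue_on A"] esssup_I[OF g1A]
        by (auto simp: g_def elim!: eventually_mono)
      also have "\<dots> \<longleftrightarrow> (AE y in lebesgue. y \<in> A \<longrightarrow> g x y \<le> c)"
        by (subst AE_restrict_space_iff) auto
      also have "\<dots> \<longleftrightarrow> (AE y in lebesgue. (if y \<in> A \<and> c < g x y then 1 else 0 :: ennreal) = 0)"
        by (intro arg_cong2[where f=eventually]) (auto simp: not_less)
      also have "\<dots> \<longleftrightarrow> (\<integral>\<^sup>+y. (if y \<in> A \<and> c < g x y then 1 else 0) \<partial>lebesgue) = 0"
        using g1[of x] by (subst nn_integral_0_iff_AE) auto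
      finally show ?thesis .
    qed
    have "(\<lambda>x. \<integral>\<^sup>+y. (if y \<in> A \<and> c < g x y then 1 else 0) \<partial>lebesgue) \<in> borel_measurable lebesgue"
    proof (rule lebesgue.borel_measurable_nn_integral)
      have [measurable]: "(\<lambda>x. g (fst x) (snd x)) \<in> borel_measurable (lebesgue \<Otimes>\<^sub>M lebesgue)"
        using g by (simp add: split_beta)
      show "(\<lambda>(x, y). if y \<in> A \<and> c < g x y then 1 else 0 :: ennreal) \<in> borel_measurable (lebesgue \<Otimes>\<^sub>M lebesgue)"
        unfolding split_beta by measurable
    qed
    then have "(\<lambda>x. \<integral>\<^sup>+y. (if y \<in> A \<and> c < g x y then 1 else 0) \<partial>lebesgue) -` {0} \<inter> space lebesgue \<in> sets lebesgue"
      by (rule measurable_sets) simp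
    then show "{x \<in> space lebesgue. inner_term s p q f A x \<le> c} \<in> sets lebesgue"
      unfolding le_iff by (simp add: vimage_def)
  qed
qed

text \<open>If g exceeded its average c everywhere on \<open>R\<close>, then g - c would be positive
  on \<open>R\<close> with integral zero, and \<open>R\<close> would be null. The product form also
  covers an infinite integral.\<close>

lemma exists_le_average:
  assumes g: "g \<in> borel_measurable M" and R: "R \<in> sets M" and e: "0 < emeasure M R" "emeasure M R < \<infinity>"
  shows "\<exists>z\<in>R. g z * emeasure M R \<le> (\<integral>\<^sup>+x\<in>R. g x \<partial>M)"
proof (rule ccontr)
  assume "\<not> ?thesis"
  then have lt: "(\<integral>\<^sup>+x\<in>R. g x \<partial>M) < g z * emeasure M R" if "z \<in> R" for z using that by (auto simp: not_le)
  define J where "J = (\<integral>\<^sup>+x\<in>R. g x \<partial>M)"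
  obtain z0 where "z0 \<in> R" using e by (metis emeasure_empty equals0I less_irrefl)
  then have J: "J < \<infinity>" using lt unfolding J_def by (metis infinity_ennreal_def order_less_le_trans top_greatest)
  define c where "c = J / emeasure M R"
  have ce: "c * emeasure M R = J" unfolding c_def using e J
    by (metis ennreal_divide_times ennreal_times_divide divide_self_if ennreal_divide_self infinity_ennreal_def less_irrefl mult.right_neutral not_gr_zero)
  have cz: "c < g z" if "z \<in> R" for z
  proof (rule ccontr)
    assume "\<not> c < g z"
    then have "g z * emeasure M R \<le> c * emeasure M R" by (intro mult_right_mono) auto
    then show False using lt[OF that] ce unfolding J_def by simp
  qed
  have "(\<integral>\<^sup>+x. g x * indicator R x - c * indicator R x \<partial>M) = (\<integral>\<^sup>+x\<in>R. g x \<partial>M) - (\<integral>\<^sup>+x. c * indicator R x \<partial>M)"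
  proof (rule nn_integral_diff)
    show "(\<integral>\<^sup>+x. c * indicator R x \<partial>M) \<noteq> \<infinity>" using ce J R by (simp add: nn_integral_cmult_indicator)
    show "AE x in M. c * indicator R x \<le> g x * indicator R x"
      using cz by (intro AE_I2) (auto simp: indicator_def less_imp_le)
  qed (use g R in auto)
  also have "\<dots> = 0" using ce J R by (simp add: nn_integral_cmult_indicator J_def)
  finally have "AE x in M. g x * indicator R x - c * indicator R x = 0"
    using g R by (subst (asm) nn_integral_0_iff_AE) auto
  then have "AE x in M. x \<notin> R"
  proof (rule AE_mp, intro AE_I2 impI)
    fix x assume "g x * indicator R x - c * indicator R x = 0"
    then show "x \<notin> R" using cz[of x] J ce by (auto simp: indicator_def diff_eq_0_iff_ennreal not_le[symmetric])
  qed
  then have "emeasure M R = 0"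
    using R by (subst (asm) AE_iff_measurable[OF R]) (auto dest: sets.sets_into_space)
  then show False using e by simp
qed

section \<open>Comparison of two values of the function through a common shadow\<close>

context uniform_shadow
begin

lemma W_sets: "Q \<in> W \<Longrightarrow> Q \<in> sets lebesgue"
  using W_measure(2) fmeasurableD by blast

lemma W_emeasure: "Q \<in> W \<Longrightarrow> emeasure lebesgue Q = ennreal (side Q ^ DIM('a))"
  using emeasure_eq_measure2[OF W_measure(2)] W_measure(1) by simp

lemma Shr_sets: "Shr W \<rho> P \<in> sets lebesgue"
proof -
  have "SH P \<subseteq> W" by (auto simp: SHr_def)
  then show ?thesis unfolding Shr_def using W_sets W_countable countable_subset
    by (intro sets.countable_Union) blast+
qed

lemma Shr_emeasure:
  assumes "P \<in> W"
  shows "emeasure lebesgue (Shr W \<rho> P) \<le> ennreal (upmult * side P ^ DIM('a))"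
proof -
  have r: "0 \<le> \<rho> * side P" using rho_gt1 side_pos[OF assms] by simp
  have "emeasure lebesgue (Shr W \<rho> P) \<le> emeasure lebesgue (ball (center P) (\<rho> * side P))"
    by (intro emeasure_mono) (auto simp: Shr_def SHr_def)
  also have "\<dots> = ennreal (unit_ball_vol (real DIM('a)) * (\<rho> * side P) ^ DIM('a))"
    using r by (simp add: emeasure_ball)
  also have "\<dots> \<le> ennreal (unit_ball_vol (real DIM('a)) * (2 * \<rho> * side P) ^ DIM('a))"
    using r by (intro ennreal_leI mult_left_mono power_mono) auto
  finally show ?thesis by (simp add: upmult_def power_mult_distrib mult_ac)
qed

lemma Shr_dist:
  assumes "P \<in> W" "z \<in> P" "y \<in> Shr W \<rho> P"
  shows "dist z y \<le> 2 * \<rho> * side P"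
proof -
  have "dist (center P) z < \<rho> * side P" using self_SH[OF assms(1)] assms(2) unfolding SH_iff by auto
  moreover have "dist (center P) y < \<rho> * side P" using assms(3) unfolding Shr_def SHr_def by auto
  ultimately show ?thesis using dist_triangle3[of z y "center P"] by linarith
qed

lemma Shr_dist_neighbour:
  assumes A: "A \<in> W" and B: "B \<in> SH A" and AB: "side A \<le> 2 * side B" and y: "y \<in> B"
  shows "z \<in> A \<Longrightarrow> dist z y \<le> 4 * \<rho> * side B" "w \<in> B \<Longrightarrow> dist w y \<le> 4 * \<rho> * side B"
proof -
  have BW: "B \<in> W" using B by (simp add: SHr_def)
  have yA: "y \<in> Shr W \<rho> A" and yB: "y \<in> Shr W \<rho> B" using B self_SH[OF BW] y unfolding Shr_def by auto
  show "dist z y \<le> 4 * \<rho> * side B" if "z \<in> A"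
  proof -
    have "2 * \<rho> * side A \<le> 2 * \<rho> * (2 * side B)" using AB rho_gt1 by (intro mult_left_mono) auto
    then show ?thesis using Shr_dist[OF A that yA] by simp
  qed
  show "dist w y \<le> 4 * \<rho> * side B" if "w \<in> B"
  proof -
    have "2 * \<rho> * side B \<le> 4 * \<rho> * side B" using side_pos[OF BW] rho_gt1 by (intro mult_right_mono) auto
    then show ?thesis using Shr_dist[OF BW that yB] by simp
  qed
qed

lemma inner_term_finite_AE:
  fixes f :: "'a \<Rightarrow> real"
  assumes q: "q = \<infinity>" and f: "f \<in> borel_measurable lebesgue" and A: "A \<in> sets lebesgue" and p: "p \<ge> 1"
    and h: "h \<ge> 0" "inner_term s p q f A z = ennreal (h powr p)"
  shows "AE y in lebesgue. y \<in> A \<longrightarrow> \<bar>f z - f y\<bar> \<le> h * dist z y powr s"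
proof -
  have "AE y in lebesgue_on A. ennreal (\<bar>f z - f y\<bar> powr p / dist z y powr (s * p)) \<le> ennreal (h powr p)"
    using esssup_AE[of "\<lambda>y. ennreal (\<bar>f z - f y\<bar> powr p / dist z y powr (s * p))" "lebesgue_on A"] h q
    unfolding inner_term_def by simp
  then have "AE y in lebesgue. y \<in> A \<longrightarrow> ennreal (\<bar>f z - f y\<bar> powr p / dist z y powr (s * p)) \<le> ennreal (h powr p)"
    using A by (subst (asm) AE_restrict_space_iff) auto
  then show ?thesis
  proof (rule AE_mp, intro AE_I2 impI)
    fix y assume y: "y \<in> A \<longrightarrow> ennreal (\<bar>f z - f y\<bar> powr p / dist z y powr (s * p)) \<le> ennreal (h powr p)" "y \<in> A"
    show "\<bar>f z - f y\<bar> \<le> h * dist z y powr s"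
    proof (cases "y = z")
      case False
      then have d: "dist z y > 0" by simp
      have "\<bar>f z - f y\<bar> powr p / dist z y powr (s * p) \<le> h powr p" using y h by (simp add: ennreal_le_iff)
      then have "\<bar>f z - f y\<bar> powr p \<le> h powr p * dist z y powr (s * p)" using d by (simp add: field_simps)
      also have "\<dots> = (h * dist z y powr s) powr p" using h d by (simp add: powr_mult powr_powr)
      finally show ?thesis using p h by (elim powr_le_powrD) auto
    qed simp
  qed
qed

lemma inner_term_finite_integral:
  fixes f :: "'a \<Rightarrow> real"
  assumes q: "q \<noteq> \<infinity>" "1 \<le> q" "t = real_of_ereal q" and p: "p \<ge> 1"
    and h: "h \<ge> 0" "inner_term s p q f A z = ennreal (h powr p)"
  shows "(\<integral>\<^sup>+y\<in>A. ennreal (\<bar>f z - f y\<bar> powr t / dist z y powr (s * t + real DIM('a))) \<partial>lebesgue) = ennreal (h powr t)"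
proof -
  have "t \<ge> 1" using q by (cases q) auto
  then show ?thesis
    using h q p unfolding inner_term_def by (intro enn_powr_eq_ennrealD[of _ p t h]) auto
qed

text \<open>Where |u - y| \<le> r, the kernel is at least r^-(s t + d), so removing it costs only
  that factor. At y = u the difference vanishes.\<close>

lemma integral_powr_le:
  fixes f :: "'a \<Rightarrow> real"
  assumes f: "f \<in> borel_measurable lebesgue" and D: "B \<subseteq> D" "D \<in> sets lebesgue"
    and q: "q \<noteq> \<infinity>" "1 \<le> q" "t = real_of_ereal q" and s: "s > 0" and p: "p \<ge> 1"
    and u: "\<And>y. y \<in> B \<Longrightarrow> dist u y \<le> r"
    and j: "j \<ge> 0" "inner_term s p q f D u = ennreal (j powr p)"
  shows "(\<integral>\<^sup>+y\<in>B. ennreal (\<bar>f u - f y\<bar> powr t) \<partial>lebesgue) \<le> ennreal (r powr (s * t + real DIM('a)) * j powr t)"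
proof -
  define e where "e = s * t + real DIM('a)"
  define m where "m = r powr e"
  have t: "t \<ge> 1" using q by (cases q) auto
  then have e: "e > 0" unfolding e_def using s by (simp add: add_pos_nonneg)
  have m: "m \<ge> 0" by (simp add: m_def)
  have [measurable]: "(\<lambda>y. \<bar>f u - f y\<bar> powr t / dist u y powr e) \<in> borel_measurable lebesgue" "D \<in> sets lebesgue"
    by (rule difference_quotient_measurable_section[OF f]) (rule D)
  have "(\<integral>\<^sup>+y\<in>B. ennreal (\<bar>f u - f y\<bar> powr t) \<partial>lebesgue) \<le> (\<integral>\<^sup>+y. ennreal m * (ennreal (\<bar>f u - f y\<bar> powr t / dist u y powr e) * indicator D y) \<partial>lebesgue)"
  proof (rule nn_integral_mono)
    fix y
    show "ennreal (\<bar>f u - f y\<bar> powr t) * indicator B y \<le> ennreal m * (ennreal (\<bar>f u - f y\<bar> powr t / dist u y powr e) * indicator D y)"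
    proof (cases "y \<in> B \<and> y \<noteq> u")
      case True
      then have d: "dist u y > 0" "y \<in> D" using D by auto
      have "dist u y powr e \<le> m" unfolding m_def using u True e by (intro powr_mono2) auto
      then have "\<bar>f u - f y\<bar> powr t * dist u y powr e \<le> \<bar>f u - f y\<bar> powr t * m" by (intro mult_left_mono) auto
      then have "\<bar>f u - f y\<bar> powr t \<le> m * (\<bar>f u - f y\<bar> powr t / dist u y powr e)"
        using d by (simp add: field_simps)
      then show ?thesis using True d m by (simp add: ennreal_leI flip: ennreal_mult)
    next
      case False
      then show ?thesis using t by (cases "y = u") auto
    qed
  qed
  also have "\<dots> = ennreal m * (\<integral>\<^sup>+y\<in>D. ennreal (\<bar>f u - f y\<bar> powr t / dist u y powr e) \<partial>lebesgue)"
    by (rule nn_integral_cmult) measurable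
  also have "(\<integral>\<^sup>+y\<in>D. ennreal (\<bar>f u - f y\<bar> powr t / dist u y powr e) \<partial>lebesgue) = ennreal (j powr t)"
    unfolding e_def by (rule inner_term_finite_integral[OF q p j])
  finally show ?thesis using m by (simp add: ennreal_mult m_def e_def)
qed

text \<open>The two values are compared through a third point y of \<open>B\<close>, which lies in
  the shadows of both \<open>A\<close> and \<open>B\<close>. For q = \<infinity> almost every y will
  do; for finite q some y is no worse than average.\<close>

lemma pair_estimate:
  assumes s: "0 < s" and p: "1 \<le> p" and q: "1 \<le> (q::ereal)"
  obtains C where "C > 0" "\<And>f A B z w h k. f \<in> borel_measurable lebesgue \<Longrightarrow> A \<in> W \<Longrightarrow> B \<in> SH A \<Longrightarrow> side A \<le> 2 * side B \<Longrightarrow>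
     z \<in> A \<Longrightarrow> w \<in> B \<Longrightarrow> h \<ge> 0 \<Longrightarrow> k \<ge> 0 \<Longrightarrow> inner_term s p q f (Shr W \<rho> A) z = ennreal (h powr p) \<Longrightarrow>
     inner_term s p q f (Shr W \<rho> B) w = ennreal (k powr p) \<Longrightarrow> \<bar>f z - f w\<bar> \<le> C * (side B powr s * (h + k))"
proof (cases "q = \<infinity>")
  case True
  show thesis
  proof (rule that[of "(4 * \<rho>) powr s"])
    show "(4 * \<rho>) powr s > 0" using rho_gt1 by simp
    fix f A B z w h k
    assume f: "f \<in> borel_measurable lebesgue" and A: "A \<in> W" and B: "B \<in> SH A" and AB: "side A \<le> 2 * side B"
      and z: "z \<in> A" and w: "w \<in> B" and h: "h \<ge> 0" and k: "k \<ge> 0"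
      and hz: "inner_term s p q f (Shr W \<rho> A) z = ennreal (h powr p)"
      and kw: "inner_term s p q f (Shr W \<rho> B) w = ennreal (k powr p)"
    have BW: "B \<in> W" using B by (simp add: SHr_def)
    have sub: "B \<subseteq> Shr W \<rho> A" "B \<subseteq> Shr W \<rho> B" using B self_SH[OF BW] unfolding Shr_def by auto
    have "AE y in lebesgue. y \<in> B \<longrightarrow> \<bar>f z - f y\<bar> \<le> h * dist z y powr s \<and> \<bar>f w - f y\<bar> \<le> k * dist w y powr s"
      using inner_term_finite_AE[OF True f Shr_sets p h hz] inner_term_finite_AE[OF True f Shr_sets p k kw] sub
      by (auto elim!: eventually_elim2)
    \<comment> \<open>\<open>B\<close> has positive measure, so what holds at almost every point of
      \<open>B\<close> holds at some point of it.\<close>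
    moreover have "\<not> (AE y in lebesgue. y \<notin> B)"
    proof
      assume "AE y in lebesgue. y \<notin> B"
      then have "emeasure lebesgue B = 0" by (subst (asm) AE_iff_measurable[OF W_sets[OF BW]]) auto
      then show False using W_emeasure[OF BW] side_pos[OF BW] by simp
    qed
    ultimately obtain y where y: "y \<in> B" "\<bar>f z - f y\<bar> \<le> h * dist z y powr s" "\<bar>f w - f y\<bar> \<le> k * dist w y powr s"
      by (smt (verit) eventually_mono)
    have d: "dist z y \<le> 4 * \<rho> * side B" "dist w y \<le> 4 * \<rho> * side B"
      using Shr_dist_neighbour[OF A B AB] z w y(1) by blast+
    have "dist z y powr s \<le> (4 * \<rho> * side B) powr s" "dist w y powr s \<le> (4 * \<rho> * side B) powr s"
      using d s by (auto intro!: powr_mono2)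
    then have "h * dist z y powr s \<le> h * (4 * \<rho> * side B) powr s" "k * dist w y powr s \<le> k * (4 * \<rho> * side B) powr s"
      using h k by (auto intro!: mult_left_mono)
    then have "\<bar>f z - f w\<bar> \<le> h * (4 * \<rho> * side B) powr s + k * (4 * \<rho> * side B) powr s"
      using y by linarith
    also have "\<dots> = (4 * \<rho>) powr s * (side B powr s * (h + k))"
      using rho_gt1 side_pos[OF BW] by (simp add: powr_mult algebra_simps)
    finally show "\<bar>f z - f w\<bar> \<le> (4 * \<rho>) powr s * (side B powr s * (h + k))" .
  qed
next
  case False
  let ?d = "real DIM('a)"
  define t where "t = real_of_ereal q"
  have t: "t \<ge> 1" using q False unfolding t_def by (cases q) auto
  define e where "e = s * t + ?d"
  have e: "e > 0" unfolding e_def using s t by (simp add: add_pos_nonneg)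
  \<comment> \<open>4 \<rho> bounds both distances in units of side B; the 2 comes from h^t + k^t
    \<le> 2 (h + k)^t.\<close>
  define c where "c = (2 * (4 * \<rho>) powr e) powr (1 / t)"
  show thesis
  proof (rule that[of "2 * c"])
    show "2 * c > 0" using rho_gt1 unfolding c_def by simp
    fix f A B z w h k
    assume f: "f \<in> borel_measurable lebesgue" and A: "A \<in> W" and B: "B \<in> SH A" and AB: "side A \<le> 2 * side B"
      and z: "z \<in> A" and w: "w \<in> B" and h: "h \<ge> 0" and k: "k \<ge> 0"
      and hz: "inner_term s p q f (Shr W \<rho> A) z = ennreal (h powr p)"
      and kw: "inner_term s p q f (Shr W \<rho> B) w = ennreal (k powr p)"
    have BW: "B \<in> W" using B by (simp add: SHr_def)
    have sB: "side B > 0" using side_pos BW .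
    have sub: "B \<subseteq> Shr W \<rho> A" "B \<subseteq> Shr W \<rho> B" using B self_SH[OF BW] unfolding Shr_def by auto
    have dz: "dist z y \<le> 4 * \<rho> * side B" and dw: "dist w y \<le> 4 * \<rho> * side B" if "y \<in> B" for y
      using Shr_dist_neighbour[OF A B AB] z w that by blast+
    define m where "m = (4 * \<rho> * side B) powr e"
    have m: "m > 0" unfolding m_def using rho_gt1 sB by simp
    note [measurable] = f W_sets[OF BW] difference_quotient_measurable_section[OF f]
    note part = integral_powr_le[OF f _ _ False q t_def s p, folded e_def]
    \<comment> \<open>One point y must serve both differences, hence the average is taken of their
      sum.\<close>
    define g where "g y = ennreal (\<bar>f z - f y\<bar> powr t) + ennreal (\<bar>f w - f y\<bar> powr t)" for y
    have gm: "g \<in> borel_measurable lebesgue" unfolding g_def by measurable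
    have eB: "emeasure lebesgue B = ennreal (side B ^ DIM('a))" by (rule W_emeasure[OF BW])
    obtain y where y: "y \<in> B" "g y * emeasure lebesgue B \<le> (\<integral>\<^sup>+y\<in>B. g y \<partial>lebesgue)"
      using exists_le_average[OF gm W_sets[OF BW]] eB sB by (auto simp: ennreal_less_top)
    have "(\<integral>\<^sup>+y\<in>B. g y \<partial>lebesgue) = (\<integral>\<^sup>+y\<in>B. ennreal (\<bar>f z - f y\<bar> powr t) \<partial>lebesgue) + (\<integral>\<^sup>+y\<in>B. ennreal (\<bar>f w - f y\<bar> powr t) \<partial>lebesgue)"
      unfolding g_def distrib_right by (intro nn_integral_add) measurable
    also have "\<dots> \<le> ennreal (m * h powr t) + ennreal (m * k powr t)"
      unfolding m_def by (rule add_mono[OF part[OF sub(1) Shr_sets dz h hz] part[OF sub(2) Shr_sets dw k kw]])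
    also have "\<dots> = ennreal (m * h powr t + m * k powr t)" using m by simp
    also have "\<dots> \<le> ennreal (2 * m * (h + k) powr t)"
    proof -
      have "h powr t \<le> (h + k) powr t" "k powr t \<le> (h + k) powr t" using h k t by (auto intro!: powr_mono2)
      then have "m * h powr t + m * k powr t \<le> m * (h + k) powr t + m * (h + k) powr t"
        using m by (intro add_mono mult_left_mono) auto
      then show ?thesis by (intro ennreal_leI) simp
    qed
    finally have "g y * emeasure lebesgue B \<le> ennreal (2 * m * (h + k) powr t)" using y by simp
    then have "ennreal ((\<bar>f z - f y\<bar> powr t + \<bar>f w - f y\<bar> powr t) * side B ^ DIM('a)) \<le> ennreal (2 * m * (h + k) powr t)"
      using sB unfolding g_def eB by (simp add: ennreal_mult)
    then have le: "(\<bar>f z - f y\<bar> powr t + \<bar>f w - f y\<bar> powr t) * side B ^ DIM('a) \<le> 2 * m * (h + k) powr t"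
      using m by (subst (asm) ennreal_le_iff) auto
    \<comment> \<open>The kernel exponent s t + d splits: the part d cancels against the volume of
      \<open>B\<close>, the part s t leaves side B^s after the t-th root.\<close>
    have "m = (4 * \<rho>) powr e * (side B powr s) powr t * side B ^ DIM('a)"
      using rho_gt1 sB unfolding m_def e_def by (simp add: powr_mult powr_add powr_powr powr_realpow)
    then have "\<bar>f z - f y\<bar> powr t + \<bar>f w - f y\<bar> powr t \<le> 2 * (4 * \<rho>) powr e * (side B powr s) powr t * (h + k) powr t"
      using le sB by (simp add: mult_ac)
    also have "\<dots> = (c * (side B powr s * (h + k))) powr t"
      using rho_gt1 h k t unfolding c_def by (simp add: powr_mult powr_powr)
    finally have X: "\<bar>f z - f y\<bar> powr t + \<bar>f w - f y\<bar> powr t \<le> (c * (side B powr s * (h + k))) powr t" .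
    have cp: "c * (side B powr s * (h + k)) \<ge> 0" unfolding c_def using h k by simp
    have "\<bar>f z - f y\<bar> powr t \<le> (c * (side B powr s * (h + k))) powr t" "\<bar>f w - f y\<bar> powr t \<le> (c * (side B powr s * (h + k))) powr t"
      using X powr_ge_zero[of "\<bar>f z - f y\<bar>" t] powr_ge_zero[of "\<bar>f w - f y\<bar>" t] by linarith+
    then have "\<bar>f z - f y\<bar> \<le> c * (side B powr s * (h + k))" "\<bar>f w - f y\<bar> \<le> c * (side B powr s * (h + k))"
      using cp t by (auto elim!: powr_le_powrD)
    then show "\<bar>f z - f w\<bar> \<le> 2 * c * (side B powr s * (h + k))" by (simp add: algebra_simps)
  qed
qed

end

section \<open>Telescoping along chains\<close>

lemma sum_le_nn_integral_count_space:
  fixes f :: "'i \<Rightarrow> ennreal"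
  assumes "finite F" "F \<subseteq> A"
  shows "sum f F \<le> (\<integral>\<^sup>+i. f i \<partial>count_space A)"
proof -
  have "sum f F = (\<integral>\<^sup>+i. f i \<partial>count_space F)" using assms by (simp add: nn_integral_count_space_finite)
  also have "\<dots> = (\<integral>\<^sup>+i. f i * indicator F i \<partial>count_space UNIV)" by (rule nn_integral_count_space_indicator) simp
  also have "\<dots> \<le> (\<integral>\<^sup>+i. f i * indicator A i \<partial>count_space UNIV)"
    using assms by (intro nn_integral_mono mult_left_mono) (auto split: split_indicator)
  also have "\<dots> = (\<integral>\<^sup>+i. f i \<partial>count_space A)" by (rule nn_integral_count_space_indicator[symmetric]) simp
  finally show ?thesis .
qed

text \<open>Written as integrals, sums over cubes can be exchanged with each other and with Lebesgue
  integrals by Tonelli's theorem; the supremum carries estimates for finite families over to all of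
  \<open>A\<close>.\<close>

lemma nn_integral_count_space_eq_SUP:
  fixes f :: "'i \<Rightarrow> ennreal"
  assumes A: "countable A"
  shows "(\<integral>\<^sup>+i. f i \<partial>count_space A) = (SUP F\<in>{F. finite F \<and> F \<subseteq> A}. sum f F)"
proof (rule antisym)
  show "(SUP F\<in>{F. finite F \<and> F \<subseteq> A}. sum f F) \<le> (\<integral>\<^sup>+i. f i \<partial>count_space A)"
    by (intro SUP_least) (auto intro: sum_le_nn_integral_count_space)
  show "(\<integral>\<^sup>+i. f i \<partial>count_space A) \<le> (SUP F\<in>{F. finite F \<and> F \<subseteq> A}. sum f F)"
  proof (cases "A = {}")
    case True then show ?thesis by (simp add: nn_integral_empty)
  next
    case False
    define B where "B n = from_nat_into A ` {..n}" for n :: nat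
    have B: "finite (B n)" "B n \<subseteq> A" for n using from_nat_into[OF False] unfolding B_def by auto
    have "(\<integral>\<^sup>+i. f i \<partial>count_space A) = (\<integral>\<^sup>+i. (SUP n. f i * indicator (B n) i) \<partial>count_space A)"
    proof (rule nn_integral_cong)
      fix i assume "i \<in> space (count_space A)"
      then obtain m where m: "i = from_nat_into A m" using A by (auto dest: from_nat_into_surj)
      show "f i = (SUP n. f i * indicator (B n) i)"
      proof (rule antisym)
        show "f i \<le> (SUP n. f i * indicator (B n) i)"
          by (rule SUP_upper2[of m]) (auto simp: m B_def)
      qed (auto intro!: SUP_least split: split_indicator)
    qed
    also have "\<dots> = (SUP n. \<integral>\<^sup>+i. f i * indicator (B n) i \<partial>count_space A)"
      by (rule nn_integral_monotone_convergence_SUP)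
         (auto simp: incseq_def le_fun_def B_def split: split_indicator)
    also have "\<dots> \<le> (SUP F\<in>{F. finite F \<and> F \<subseteq> A}. sum f F)"
    proof (rule SUP_least)
      fix n
      have "(\<integral>\<^sup>+i. f i * indicator (B n) i \<partial>count_space A) = (\<Sum>i\<in>B n. f i * indicator (B n) i)"
        using B by (intro nn_integral_count_space') auto
      also have "\<dots> = sum f (B n)" by (intro sum.cong) auto
      also have "\<dots> \<le> (SUP F\<in>{F. finite F \<and> F \<subseteq> A}. sum f F)"
        using B by (intro SUP_upper) auto
      finally show "(\<integral>\<^sup>+i. f i * indicator (B n) i \<partial>count_space A) \<le> (SUP F\<in>{F. finite F \<and> F \<subseteq> A}. sum f F)" .
    qed
    finally show ?thesis .
  qed
qed

lemma nn_integral_count_space_le: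
  fixes f :: "'i \<Rightarrow> ennreal"
  assumes "countable A" "\<And>F. finite F \<Longrightarrow> F \<subseteq> A \<Longrightarrow> sum f F \<le> c"
  shows "(\<integral>\<^sup>+i. f i \<partial>count_space A) \<le> c"
  unfolding nn_integral_count_space_eq_SUP[OF assms(1)] using assms(2) by (intro SUP_least) auto

lemma measurable_nn_integral_count_space:
  fixes f :: "'i \<Rightarrow> 'a \<Rightarrow> ennreal"
  assumes "countable I" "\<And>i. i \<in> I \<Longrightarrow> f i \<in> borel_measurable M"
  shows "(\<lambda>x. \<integral>\<^sup>+i. f i x \<partial>count_space I) \<in> borel_measurable M"
  unfolding nn_integral_count_space_eq_SUP[OF assms(1)]
  using assms by (intro borel_measurable_SUP countable_Collect_finite_subset borel_measurable_sum) auto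

lemma infsum_eq_nn_integral_count_space:
  fixes f :: "'i \<Rightarrow> ennreal"
  assumes "countable A"
  shows "(\<Sum>\<^sub>\<infinity>i\<in>A. f i) = (\<integral>\<^sup>+i. f i \<partial>count_space A)"
  unfolding nn_integral_count_space_eq_SUP[OF assms] by (rule nonneg_infsum_complete) simp

lemma nn_integral_count_space_restrict:
  fixes f :: "'i \<Rightarrow> ennreal"
  assumes "B \<subseteq> A"
  shows "(\<integral>\<^sup>+i. f i \<partial>count_space B) = (\<integral>\<^sup>+i. f i * indicator B i \<partial>count_space A)"
proof -
  have "(\<integral>\<^sup>+i. f i \<partial>count_space B) = (\<integral>\<^sup>+i. f i * indicator B i \<partial>count_space UNIV)"
    by (rule nn_integral_count_space_indicator) simp
  also have "\<dots> = (\<integral>\<^sup>+i. f i * indicator B i * indicator A i \<partial>count_space UNIV)"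
    using assms by (intro nn_integral_cong) (auto split: split_indicator)
  also have "\<dots> = (\<integral>\<^sup>+i. f i * indicator B i \<partial>count_space A)"
    by (rule nn_integral_count_space_indicator[symmetric]) simp
  finally show ?thesis .
qed

lemma nn_integral_count_space_swap:
  fixes f :: "'i \<Rightarrow> 'j \<Rightarrow> ennreal"
  assumes "countable I"
  shows "(\<integral>\<^sup>+j. \<integral>\<^sup>+i. f i j \<partial>count_space I \<partial>count_space J) = (\<integral>\<^sup>+i. \<integral>\<^sup>+j. f i j \<partial>count_space J \<partial>count_space I)"
  by (rule nn_integral_count_space_nn_integral[OF assms]) simp

lemma nn_integral_count_space_single:
  fixes f :: "'i \<Rightarrow> ennreal"
  assumes "i \<in> A" "\<And>j. j \<in> A \<Longrightarrow> j \<noteq> i \<Longrightarrow> f j = 0"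
  shows "(\<integral>\<^sup>+j. f j \<partial>count_space A) = f i"
  using nn_integral_count_space'[of "{i}" A f] assms by auto

text \<open>A walk may revisit a cube, yet the sum ranges over the set of its members: when the head
  recurs, the loop up to the recurrence is cut out. Otherwise each member takes part in at most two
  steps and the head in only one; subtracting \<open>e (hd cs)\<close> leaves the room in which the
  induction adds the step to a new head.\<close>

lemma walk_telescope:
  fixes g e :: "'i \<Rightarrow> real"
  assumes "cs \<noteq> []" "successively E cs"
    "\<And>A B. A \<in> set cs \<Longrightarrow> B \<in> set cs \<Longrightarrow> E A B \<Longrightarrow> \<bar>g A - g B\<bar> \<le> e A + e B"
    "\<And>A. A \<in> set cs \<Longrightarrow> e A \<ge> 0"
  shows "\<bar>g (hd cs) - g (last cs)\<bar> \<le> 2 * (\<Sum>A\<in>set cs. e A) - e (hd cs)"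
  using assms
proof (induction "length cs" arbitrary: cs rule: less_induct)
  case less
  obtain A ds where cs: "cs = A # ds" using less.prems by (cases cs) auto
  show ?case
  proof (cases "ds = []")
    case True then show ?thesis using cs less.prems by simp
  next
    case ds: False
    show ?thesis
    proof (cases "A \<in> set ds")
      case True
      then obtain ys zs where yz: "ds = ys @ A # zs" by (meson split_list)
      have suc: "successively E (A # zs)"
        using less.prems(2) unfolding cs yz by (simp add: successively_Cons successively_append_iff)
      have "\<bar>g (hd (A # zs)) - g (last (A # zs))\<bar> \<le> 2 * (\<Sum>A\<in>set (A # zs). e A) - e (hd (A # zs))"
        using less.prems suc unfolding cs yz by (intro less.hyps) (auto simp: cs yz)
      moreover have "(\<Sum>A\<in>set (A # zs). e A) \<le> (\<Sum>A\<in>set cs. e A)"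
        using less.prems unfolding cs yz by (intro sum_mono2) auto
      ultimately show ?thesis unfolding cs yz by simp
    next
      case False
      have "\<bar>g (hd ds) - g (last ds)\<bar> \<le> 2 * (\<Sum>A\<in>set ds. e A) - e (hd ds)"
        using less.prems ds unfolding cs by (intro less.hyps) (auto simp: cs successively_Cons)
      moreover have "\<bar>g A - g (hd ds)\<bar> \<le> e A + e (hd ds)"
        using less.prems(2) ds unfolding cs by (intro less.prems(3)) (auto simp: cs successively_Cons)
      moreover have "(\<Sum>A\<in>set cs. e A) = e A + (\<Sum>A\<in>set ds. e A)" using False unfolding cs by simp
      ultimately show ?thesis using ds unfolding cs by simp
    qed
  qed
qed

section \<open>Chains from a cube up to a central cube\<close>

context uniform_shadow
begin

text \<open>The half of an admissible chain that leads from \<open>Q\<close> to the central cube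
  \<open>P\<close>. Admissibility enters through two consequences: \<open>Q\<close> is in the shadow
  of every member, and the sides are controlled by that of \<open>P\<close>.\<close>

definition reaches :: "'a set \<Rightarrow> 'a set \<Rightarrow> 'a set list \<Rightarrow> bool" where
  "reaches Q P cs \<longleftrightarrow> P \<in> W \<and> cs \<noteq> [] \<and> hd cs = Q \<and> last cs = P \<and> successively meet cs \<and> set cs \<subseteq> up Q
     \<and> (\<forall>R\<in>set cs. side R \<le> 2 * \<rho> * side P)"

text \<open>\<open>H R\<close> is the p-th root of the inner term at the sample point, which makes
  finiteness of that term part of the data. The comparison with the average over \<open>R\<close>
  enters separately, in the final integration.\<close>

definition sample :: "real \<Rightarrow> real \<Rightarrow> ereal \<Rightarrow> ('a \<Rightarrow> real) \<Rightarrow> ('a set \<Rightarrow> 'a) \<Rightarrow> ('a set \<Rightarrow> real) \<Rightarrow> bool" where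
  "sample s p q f z H \<longleftrightarrow> f \<in> borel_measurable lebesgue \<and> (\<forall>R\<in>W. z R \<in> R \<and> H R \<ge> 0 \<and>
     inner_term s p q f (Shr W \<rho> R) (z R) = ennreal (H R powr p))"

text \<open>Puts h, the p-th root of the inner term at the moving point x, on the cube
  \<open>Q\<close>, so that the link from x to \<open>z Q\<close> is accounted for in the same sum
  as the links between sample points.\<close>

definition bump :: "('a set \<Rightarrow> real) \<Rightarrow> 'a set \<Rightarrow> real \<Rightarrow> 'a set \<Rightarrow> real" where
  "bump H Q h R = H R + (if R = Q then h else 0)"

lemma up_subset: "up Q \<subseteq> W" by (auto simp: up_def)

lemma up_countable: "countable (up Q)"
  using W_countable countable_subset up_subset by blast

lemma self_up: "Q \<in> W \<Longrightarrow> Q \<in> up Q"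
  using self_SH by (simp add: up_def)

lemma bump_nonneg: "sample s p q f z H \<Longrightarrow> R \<in> W \<Longrightarrow> h \<ge> 0 \<Longrightarrow> bump H Q h R \<ge> 0"
  by (auto simp: sample_def bump_def)

lemma far_cube:
  assumes "Q \<in> W" "S \<in> W" "S \<notin> SH Q" "x \<in> Q" "y \<in> S"
  obtains P cs where "reaches Q P cs" "y \<in> Shr W \<rho> P" "side P \<le> 5 / \<epsilon> * dist x y"
proof -
  obtain P cs where P: "P \<in> W" "Q \<in> SH P" "S \<in> SH P" "\<epsilon> * side P \<le> DD Q S" and
    cs: "cs \<noteq> []" "hd cs = Q" "last cs = P" "successively meet cs" "set cs \<subseteq> W"
    "\<And>R. R \<in> set cs \<Longrightarrow> Q \<in> SH R \<and> side R \<le> 2 * \<rho> * side P"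
    using central_cube[OF assms(1,2)] by metis
  have "\<epsilon> * side P \<le> 5 * dist x y" using P(4) not_SH_dist(3)[OF assms] by simp
  then have "side P \<le> 5 / \<epsilon> * dist x y" using eps_pos by (simp add: field_simps)
  moreover have "reaches Q P cs" unfolding reaches_def up_def using P cs by auto
  moreover have "y \<in> Shr W \<rho> P" using P(3) assms(5) unfolding Shr_def by auto
  ultimately show thesis using that by blast
qed

lemma chain_estimate:
  assumes s: "0 < s" "s < 1" and p: "1 \<le> p" and q: "1 \<le> (q::ereal)"
  obtains C where "C > 0" "\<And>f z H Q P cs x h. sample s p q f z H \<Longrightarrow> Q \<in> W \<Longrightarrow> reaches Q P cs \<Longrightarrow> x \<in> Q \<Longrightarrow> h \<ge> 0 \<Longrightarrow>
     inner_term s p q f (Shr W \<rho> Q) x = ennreal (h powr p) \<Longrightarrow>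
     \<bar>f x - f (z P)\<bar> \<le> C * (\<Sum>R\<in>set cs. side R powr s * bump H Q h R)"
proof -
  obtain C where C: "C > 0" and pair: "\<And>f A B z w h k. f \<in> borel_measurable lebesgue \<Longrightarrow> A \<in> W \<Longrightarrow> B \<in> SH A \<Longrightarrow> side A \<le> 2 * side B \<Longrightarrow>
     z \<in> A \<Longrightarrow> w \<in> B \<Longrightarrow> h \<ge> 0 \<Longrightarrow> k \<ge> 0 \<Longrightarrow> inner_term s p q f (Shr W \<rho> A) z = ennreal (h powr p) \<Longrightarrow>
     inner_term s p q f (Shr W \<rho> B) w = ennreal (k powr p) \<Longrightarrow> \<bar>f z - f w\<bar> \<le> C * (side B powr s * (h + k))"
    using pair_estimate[OF s(1) p q] by blast
  show thesis
  proof (rule that[of "5 * C"])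
    show "5 * C > 0" using C by simp
    fix f z H Q P cs x h
    assume sm: "sample s p q f z H" and Q: "Q \<in> W" and r: "reaches Q P cs" and x: "x \<in> Q" and h: "h \<ge> 0"
      and hx: "inner_term s p q f (Shr W \<rho> Q) x = ennreal (h powr p)"
    have f: "f \<in> borel_measurable lebesgue"
      and zH: "\<And>R. R \<in> W \<Longrightarrow> z R \<in> R" "\<And>R. R \<in> W \<Longrightarrow> H R \<ge> 0"
       "\<And>R. R \<in> W \<Longrightarrow> inner_term s p q f (Shr W \<rho> R) (z R) = ennreal (H R powr p)"
      using sm unfolding sample_def by auto
    have cs: "cs \<noteq> []" "hd cs = Q" "last cs = P" "successively meet cs" "set cs \<subseteq> W"
      using r up_subset unfolding reaches_def by auto
    have Qcs: "Q \<in> set cs" using cs by (metis hd_in_set)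
    \<comment> \<open>A step between neighbours costs C (side B)^s (H A + H B). As side B \<le> 2
      side A and 2^s \<le> 2, this splits into one term for each cube, the form that telescoping
      needs.\<close>
    define e where "e R = 2 * C * (side R powr s * H R)" for R
    have "\<bar>f (z (hd cs)) - f (z (last cs))\<bar> \<le> 2 * (\<Sum>R\<in>set cs. e R) - e (hd cs)"
    proof (rule walk_telescope[OF cs(1,4)])
      fix A B assume "A \<in> set cs" "B \<in> set cs" and m: "meet A B"
      then have AB: "A \<in> W" "B \<in> W" using cs by auto
      have sAB: "side A \<le> 2 * side B" "side B \<le> 2 * side A" "side A > 0" "side B > 0"
        using meet_side[OF AB m] meet_side[OF AB(2,1)] m side_pos AB by (auto simp: Int_commute)
      have "side B powr s \<le> (2 * side A) powr s" using sAB s by (intro powr_mono2) auto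
      also have "\<dots> = 2 powr s * side A powr s" using sAB by (simp add: powr_mult)
      also have "\<dots> \<le> 2 * side A powr s"
      proof -
        have "2 powr s \<le> 2 powr 1" using s by (intro powr_mono) auto
        then show ?thesis by (intro mult_right_mono) auto
      qed
      finally have "side B powr s * H A \<le> 2 * (side A powr s * H A)"
        using zH(2)[OF AB(1)] mult_right_mono by fastforce
      moreover have "side B powr s * H B \<le> 2 * (side B powr s * H B)" using zH(2)[OF AB(2)] by simp
      ultimately have "side B powr s * (H A + H B) \<le> 2 * (side A powr s * H A) + 2 * (side B powr s * H B)"
        unfolding distrib_left by linarith
      then have "C * (side B powr s * (H A + H B)) \<le> C * (2 * (side A powr s * H A) + 2 * (side B powr s * H B))"
        using C by simp
      also have "\<dots> = e A + e B" unfolding e_def by (simp add: algebra_simps)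
      finally show "\<bar>f (z A) - f (z B)\<bar> \<le> e A + e B"
        using pair[OF f AB(1) meet_SH[OF AB m] sAB(1) zH(1)[OF AB(1)] zH(1)[OF AB(2)] zH(2)[OF AB(1)] zH(2)[OF AB(2)] zH(3)[OF AB(1)] zH(3)[OF AB(2)]]
        by linarith
    next
      fix A assume "A \<in> set cs"
      then show "e A \<ge> 0" unfolding e_def using zH(2)[of A] cs C by auto
    qed
    then have 1: "\<bar>f (z Q) - f (z P)\<bar> \<le> 2 * (\<Sum>R\<in>set cs. e R)"
      using cs zH(2)[OF Q] C unfolding e_def by (smt (verit) mult_nonneg_nonneg powr_ge_zero)
    have 2: "\<bar>f x - f (z Q)\<bar> \<le> C * (side Q powr s * (h + H Q))"
      using side_pos[OF Q] by (intro pair[OF f Q self_SH[OF Q] _ x zH(1)[OF Q] h zH(2)[OF Q] hx zH(3)[OF Q]]) auto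
    have 3: "(\<Sum>R\<in>set cs. side R powr s * H R) \<le> (\<Sum>R\<in>set cs. side R powr s * bump H Q h R)"
      using h unfolding bump_def by (intro sum_mono mult_left_mono) auto
    have "side Q powr s * bump H Q h Q \<le> (\<Sum>R\<in>set cs. side R powr s * bump H Q h R)"
      using Qcs cs bump_nonneg[OF sm _ h] by (intro member_le_sum mult_nonneg_nonneg) auto
    then have 4: "side Q powr s * (h + H Q) \<le> (\<Sum>R\<in>set cs. side R powr s * bump H Q h R)"
      by (simp add: bump_def add.commute)
    \<comment> \<open>One share for the link from x to \<open>z Q\<close>, four for the walk: 2 from
      telescoping and 2 from \<open>e\<close>.\<close>
    have "\<bar>f x - f (z P)\<bar> \<le> C * (side Q powr s * (h + H Q)) + 4 * (C * (\<Sum>R\<in>set cs. side R powr s * H R))"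
      using 1 2 unfolding e_def sum_distrib_left[symmetric] by linarith
    also have "\<dots> \<le> C * (\<Sum>R\<in>set cs. side R powr s * bump H Q h R) + 4 * (C * (\<Sum>R\<in>set cs. side R powr s * bump H Q h R))"
      using 3 4 C by (intro add_mono mult_left_mono) auto
    finally show "\<bar>f x - f (z P)\<bar> \<le> 5 * C * (\<Sum>R\<in>set cs. side R powr s * bump H Q h R)" by simp
  qed
qed

text \<open>The weights (side R / side P)^s add up to at most \<open>M\<close> along the chain,
  since its sides are at most 2 \<rho> side P and boundedly many cubes share a side. Jensen's
  inequality with these weights gives the t-th power at a cost independent of the chain.
  \<open>H P\<close> is covered by the summand of \<open>P\<close>, whose weight is 1.\<close>

lemma far_estimate:
  assumes s: "0 < s" "s < 1" and p: "1 \<le> p" and q: "1 \<le> (q::ereal)" and t: "(1::real) \<le> t"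
  obtains C where "C > 0" "\<And>f z H Q P cs x h. sample s p q f z H \<Longrightarrow> Q \<in> W \<Longrightarrow> reaches Q P cs \<Longrightarrow> x \<in> Q \<Longrightarrow> h \<ge> 0 \<Longrightarrow>
     inner_term s p q f (Shr W \<rho> Q) x = ennreal (h powr p) \<Longrightarrow>
     (\<bar>f x - f (z P)\<bar> / side P powr s) powr t + H P powr t
      \<le> C * (\<Sum>R\<in>set cs. (side R / side P) powr s * bump H Q h R powr t)"
proof -
  obtain C where C: "C > 0" and chain: "\<And>f z H Q P cs x h. sample s p q f z H \<Longrightarrow> Q \<in> W \<Longrightarrow> reaches Q P cs \<Longrightarrow> x \<in> Q \<Longrightarrow> h \<ge> 0 \<Longrightarrow>
     inner_term s p q f (Shr W \<rho> Q) x = ennreal (h powr p) \<Longrightarrow>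
     \<bar>f x - f (z P)\<bar> \<le> C * (\<Sum>R\<in>set cs. side R powr s * bump H Q h R)"
    using chain_estimate[OF s p q] by blast
  define M where "M = (2 * \<rho>) powr s * (upmult / (1 - 2 powr - s))"
  define K where "K = C powr t * M powr (t - 1)"
  show thesis
  proof (rule that[of "K + 1"])
    show "K + 1 > 0" unfolding K_def by (simp add: add_nonneg_pos)
    fix f z H Q P cs x h
    assume sm: "sample s p q f z H" and Q: "Q \<in> W" and r: "reaches Q P cs" and x: "x \<in> Q" and h: "h \<ge> 0"
      and hx: "inner_term s p q f (Shr W \<rho> Q) x = ennreal (h powr p)"
    have cs: "cs \<noteq> []" "last cs = P" "set cs \<subseteq> up Q" "P \<in> W" "\<And>R. R \<in> set cs \<Longrightarrow> side R \<le> 2 * \<rho> * side P"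
      using r unfolding reaches_def by auto
    have Pcs: "P \<in> set cs" using cs by (metis last_in_set)
    have sP: "side P > 0" using side_pos[OF cs(4)] .
    have sR: "side R > 0" if "R \<in> set cs" for R using that cs(3) up_subset side_pos by blast
    have bn: "bump H Q h R \<ge> 0" if "R \<in> set cs" for R using that cs(3) up_subset bump_nonneg[OF sm _ h] by blast
    define w where "w R = (side R / side P) powr s" for R :: "'a set"
    have w: "w R > 0" if "R \<in> set cs" for R unfolding w_def using sR[OF that] sP by simp
    have wM: "(\<Sum>R\<in>set cs. w R) \<le> M"
    proof -
      have r2: "2 * \<rho> * side P > 0" using rho_gt1 sP by simp
      have "(\<Sum>R\<in>set cs. w R) = (2 * \<rho>) powr s * (\<Sum>R\<in>set cs. (side R / (2 * \<rho> * side P)) powr s)"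
        unfolding sum_distrib_left w_def
      proof (rule sum.cong[OF refl])
        fix R assume "R \<in> set cs"
        have "side R / side P = (2 * \<rho>) * (side R / (2 * \<rho> * side P))" using rho_gt1 by simp
        then show "(side R / side P) powr s = (2 * \<rho>) powr s * (side R / (2 * \<rho> * side P)) powr s"
          using rho_gt1 sR[OF \<open>R \<in> set cs\<close>] sP by (metis powr_mult)
      qed
      also have "\<dots> \<le> M"
        unfolding M_def using cs s r2 by (intro mult_left_mono up_sum_small[OF Q]) auto
      finally show ?thesis .
    qed
    have "\<bar>f x - f (z P)\<bar> / side P powr s \<le> C * (\<Sum>R\<in>set cs. side R powr s * bump H Q h R) / side P powr s"
      using chain[OF sm Q r x h hx] by (intro divide_right_mono) auto
    also have "\<dots> = C * (\<Sum>R\<in>set cs. w R * bump H Q h R)"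
      unfolding w_def sum_divide_distrib times_divide_eq_right[symmetric]
      using sP sR by (intro arg_cong[where f="(*) C"] sum.cong) (auto simp: powr_divide less_imp_le)
    finally have "(\<bar>f x - f (z P)\<bar> / side P powr s) powr t \<le> (C * (\<Sum>R\<in>set cs. w R * bump H Q h R)) powr t"
      using t by (intro powr_mono2) auto
    also have "\<dots> = C powr t * (\<Sum>R\<in>set cs. w R * bump H Q h R) powr t"
      using C w bn by (intro powr_mult)
    also have "\<dots> \<le> C powr t * ((\<Sum>R\<in>set cs. w R) powr (t - 1) * (\<Sum>R\<in>set cs. w R * bump H Q h R powr t))"
      using w bn t by (intro mult_left_mono powr_sum_weighted_le) auto
    also have "\<dots> \<le> C powr t * (M powr (t - 1) * (\<Sum>R\<in>set cs. w R * bump H Q h R powr t))"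
      using wM t w less_imp_le[OF w] by (intro mult_left_mono mult_right_mono powr_mono2 sum_nonneg mult_nonneg_nonneg) auto
    also have "\<dots> = K * (\<Sum>R\<in>set cs. w R * bump H Q h R powr t)" by (simp add: K_def)
    finally have 1: "(\<bar>f x - f (z P)\<bar> / side P powr s) powr t \<le> K * (\<Sum>R\<in>set cs. w R * bump H Q h R powr t)" .
    have "H P powr t \<le> bump H Q h P powr t"
      using sm cs(4) h t unfolding bump_def sample_def by (intro powr_mono2) auto
    also have "\<dots> = w P * bump H Q h P powr t" using sP by (simp add: w_def)
    also have "\<dots> \<le> (\<Sum>R\<in>set cs. w R * bump H Q h R powr t)"
      using Pcs less_imp_le[OF w] by (intro member_le_sum mult_nonneg_nonneg) auto
    finally show "(\<bar>f x - f (z P)\<bar> / side P powr s) powr t + H P powr t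
      \<le> (K + 1) * (\<Sum>R\<in>set cs. (side R / side P) powr s * bump H Q h R powr t)"
      using 1 unfolding w_def distrib_right by linarith
  qed
qed

lemma up_weight_ge:
  assumes "Q \<in> W" "R \<in> up Q" "\<eta> > 0"
  shows "1 \<le> (2 * \<rho>) powr \<eta> * (side R / side Q) powr \<eta>"
proof -
  have "R \<in> W" "Q \<in> SH R" using assms unfolding up_def by auto
  then have "side Q \<le> 2 * \<rho> * side R" "side R > 0" "side Q > 0" using SH_side side_pos assms by auto
  then have "1 \<le> 2 * \<rho> * (side R / side Q)" "side R / side Q > 0" by (auto simp: field_simps)
  then have "1 powr \<eta> \<le> (2 * \<rho> * (side R / side Q)) powr \<eta>" using assms by (intro powr_mono2) auto
  also have "\<dots> = (2 * \<rho>) powr \<eta> * (side R / side Q) powr \<eta>"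
    using rho_gt1 \<open>side R / side Q > 0\<close> by (intro powr_mult)
  finally show ?thesis by simp
qed

text \<open>The weights on the right are bounded below, which settles p \<le> t. For p > t they pay
  for Jensen's inequality, and any \<eta> > 0 is enough because every positive power of side Q /
  side R is summable over \<open>up Q\<close>.\<close>

lemma up_power_sum:
  assumes pt: "(0::real) < p" "0 < t" and \<eta>: "0 < \<eta>"
  obtains C where "C > 0" "\<And>Q F b. Q \<in> W \<Longrightarrow> finite F \<Longrightarrow> F \<subseteq> up Q \<Longrightarrow> (\<And>R. R \<in> F \<Longrightarrow> b R \<ge> 0) \<Longrightarrow>
     (\<Sum>R\<in>F. b R powr t) powr (p / t) \<le> C * (\<Sum>R\<in>F. b R powr p * (side R / side Q) powr \<eta>)"
proof (cases "p / t \<le> 1")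
  case True
  have r1: "2 * \<rho> > 0" using rho_gt1 by simp
  show thesis
  proof (rule that[of "(2 * \<rho>) powr \<eta>"])
    show "(2 * \<rho>) powr \<eta> > 0" using r1 by simp
    fix Q F b assume Q: "Q \<in> W" and F: "finite F" "F \<subseteq> up Q" and b: "\<And>R. R \<in> F \<Longrightarrow> b R \<ge> (0::real)"
    have "(\<Sum>R\<in>F. b R powr t) powr (p / t) \<le> (\<Sum>R\<in>F. (b R powr t) powr (p / t))"
      using F pt True by (intro powr_sum_subadd) auto
    also have "\<dots> = (\<Sum>R\<in>F. b R powr p)" using pt by (simp add: powr_powr)
    also have "\<dots> \<le> (\<Sum>R\<in>F. (2 * \<rho>) powr \<eta> * (b R powr p * (side R / side Q) powr \<eta>))"
    proof (rule sum_mono)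
      fix R assume R: "R \<in> F"
      have "1 \<le> (2 * \<rho>) powr \<eta> * (side R / side Q) powr \<eta>" using up_weight_ge Q R F \<eta> by auto
      then have "b R powr p * 1 \<le> b R powr p * ((2 * \<rho>) powr \<eta> * (side R / side Q) powr \<eta>)"
        by (intro mult_left_mono) auto
      then show "b R powr p \<le> (2 * \<rho>) powr \<eta> * (b R powr p * (side R / side Q) powr \<eta>)" by (simp add: mult_ac)
    qed
    finally show "(\<Sum>R\<in>F. b R powr t) powr (p / t) \<le> (2 * \<rho>) powr \<eta> * (\<Sum>R\<in>F. b R powr p * (side R / side Q) powr \<eta>)"
      by (simp add: sum_distrib_left)
  qed
next
  case False
  define r where "r = p / t"
  have r: "r > 1" using False unfolding r_def by simp
  \<comment> \<open>Makes w^(1 - r), the factor that Jensen's inequality leaves over for w = (side Q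
    / side R)^\<theta>, equal to (side R / side Q)^\<eta>.\<close>
  define \<theta> where "\<theta> = \<eta> / (r - 1)"
  have \<theta>: "\<theta> > 0" using \<eta> r unfolding \<theta>_def by simp
  define M where "M = (2 * \<rho>) powr \<theta> * (upmult / (1 - 2 powr - \<theta>))"
  have r1: "2 * \<rho> > 0" using rho_gt1 by simp
  show thesis
  proof (rule that[of "M powr (r - 1) + 1"])
    show "M powr (r - 1) + 1 > 0" by (simp add: add_nonneg_pos)
    fix Q F b assume Q: "Q \<in> W" and F: "finite F" "F \<subseteq> up Q" and b: "\<And>R. R \<in> F \<Longrightarrow> b R \<ge> (0::real)"
    have sQ: "side Q > 0" using side_pos Q .
    have sR: "side R > 0" if "R \<in> F" for R using that F up_subset side_pos by blast
    define w where "w R = (side Q / side R) powr \<theta>" for R :: "'a set"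
    have w: "w R > 0" if "R \<in> F" for R unfolding w_def using sQ sR[OF that] by simp
    have wM: "(\<Sum>R\<in>F. w R) \<le> M"
    proof -
      have "(\<Sum>R\<in>F. w R) = (2 * \<rho>) powr \<theta> * (\<Sum>R\<in>F. ((side Q / (2 * \<rho>)) / side R) powr \<theta>)"
        unfolding sum_distrib_left w_def
      proof (rule sum.cong[OF refl])
        fix R assume "R \<in> F"
        have "side Q / side R = (2 * \<rho>) * ((side Q / (2 * \<rho>)) / side R)" using rho_gt1 by simp
        then show "(side Q / side R) powr \<theta> = (2 * \<rho>) powr \<theta> * ((side Q / (2 * \<rho>)) / side R) powr \<theta>"
          using rho_gt1 sR[OF \<open>R \<in> F\<close>] sQ by (metis powr_mult)
      qed
      also have "\<dots> \<le> M"
        unfolding M_def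
      proof (intro mult_left_mono up_sum_large[OF Q F(2,1) \<theta>])
        show "side Q / (2 * \<rho>) > 0" using r1 sQ by simp
        show "side Q / (2 * \<rho>) \<le> side R" if R: "R \<in> F" for R
          using SH_side[of Q R] R F r1 unfolding up_def by (auto simp: field_simps)
      qed simp
      finally show ?thesis .
    qed
    have "(\<Sum>R\<in>F. b R powr t) = (\<Sum>R\<in>F. w R * (b R powr t / w R))"
      using w by (intro sum.cong) (auto simp: less_imp_neq[symmetric])
    then have "(\<Sum>R\<in>F. b R powr t) powr r = (\<Sum>R\<in>F. w R * (b R powr t / w R)) powr r" by simp
    also have "\<dots> \<le> (\<Sum>R\<in>F. w R) powr (r - 1) * (\<Sum>R\<in>F. w R * (b R powr t / w R) powr r)"
      using F r w less_imp_le[OF w] by (intro powr_sum_weighted_le) auto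
    also have "\<dots> \<le> M powr (r - 1) * (\<Sum>R\<in>F. w R * (b R powr t / w R) powr r)"
      using wM r less_imp_le[OF w] by (intro mult_right_mono powr_mono2 sum_nonneg mult_nonneg_nonneg) auto
    also have "(\<Sum>R\<in>F. w R * (b R powr t / w R) powr r) = (\<Sum>R\<in>F. b R powr p * (side R / side Q) powr \<eta>)"
    proof (rule sum.cong[OF refl])
      fix R assume R: "R \<in> F"
      have "(b R powr t / w R) powr r = b R powr p / w R powr r"
        using w[OF R] pt by (simp add: powr_divide powr_powr r_def)
      then have "w R * (b R powr t / w R) powr r = b R powr p * (w R powr 1 / w R powr r)" using w[OF R] by simp
      also have "w R powr 1 / w R powr r = w R powr (- (r - 1))" using w[OF R] by (simp add: powr_diff)
      also have "\<dots> = (side Q / side R) powr (- \<eta>)"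
      proof -
        have "\<theta> * (r - 1) = \<eta>" using r unfolding \<theta>_def by simp
        then have "\<theta> * - (r - 1) = - \<eta>" by (simp only: mult_minus_right)
        then show ?thesis unfolding w_def powr_powr by (rule arg_cong)
      qed
      also have "\<dots> = (side R / side Q) powr \<eta>"
        using sQ sR[OF R] by (simp add: powr_minus powr_divide)
      finally show "w R * (b R powr t / w R) powr r = b R powr p * (side R / side Q) powr \<eta>" .
    qed
    also have "M powr (r - 1) * (\<Sum>R\<in>F. b R powr p * (side R / side Q) powr \<eta>) \<le> (M powr (r - 1) + 1) * (\<Sum>R\<in>F. b R powr p * (side R / side Q) powr \<eta>)"
      by (intro mult_right_mono sum_nonneg) auto
    finally show "(\<Sum>R\<in>F. b R powr t) powr (p / t) \<le> (M powr (r - 1) + 1) * (\<Sum>R\<in>F. b R powr p * (side R / side Q) powr \<eta>)"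
      unfolding r_def .
  qed
qed

lemma AE_W: "AE y in lebesgue. y \<in> \<Omega> \<longrightarrow> (\<exists>S\<in>W. y \<in> S)"
proof -
  have "(\<Union>S\<in>W. closure S - S) \<in> null_sets lebesgue"
    using W_dyadic dyadic_cube_frontier_null by (intro null_sets_UN' W_countable) auto
  then show ?thesis
    using W_cover by (elim AE_I') blast
qed

section \<open>The inner term over the domain\<close>

text \<open>The common bound for finite and infinite q. Its weights are those that can be summed
  against side Q^d over a shadow; the value may be infinite.\<close>

definition energy :: "real \<Rightarrow> real \<Rightarrow> ('a set \<Rightarrow> real) \<Rightarrow> 'a set \<Rightarrow> ennreal" where
  "energy p \<eta> v Q = (\<integral>\<^sup>+R. ennreal (v R powr p * (side R / side Q) powr \<eta>) \<partial>count_space (up Q))"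

lemma energy_ge:
  assumes "finite F" "F \<subseteq> up Q"
  shows "ennreal (\<Sum>R\<in>F. v R powr p * (side R / side Q) powr \<eta>) \<le> energy p \<eta> v Q"
  using sum_le_nn_integral_count_space[OF assms, of "\<lambda>R. ennreal (v R powr p * (side R / side Q) powr \<eta>)"]
  unfolding energy_def by (simp add: sum_ennreal)

lemma energy_ge_self:
  assumes "Q \<in> W" "0 \<le> h" "h \<le> v Q" "p \<ge> 0"
  shows "ennreal (h powr p) \<le> energy p \<eta> v Q"
proof -
  have "ennreal (h powr p) \<le> ennreal (\<Sum>R\<in>{Q}. v R powr p * (side R / side Q) powr \<eta>)"
    using assms side_pos[OF assms(1)] by (intro ennreal_leI) (simp add: powr_mono2)
  also have "\<dots> \<le> energy p \<eta> v Q" using assms self_up by (intro energy_ge) auto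
  finally show ?thesis .
qed

lemma reaches_subset: "reaches Q P cs \<Longrightarrow> set cs \<subseteq> up Q" "reaches Q P cs \<Longrightarrow> P \<in> up Q" "reaches Q P cs \<Longrightarrow> P \<in> W"
  unfolding reaches_def by auto

text \<open>A supremum is bounded one y at a time, so a single chain is used for each y: the chain
  estimate at t = p suffices and no sum over central cubes arises.\<close>

lemma full_inner_term_le_sup:
  assumes s: "0 < s" "s < 1" and p: "1 \<le> p" and q: "q = \<infinity>" and \<eta>: "\<eta> > 0"
  obtains C where "C > 0" "\<And>f z H Q x h. sample s p q f z H \<Longrightarrow> Q \<in> W \<Longrightarrow> x \<in> Q \<Longrightarrow> h \<ge> 0 \<Longrightarrow>
     inner_term s p q f (Shr W \<rho> Q) x = ennreal (h powr p) \<Longrightarrow> \<Omega> \<in> sets lebesgue \<Longrightarrow>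
     inner_term s p q f \<Omega> x \<le> ennreal C * energy p \<eta> (bump H Q h) Q"
proof -
  have q1: "1 \<le> q" using q by simp
  obtain K where K: "K > 0" and far: "\<And>f z H Q P cs x h. sample s p q f z H \<Longrightarrow> Q \<in> W \<Longrightarrow> reaches Q P cs \<Longrightarrow> x \<in> Q \<Longrightarrow> h \<ge> 0 \<Longrightarrow>
     inner_term s p q f (Shr W \<rho> Q) x = ennreal (h powr p) \<Longrightarrow>
     (\<bar>f x - f (z P)\<bar> / side P powr s) powr p + H P powr p
      \<le> K * (\<Sum>R\<in>set cs. (side R / side P) powr s * bump H Q h R powr p)"
    using far_estimate[OF s p q1 p] by blast
  define \<kappa> where "\<kappa> = 5 / \<epsilon>"
  have \<kappa>: "\<kappa> > 0" unfolding \<kappa>_def using eps_pos by simp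
  have r1: "2 * \<rho> > 1" using rho_gt1 by simp
  define K1 where "K1 = 2 powr p * \<kappa> powr (s * p) * (2 * \<rho>) powr (s * p)"
  have K1: "K1 > 0" unfolding K1_def using \<kappa> r1 by simp
  define C where "C = 1 + K1 * K * (2 * \<rho>) powr s * (2 * \<rho>) powr \<eta>"
  have C: "C \<ge> 1" unfolding C_def using K1 K r1 by simp
  show thesis
  proof (rule that[of C])
    show "C > 0" using C by simp
    fix f z H Q x h
    assume sm: "sample s p q f z H" and Q: "Q \<in> W" and x: "x \<in> Q" and h: "h \<ge> 0"
      and hx: "inner_term s p q f (Shr W \<rho> Q) x = ennreal (h powr p)" and Om: "\<Omega> \<in> sets lebesgue"
    have f: "f \<in> borel_measurable lebesgue"
      and zH: "\<And>R. R \<in> W \<Longrightarrow> z R \<in> R" "\<And>R. R \<in> W \<Longrightarrow> H R \<ge> 0"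
       "\<And>R. R \<in> W \<Longrightarrow> inner_term s p q f (Shr W \<rho> R) (z R) = ennreal (H R powr p)"
      using sm unfolding sample_def by auto
    let ?v = "bump H Q h"
    let ?V = "energy p \<eta> ?v Q"
    have vQ: "h \<le> ?v Q" using zH(2)[OF Q] by (simp add: bump_def)
    \<comment> \<open>\<open>W\<close> is countable, so the exceptional sets of all \<open>P\<close>
      form one null set, and y may be fixed before the \<open>P\<close> that its chain
      selects.\<close>
    have "AE y in lebesgue. \<forall>P\<in>W. y \<in> Shr W \<rho> P \<longrightarrow> \<bar>f (z P) - f y\<bar> \<le> H P * dist (z P) y powr s"
      using W_countable inner_term_finite_AE[OF q f Shr_sets p zH(2) zH(3)] by (subst AE_ball_countable) auto
    moreover have "AE y in lebesgue. y \<in> Shr W \<rho> Q \<longrightarrow> \<bar>f x - f y\<bar> \<le> h * dist x y powr s"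
      by (rule inner_term_finite_AE[OF q f Shr_sets p h hx])
    ultimately have "AE y in lebesgue. y \<in> \<Omega> \<longrightarrow> ennreal (\<bar>f x - f y\<bar> powr p / dist x y powr (s * p)) \<le> ennreal C * ?V"
      using AE_W
    proof (eventually_elim, intro impI)
      fix y
      assume P: "\<forall>P\<in>W. y \<in> Shr W \<rho> P \<longrightarrow> \<bar>f (z P) - f y\<bar> \<le> H P * dist (z P) y powr s"
        and hy: "y \<in> Shr W \<rho> Q \<longrightarrow> \<bar>f x - f y\<bar> \<le> h * dist x y powr s"
        and yW: "y \<in> \<Omega> \<longrightarrow> (\<exists>S\<in>W. y \<in> S)" and y: "y \<in> \<Omega>"
      obtain S where S: "S \<in> W" "y \<in> S" using yW y by blast
      show "ennreal (\<bar>f x - f y\<bar> powr p / dist x y powr (s * p)) \<le> ennreal C * ?V"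
      proof (cases "S \<in> SH Q")
        case True
        then have "\<bar>f x - f y\<bar> \<le> h * dist x y powr s" using hy S unfolding Shr_def by auto
        then have "\<bar>f x - f y\<bar> powr p \<le> (h * dist x y powr s) powr p" using p by (intro powr_mono2) auto
        also have "\<dots> = h powr p * dist x y powr (s * p)" using h by (simp add: powr_mult powr_powr)
        finally have "\<bar>f x - f y\<bar> powr p / dist x y powr (s * p) \<le> h powr p"
          by (cases "x = y") (auto simp: field_simps)
        then have "ennreal (\<bar>f x - f y\<bar> powr p / dist x y powr (s * p)) \<le> ennreal (h powr p)" by (rule ennreal_leI)
        also have "\<dots> \<le> ?V" using Q h vQ p by (intro energy_ge_self) auto
        also have "\<dots> = 1 * ?V" by simp
        also have "\<dots> \<le> ennreal C * ?V" using C by (intro mult_right_mono) (auto simp flip: ennreal_1 intro!: ennreal_leI)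
        finally show ?thesis .
      next
        case False
        obtain P cs where r: "reaches Q P cs" and yP: "y \<in> Shr W \<rho> P" and sz: "side P \<le> \<kappa> * dist x y"
          using far_cube[OF Q S(1) False x S(2)] unfolding \<kappa>_def by blast
        have PW: "P \<in> W" using reaches_subset(3)[OF r] .
        have sP: "side P > 0" using side_pos[OF PW] .
        have D: "dist x y > 0" using sz sP \<kappa> by (metis less_le_trans zero_less_mult_pos)
        define a where "a = \<bar>f x - f (z P)\<bar>"
        have "dist (z P) y powr s \<le> (2 * \<rho> * side P) powr s"
          using Shr_dist[OF PW zH(1)[OF PW] yP] s by (intro powr_mono2) auto
        then have "\<bar>f (z P) - f y\<bar> \<le> H P * (2 * \<rho> * side P) powr s"
          using P PW yP zH(2)[OF PW] by (meson mult_left_mono order_trans)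
        then have "\<bar>f x - f y\<bar> \<le> a + H P * (2 * \<rho> * side P) powr s" unfolding a_def by linarith
        then have "\<bar>f x - f y\<bar> powr p \<le> (a + H P * (2 * \<rho> * side P) powr s) powr p" using p by (intro powr_mono2) auto
        also have "\<dots> \<le> 2 powr p * (a powr p + (H P * (2 * \<rho> * side P) powr s) powr p)"
          using zH(2)[OF PW] p unfolding a_def by (intro powr_add_le) auto
        also have "(H P * (2 * \<rho> * side P) powr s) powr p = (2 * \<rho>) powr (s * p) * side P powr (s * p) * H P powr p"
          using zH(2)[OF PW] sP r1 by (simp add: powr_mult powr_powr)
        also have "a powr p = (a / side P powr s) powr p * side P powr (s * p)"
          using sP unfolding a_def by (simp add: powr_divide powr_powr)
        finally have 1: "\<bar>f x - f y\<bar> powr p \<le> 2 powr p * ((a / side P powr s) powr p + (2 * \<rho>) powr (s * p) * H P powr p) * side P powr (s * p)"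
          by (simp add: algebra_simps)
        have "side P powr (s * p) \<le> (\<kappa> * dist x y) powr (s * p)" using sz sP s p by (intro powr_mono2) auto
        then have 2: "side P powr (s * p) \<le> \<kappa> powr (s * p) * dist x y powr (s * p)" using \<kappa> D by (simp add: powr_mult)
        have "1 \<le> (2 * \<rho>) powr (s * p)" using r1 s p by (simp add: ge_one_powr_ge_zero)
        then have 3: "(a / side P powr s) powr p + (2 * \<rho>) powr (s * p) * H P powr p \<le> (2 * \<rho>) powr (s * p) * ((a / side P powr s) powr p + H P powr p)"
          unfolding distrib_left by (intro add_mono) (auto simp: mult_le_cancel_right1)
        have "\<bar>f x - f y\<bar> powr p \<le> 2 powr p * ((2 * \<rho>) powr (s * p) * ((a / side P powr s) powr p + H P powr p)) * (\<kappa> powr (s * p) * dist x y powr (s * p))"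
          using 3 by (intro order_trans[OF 1] mult_mono 2 mult_left_mono) auto
        also have "\<dots> = K1 * ((a / side P powr s) powr p + H P powr p) * dist x y powr (s * p)" by (simp add: K1_def)
        finally have "\<bar>f x - f y\<bar> powr p / dist x y powr (s * p) \<le> K1 * ((a / side P powr s) powr p + H P powr p)"
          using D by (simp add: field_simps)
        also have "\<dots> \<le> K1 * (K * (\<Sum>R\<in>set cs. (side R / side P) powr s * ?v R powr p))"
          using far[OF sm Q r x h hx] K1 unfolding a_def by (intro mult_left_mono) auto
        \<comment> \<open>Exchange of weights at the cost of constants: side R / side P \<le> 2
          \<rho> along the chain, and side R / side Q \<ge> 1 / (2 \<rho>) on
          \<open>up Q\<close>.\<close>
        also have "\<dots> \<le> K1 * (K * (\<Sum>R\<in>set cs. (2 * \<rho>) powr s * ((2 * \<rho>) powr \<eta> * (?v R powr p * (side R / side Q) powr \<eta>))))"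
        proof (intro mult_left_mono sum_mono)
          fix R assume R: "R \<in> set cs"
          have RW: "side R > 0" "R \<in> up Q" "side R \<le> 2 * \<rho> * side P"
            using R r reaches_subset(1)[OF r] up_subset side_pos unfolding reaches_def by auto
          have "side R / side P \<le> 2 * \<rho>" using RW sP by (simp add: field_simps)
          then have a1: "(side R / side P) powr s \<le> (2 * \<rho>) powr s" using RW sP s by (intro powr_mono2) auto
          have "?v R powr p * 1 \<le> ?v R powr p * ((2 * \<rho>) powr \<eta> * (side R / side Q) powr \<eta>)"
            using up_weight_ge[OF Q RW(2) \<eta>] by (intro mult_left_mono) auto
          then have "?v R powr p \<le> (2 * \<rho>) powr \<eta> * (?v R powr p * (side R / side Q) powr \<eta>)" by (simp add: mult_ac)
          then show "(side R / side P) powr s * ?v R powr p \<le> (2 * \<rho>) powr s * ((2 * \<rho>) powr \<eta> * (?v R powr p * (side R / side Q) powr \<eta>))"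
            using a1 by (intro mult_mono) auto
        qed (use K K1 in auto)
        also have "\<dots> = (C - 1) * (\<Sum>R\<in>set cs. ?v R powr p * (side R / side Q) powr \<eta>)"
          unfolding C_def by (simp add: sum_distrib_left[symmetric])
        also have "\<dots> \<le> C * (\<Sum>R\<in>set cs. ?v R powr p * (side R / side Q) powr \<eta>)"
          by (intro mult_right_mono sum_nonneg) auto
        finally have "ennreal (\<bar>f x - f y\<bar> powr p / dist x y powr (s * p)) \<le> ennreal (C * (\<Sum>R\<in>set cs. ?v R powr p * (side R / side Q) powr \<eta>))"
          by (rule ennreal_leI)
        also have "\<dots> = ennreal C * ennreal (\<Sum>R\<in>set cs. ?v R powr p * (side R / side Q) powr \<eta>)"
          using C by (intro ennreal_mult) (auto intro!: sum_nonneg)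
        also have "\<dots> \<le> ennreal C * ?V" using reaches_subset(1)[OF r] by (intro mult_left_mono energy_ge) auto
        finally show ?thesis .
      qed
    qed
    then have "AE y in lebesgue_on \<Omega>. ennreal (\<bar>f x - f y\<bar> powr p / dist x y powr (s * p)) \<le> ennreal C * ?V"
      using Om by (subst AE_restrict_space_iff) auto
    moreover have "(\<lambda>y. ennreal (\<bar>f x - f y\<bar> powr p / dist x y powr (s * p))) \<in> borel_measurable (lebesgue_on \<Omega>)"
      by (intro measurable_restrict_space1 measurable_compose[OF difference_quotient_measurable_section[OF f] measurable_ennreal])
    ultimately show "inner_term s p q f \<Omega> x \<le> ennreal C * ?V"
      unfolding inner_term_def using q by (auto intro: esssup_I)
  qed
qed

text \<open>The finite bound, raised to the power t / p, bounds all finite partial sums and hence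
  their supremum.\<close>

lemma enn_powr_up_sum:
  assumes pt: "0 < p" "0 < t" and \<eta>: "0 < \<eta>"
  obtains C where "C > 0" "\<And>Q v. Q \<in> W \<Longrightarrow> (\<And>R. R \<in> W \<Longrightarrow> v R \<ge> 0) \<Longrightarrow>
     enn_powr (\<integral>\<^sup>+R. ennreal (v R powr t) \<partial>count_space (up Q)) (p / t) \<le> ennreal C * energy p \<eta> v Q"
proof -
  obtain C where C: "C > 0" and le: "\<And>Q F b. Q \<in> W \<Longrightarrow> finite F \<Longrightarrow> F \<subseteq> up Q \<Longrightarrow> (\<And>R. R \<in> F \<Longrightarrow> b R \<ge> 0) \<Longrightarrow>
     (\<Sum>R\<in>F. b R powr t) powr (p / t) \<le> C * (\<Sum>R\<in>F. b R powr p * (side R / side Q) powr \<eta>)"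
    using up_power_sum[OF pt \<eta>] by blast
  show thesis
  proof (rule that[OF C])
    fix Q v assume Q: "Q \<in> W" and v: "\<And>R. R \<in> W \<Longrightarrow> v R \<ge> (0::real)"
    show "enn_powr (\<integral>\<^sup>+R. ennreal (v R powr t) \<partial>count_space (up Q)) (p / t) \<le> ennreal C * energy p \<eta> v Q"
    proof (cases "energy p \<eta> v Q")
      case (real e)
      have "(\<integral>\<^sup>+R. ennreal (v R powr t) \<partial>count_space (up Q)) \<le> ennreal ((C * e) powr (t / p))"
      proof (rule nn_integral_count_space_le[OF up_countable])
        fix F assume F: "finite F" "F \<subseteq> up Q"
        have "(\<Sum>R\<in>F. v R powr t) powr (p / t) \<le> C * (\<Sum>R\<in>F. v R powr p * (side R / side Q) powr \<eta>)"
          using F v up_subset by (intro le[OF Q]) auto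
        also have "\<dots> \<le> C * e"
        proof -
          have "ennreal (\<Sum>R\<in>F. v R powr p * (side R / side Q) powr \<eta>) \<le> ennreal e"
            using energy_ge[OF F, of v p \<eta>] real by simp
          then show ?thesis using real C by (subst (asm) ennreal_le_iff) auto
        qed
        finally have "((\<Sum>R\<in>F. v R powr t) powr (p / t)) powr (t / p) \<le> (C * e) powr (t / p)"
          using pt by (intro powr_mono2) auto
        then have "(\<Sum>R\<in>F. v R powr t) \<le> (C * e) powr (t / p)"
          using pt by (simp add: powr_powr sum_nonneg)
        then show "(\<Sum>R\<in>F. ennreal (v R powr t)) \<le> ennreal ((C * e) powr (t / p))"
          by (simp add: sum_ennreal ennreal_leI)
      qed
      then have "enn_powr (\<integral>\<^sup>+R. ennreal (v R powr t) \<partial>count_space (up Q)) (p / t) \<le> enn_powr (ennreal ((C * e) powr (t / p))) (p / t)"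
        using pt by (intro enn_powr_mono) auto
      also have "\<dots> = ennreal (C * e)" using pt C real by (simp add: enn_powr_ennreal powr_powr)
      also have "\<dots> = ennreal C * energy p \<eta> v Q" using C real by (simp add: ennreal_mult)
      finally show ?thesis .
    qed (use C in \<open>simp add: ennreal_mult_top\<close>)
  qed
qed

text \<open>Here \<open>R\<close> is fixed and the central cube \<open>P\<close> varies, the reverse
  of the sum along one chain. Only sides above side R / (2 \<rho>) occur, so the series is again
  geometric, and interchanging the sums over \<open>P\<close> and \<open>R\<close> costs a
  constant.\<close>

lemma up_sum_ratio:
  assumes "Q \<in> W" "R \<in> W" "s > 0"
  shows "(\<integral>\<^sup>+P. ennreal (if side R \<le> 2 * \<rho> * side P then (side R / side P) powr s else 0) \<partial>count_space (up Q))
    \<le> ennreal ((2 * \<rho>) powr s * (upmult / (1 - 2 powr - s)))"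
proof (rule nn_integral_count_space_le[OF up_countable])
  fix F assume F: "finite F" "F \<subseteq> up Q"
  have sR: "side R > 0" using side_pos assms by auto
  define G where "G = {P \<in> F. side R \<le> 2 * \<rho> * side P}"
  have "(\<Sum>P\<in>F. if side R \<le> 2 * \<rho> * side P then (side R / side P) powr s else 0) = (\<Sum>P\<in>G. (side R / side P) powr s)"
    unfolding G_def using F by (simp add: sum.inter_filter)
  also have "\<dots> = (2 * \<rho>) powr s * (\<Sum>P\<in>G. ((side R / (2 * \<rho>)) / side P) powr s)"
    unfolding sum_distrib_left
  proof (rule sum.cong[OF refl])
    fix P assume "P \<in> G"
    have "side R / side P = (2 * \<rho>) * ((side R / (2 * \<rho>)) / side P)" using rho_gt1 by simp
    then show "(side R / side P) powr s = (2 * \<rho>) powr s * ((side R / (2 * \<rho>)) / side P) powr s"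
      by (metis powr_mult)
  qed
  also have "\<dots> \<le> (2 * \<rho>) powr s * (upmult / (1 - 2 powr - s))"
    using F assms sR rho_gt1 unfolding G_def
    by (intro mult_left_mono up_sum_large[OF assms(1)]) (auto simp: field_simps)
  finally show "(\<Sum>P\<in>F. ennreal (if side R \<le> 2 * \<rho> * side P then (side R / side P) powr s else 0)) \<le> ennreal ((2 * \<rho>) powr s * (upmult / (1 - 2 powr - s)))"
    by (subst sum_ennreal) (auto intro!: ennreal_leI)
qed

text \<open>Since y is integrated, all central cubes \<open>P\<close> reached from \<open>Q\<close>
  occur. For the y assigned to \<open>P\<close> the kernel is at most a constant times side P^-(s t
  + d); after this replacement the whole shadow of \<open>P\<close> may be integrated over. The
  resulting double sum over \<open>P\<close> and chain members \<open>R\<close> collapses to a sum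
  over \<open>R\<close>.\<close>

lemma full_inner_term_le_integral:
  assumes s: "0 < s" "s < 1" and p: "1 \<le> p" and q: "q \<noteq> \<infinity>" "1 \<le> q" and \<eta>: "\<eta> > 0"
  obtains C where "C > 0" "\<And>f z H Q x h. sample s p q f z H \<Longrightarrow> Q \<in> W \<Longrightarrow> x \<in> Q \<Longrightarrow> h \<ge> 0 \<Longrightarrow>
     inner_term s p q f (Shr W \<rho> Q) x = ennreal (h powr p) \<Longrightarrow> \<Omega> \<in> sets lebesgue \<Longrightarrow>
     inner_term s p q f \<Omega> x \<le> ennreal C * energy p \<eta> (bump H Q h) Q"
proof -
  let ?d = "real DIM('a)"
  define t where "t = real_of_ereal q"
  have t: "t \<ge> 1" using q unfolding t_def by (cases q) auto
  define e where "e = s * t + ?d"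
  have e: "e > 0" unfolding e_def using s t by (simp add: add_pos_nonneg)
  obtain K where K: "K > 0" and far: "\<And>f z H Q P cs x h. sample s p q f z H \<Longrightarrow> Q \<in> W \<Longrightarrow> reaches Q P cs \<Longrightarrow> x \<in> Q \<Longrightarrow> h \<ge> 0 \<Longrightarrow>
     inner_term s p q f (Shr W \<rho> Q) x = ennreal (h powr p) \<Longrightarrow>
     (\<bar>f x - f (z P)\<bar> / side P powr s) powr t + H P powr t
      \<le> K * (\<Sum>R\<in>set cs. (side R / side P) powr s * bump H Q h R powr t)"
    using far_estimate[OF s p q(2) t] by blast
  obtain B where B: "B > 0" and powsum: "\<And>Q v. Q \<in> W \<Longrightarrow> (\<And>R. R \<in> W \<Longrightarrow> v R \<ge> 0) \<Longrightarrow>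
     enn_powr (\<integral>\<^sup>+R. ennreal (v R powr t) \<partial>count_space (up Q)) (p / t) \<le> ennreal B * energy p \<eta> v Q"
    using enn_powr_up_sum[of p t \<eta>] p t \<eta> by auto
  define \<kappa> where "\<kappa> = 5 / \<epsilon>"
  have \<kappa>: "\<kappa> > 0" unfolding \<kappa>_def using eps_pos by simp
  have r1: "2 * \<rho> > 0" using rho_gt1 by simp
  define K1 where "K1 = \<kappa> powr e * 2 powr t * (upmult + (2 * \<rho>) powr e)"
  have K1: "K1 > 0" unfolding K1_def using \<kappa> r1 upmult_nonneg by (simp add: add_nonneg_pos)
  define M where "M = (2 * \<rho>) powr s * (upmult / (1 - 2 powr - s))"
  have "2 powr - s < 2 powr 0" using s by (intro powr_less_mono) auto
  then have M: "M \<ge> 0" unfolding M_def using upmult_nonneg by simp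
  define L where "L = 1 + K1 * K * M"
  have L: "L > 0" unfolding L_def using K1 K M by (simp add: add_pos_nonneg)
  show thesis
  proof (rule that[of "L powr (p / t) * B"])
    show "L powr (p / t) * B > 0" using L B by simp
    fix f z H Q x h
    assume sm: "sample s p q f z H" and Q: "Q \<in> W" and x: "x \<in> Q" and h: "h \<ge> 0"
      and hx: "inner_term s p q f (Shr W \<rho> Q) x = ennreal (h powr p)" and Om: "\<Omega> \<in> sets lebesgue"
    have f: "f \<in> borel_measurable lebesgue"
      and zH: "\<And>R. R \<in> W \<Longrightarrow> z R \<in> R" "\<And>R. R \<in> W \<Longrightarrow> H R \<ge> 0"
       "\<And>R. R \<in> W \<Longrightarrow> inner_term s p q f (Shr W \<rho> R) (z R) = ennreal (H R powr p)"
      using sm unfolding sample_def by auto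
    let ?v = "bump H Q h"
    \<comment> \<open>The condition side R \<le> 2 \<rho> side P stands in for membership in a chain
      to \<open>P\<close>; with it the sum over the chain is enlarged to \<open>up Q\<close>, and
      the two sums become interchangeable.\<close>
    let ?r = "\<lambda>R P. ennreal (if side R \<le> 2 * \<rho> * side P then (side R / side P) powr s else 0)"
    let ?X = "\<integral>\<^sup>+R. ennreal (?v R powr t) \<partial>count_space (up Q)"
    define g where "g y = ennreal (\<bar>f x - f y\<bar> powr t / dist x y powr e)" for y
    define RP where "RP = {P. \<exists>cs. reaches Q P cs}"
    have RP: "RP \<subseteq> up Q" using reaches_subset(2) unfolding RP_def by blast
    then have RP_countable: "countable RP" using up_countable by (rule countable_subset)
    \<comment> \<open>Kernel bound for |x - y| \<ge> side P / \<kappa>, with the factor 2^t for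
      splitting the difference at \<open>z P\<close>.\<close>
    define c where "c P = \<kappa> powr e * side P powr - e * 2 powr t" for P :: "'a set"
    have c0: "c P \<ge> 0" for P unfolding c_def by simp
    define G where "G P y = ennreal (c P) * (ennreal (\<bar>f x - f (z P)\<bar> powr t) * indicator (Shr W \<rho> P) y +
         ennreal (\<bar>f (z P) - f y\<bar> powr t) * indicator (Shr W \<rho> P) y)" for P y
    note [measurable] = f Shr_sets
    have [measurable]: "g \<in> borel_measurable lebesgue"
      unfolding g_def using difference_quotient_measurable_section[OF f, of x t e] by measurable
    have Gm [measurable]: "G P \<in> borel_measurable lebesgue" for P unfolding G_def by measurable
    have "AE y in lebesgue. g y * indicator \<Omega> y \<le> g y * indicator (Shr W \<rho> Q) y + (\<integral>\<^sup>+P. G P y \<partial>count_space RP)"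
      using AE_W
    proof eventually_elim
      fix y assume yW: "y \<in> \<Omega> \<longrightarrow> (\<exists>S\<in>W. y \<in> S)"
      show "g y * indicator \<Omega> y \<le> g y * indicator (Shr W \<rho> Q) y + (\<integral>\<^sup>+P. G P y \<partial>count_space RP)"
      proof (cases "y \<in> \<Omega> \<and> y \<notin> Shr W \<rho> Q")
        case True
        then obtain S where S: "S \<in> W" "y \<in> S" "S \<notin> SH Q" using yW unfolding Shr_def by blast
        obtain P cs where r: "reaches Q P cs" and yP: "y \<in> Shr W \<rho> P" and sz: "side P \<le> \<kappa> * dist x y"
          using far_cube[OF Q S(1,3) x S(2)] unfolding \<kappa>_def by blast
        have sP: "side P > 0" using side_pos[OF reaches_subset(3)[OF r]] .
        have D: "dist x y > 0" using sz sP \<kappa> by (metis less_le_trans zero_less_mult_pos)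
        have "\<bar>f x - f y\<bar> powr t \<le> (\<bar>f x - f (z P)\<bar> + \<bar>f (z P) - f y\<bar>) powr t" using t by (intro powr_mono2) auto
        also have "\<dots> \<le> 2 powr t * (\<bar>f x - f (z P)\<bar> powr t + \<bar>f (z P) - f y\<bar> powr t)" using t by (intro powr_add_le) auto
        finally have 1: "\<bar>f x - f y\<bar> powr t \<le> 2 powr t * (\<bar>f x - f (z P)\<bar> powr t + \<bar>f (z P) - f y\<bar> powr t)" .
        have "side P powr e \<le> (\<kappa> * dist x y) powr e" using sz sP e by (intro powr_mono2) auto
        then have "side P powr e \<le> \<kappa> powr e * dist x y powr e" using \<kappa> D by (simp add: powr_mult)
        then have 2: "1 / dist x y powr e \<le> \<kappa> powr e * side P powr - e" using D sP by (simp add: powr_minus field_simps)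
        have "\<bar>f x - f y\<bar> powr t * (1 / dist x y powr e) \<le> 2 powr t * (\<bar>f x - f (z P)\<bar> powr t + \<bar>f (z P) - f y\<bar> powr t) * (\<kappa> powr e * side P powr - e)"
          by (intro mult_mono 1 2) auto
        also have "\<dots> = c P * (\<bar>f x - f (z P)\<bar> powr t + \<bar>f (z P) - f y\<bar> powr t)" unfolding c_def by simp
        finally have "g y \<le> ennreal (c P * (\<bar>f x - f (z P)\<bar> powr t + \<bar>f (z P) - f y\<bar> powr t))"
          unfolding g_def by (intro ennreal_leI) simp
        also have "\<dots> = G P y" unfolding G_def using yP c0 by (simp add: ennreal_mult)
        also have "\<dots> = (\<Sum>P\<in>{P}. G P y)" by simp
        also have "\<dots> \<le> (\<integral>\<^sup>+P. G P y \<partial>count_space RP)"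
          using r unfolding RP_def by (intro sum_le_nn_integral_count_space) auto
        finally show ?thesis using True by simp
      next
        case False
        then show ?thesis by (auto split: split_indicator)
      qed
    qed
    then have "(\<integral>\<^sup>+y\<in>\<Omega>. g y \<partial>lebesgue) \<le> (\<integral>\<^sup>+y. g y * indicator (Shr W \<rho> Q) y + (\<integral>\<^sup>+P. G P y \<partial>count_space RP) \<partial>lebesgue)"
      by (rule nn_integral_mono_AE)
    also have "\<dots> = (\<integral>\<^sup>+y\<in>Shr W \<rho> Q. g y \<partial>lebesgue) + (\<integral>\<^sup>+y. (\<integral>\<^sup>+P. G P y \<partial>count_space RP) \<partial>lebesgue)"
    proof (rule nn_integral_add)
      show "(\<lambda>y. \<integral>\<^sup>+P. G P y \<partial>count_space RP) \<in> borel_measurable lebesgue"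
        using RP_countable Gm by (rule measurable_nn_integral_count_space)
    qed measurable
    also have "(\<integral>\<^sup>+y\<in>Shr W \<rho> Q. g y \<partial>lebesgue) = ennreal (h powr t)"
      unfolding g_def e_def by (rule inner_term_finite_integral[OF q t_def p h hx])
    also have "(\<integral>\<^sup>+y. (\<integral>\<^sup>+P. G P y \<partial>count_space RP) \<partial>lebesgue) = (\<integral>\<^sup>+P. (\<integral>\<^sup>+y. G P y \<partial>lebesgue) \<partial>count_space RP)"
      using RP_countable by (intro nn_integral_count_space_nn_integral) auto
    also have "\<dots> \<le> (\<integral>\<^sup>+P. ennreal (K1 * K) * (\<integral>\<^sup>+R. ennreal (?v R powr t) * ?r R P \<partial>count_space (up Q)) \<partial>count_space RP)"
    proof (rule nn_integral_mono)
      fix P assume "P \<in> space (count_space RP)"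
      then obtain cs where r: "reaches Q P cs" unfolding RP_def by auto
      have PW: "P \<in> W" using reaches_subset(3)[OF r] .
      have sP: "side P > 0" using side_pos[OF PW] .
      define a where "a = \<bar>f x - f (z P)\<bar>"
      have "(\<integral>\<^sup>+y. G P y \<partial>lebesgue) = ennreal (c P) * ((\<integral>\<^sup>+y. ennreal (a powr t) * indicator (Shr W \<rho> P) y \<partial>lebesgue) + (\<integral>\<^sup>+y\<in>Shr W \<rho> P. ennreal (\<bar>f (z P) - f y\<bar> powr t) \<partial>lebesgue))"
        unfolding G_def a_def by (subst nn_integral_cmult, measurable) (subst nn_integral_add, auto)
      also have "\<dots> \<le> ennreal (c P) * (ennreal (a powr t * (upmult * side P ^ DIM('a))) + ennreal ((2 * \<rho> * side P) powr e * H P powr t))"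
      proof (intro mult_left_mono add_mono)
        have "(\<integral>\<^sup>+y. ennreal (a powr t) * indicator (Shr W \<rho> P) y \<partial>lebesgue) = ennreal (a powr t) * emeasure lebesgue (Shr W \<rho> P)"
          by (rule nn_integral_cmult_indicator) (rule Shr_sets)
        also have "\<dots> \<le> ennreal (a powr t) * ennreal (upmult * side P ^ DIM('a))"
          using Shr_emeasure[OF PW] by (rule mult_left_mono) simp
        also have "\<dots> = ennreal (a powr t * (upmult * side P ^ DIM('a)))"
          using upmult_nonneg sP by (intro ennreal_mult[symmetric]) auto
        finally show "(\<integral>\<^sup>+y. ennreal (a powr t) * indicator (Shr W \<rho> P) y \<partial>lebesgue) \<le> ennreal (a powr t * (upmult * side P ^ DIM('a)))" .
        show "(\<integral>\<^sup>+y\<in>Shr W \<rho> P. ennreal (\<bar>f (z P) - f y\<bar> powr t) \<partial>lebesgue) \<le> ennreal ((2 * \<rho> * side P) powr e * H P powr t)"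
          unfolding e_def using Shr_dist[OF PW zH(1)[OF PW]]
          by (intro integral_powr_le[OF f subset_refl Shr_sets q t_def s(1) p _ zH(2)[OF PW] zH(3)[OF PW]])
      qed auto
      also have "\<dots> = ennreal (c P * (a powr t * (upmult * side P ^ DIM('a)) + (2 * \<rho> * side P) powr e * H P powr t))"
        using c0 upmult_nonneg sP by (simp add: ennreal_mult)
      \<comment> \<open>All powers of side P cancel: in the first term side P^-(s t + d) meets the
        volume of the shadow and normalises |f x - f (z P)|, in the second it meets (2 \<rho> side
        P)^(s t + d).\<close>
      also have "c P * (a powr t * (upmult * side P ^ DIM('a)) + (2 * \<rho> * side P) powr e * H P powr t)
         = \<kappa> powr e * 2 powr t * (upmult * (a / side P powr s) powr t + (2 * \<rho>) powr e * H P powr t)"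
      proof -
        have n: "side P powr (s * t) > 0" "side P ^ DIM('a) > 0" using sP by auto
        have e1: "side P powr e = side P powr (s * t) * side P ^ DIM('a)"
          unfolding e_def using sP by (simp add: powr_add powr_realpow)
        have e2: "(2 * \<rho> * side P) powr e = (2 * \<rho>) powr e * side P powr e" using r1 sP by (simp add: powr_mult)
        have e3: "(a / side P powr s) powr t = a powr t / side P powr (s * t)"
          using sP unfolding a_def by (simp add: powr_divide powr_powr)
        show ?thesis unfolding c_def powr_minus e2 e3 e1 using n by (simp add: field_simps)
      qed
      also have "ennreal \<dots> \<le> ennreal (K1 * (K * (\<Sum>R\<in>set cs. (side R / side P) powr s * ?v R powr t)))"
      proof (rule ennreal_leI)
        let ?A = "(a / side P powr s) powr t" and ?B = "H P powr t"
        have "upmult * ?A + (2 * \<rho>) powr e * ?B \<le> (upmult + (2 * \<rho>) powr e) * ?A + (upmult + (2 * \<rho>) powr e) * ?B"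
          using upmult_nonneg by (intro add_mono mult_right_mono) auto
        also have "\<dots> = (upmult + (2 * \<rho>) powr e) * (?A + ?B)" by (simp add: algebra_simps)
        finally have "\<kappa> powr e * 2 powr t * (upmult * ?A + (2 * \<rho>) powr e * ?B) \<le> \<kappa> powr e * 2 powr t * ((upmult + (2 * \<rho>) powr e) * (?A + ?B))"
          by (intro mult_left_mono) auto
        also have "\<dots> = K1 * (?A + ?B)" by (simp add: K1_def)
        also have "\<dots> \<le> K1 * (K * (\<Sum>R\<in>set cs. (side R / side P) powr s * ?v R powr t))"
          using far[OF sm Q r x h hx] K1 unfolding a_def by (intro mult_left_mono) auto
        finally show "\<kappa> powr e * 2 powr t * (upmult * ?A + (2 * \<rho>) powr e * ?B) \<le> K1 * (K * (\<Sum>R\<in>set cs. (side R / side P) powr s * ?v R powr t))" .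
      qed
      also have "ennreal (K1 * (K * (\<Sum>R\<in>set cs. (side R / side P) powr s * ?v R powr t))) = ennreal (K1 * K) * (\<Sum>R\<in>set cs. ennreal (?v R powr t) * ?r R P)"
      proof -
        have "(\<Sum>R\<in>set cs. ennreal (?v R powr t) * ?r R P) = (\<Sum>R\<in>set cs. ennreal ((side R / side P) powr s * ?v R powr t))"
          using r unfolding reaches_def by (intro sum.cong) (auto simp: ennreal_mult mult.commute)
        also have "\<dots> = ennreal (\<Sum>R\<in>set cs. (side R / side P) powr s * ?v R powr t)" by (rule sum_ennreal) simp
        finally show ?thesis using K K1 by (simp add: sum_nonneg mult.assoc flip: ennreal_mult)
      qed
      also have "\<dots> \<le> ennreal (K1 * K) * (\<integral>\<^sup>+R. ennreal (?v R powr t) * ?r R P \<partial>count_space (up Q))"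
        using reaches_subset(1)[OF r] by (intro mult_left_mono sum_le_nn_integral_count_space) auto
      finally show "(\<integral>\<^sup>+y. G P y \<partial>lebesgue) \<le> ennreal (K1 * K) * (\<integral>\<^sup>+R. ennreal (?v R powr t) * ?r R P \<partial>count_space (up Q))" .
    qed
    also have "\<dots> \<le> (\<integral>\<^sup>+P. ennreal (K1 * K) * (\<integral>\<^sup>+R. ennreal (?v R powr t) * ?r R P \<partial>count_space (up Q)) \<partial>count_space (up Q))"
      unfolding nn_integral_count_space_restrict[OF RP] by (intro nn_integral_mono) (auto split: split_indicator)
    also have "\<dots> = ennreal (K1 * K) * (\<integral>\<^sup>+R. (\<integral>\<^sup>+P. ennreal (?v R powr t) * ?r R P \<partial>count_space (up Q)) \<partial>count_space (up Q))"
      by (subst nn_integral_cmult) (simp, subst nn_integral_count_space_swap[OF up_countable], simp)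
    also have "\<dots> = ennreal (K1 * K) * (\<integral>\<^sup>+R. ennreal (?v R powr t) * (\<integral>\<^sup>+P. ?r R P \<partial>count_space (up Q)) \<partial>count_space (up Q))"
      by (subst nn_integral_cmult) simp_all
    also have "\<dots> \<le> ennreal (K1 * K) * (\<integral>\<^sup>+R. ennreal (?v R powr t) * ennreal M \<partial>count_space (up Q))"
      unfolding M_def using up_subset s(1) by (intro mult_left_mono nn_integral_mono up_sum_ratio[OF Q]) auto
    also have "\<dots> = ennreal (K1 * K) * (?X * ennreal M)" by (subst nn_integral_multc) auto
    also have "\<dots> = ennreal (K1 * K * M) * ?X" using K1 K M by (simp add: ennreal_mult mult_ac)
    finally have "(\<integral>\<^sup>+y\<in>\<Omega>. g y \<partial>lebesgue) \<le> ennreal (h powr t) + ennreal (K1 * K * M) * ?X"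
      by (simp add: add_left_mono)
    also have "ennreal (h powr t) \<le> ?X"
    proof -
      have "ennreal (h powr t) \<le> (\<Sum>R\<in>{Q}. ennreal (?v R powr t))"
        using h zH(2)[OF Q] t by (auto simp: bump_def intro!: ennreal_leI powr_mono2)
      also have "\<dots> \<le> ?X" using self_up[OF Q] by (intro sum_le_nn_integral_count_space) auto
      finally show ?thesis .
    qed
    also have "?X + ennreal (K1 * K * M) * ?X = ennreal L * ?X"
      unfolding L_def using K1 K M by (simp add: distrib_right)
    finally have "(\<integral>\<^sup>+y\<in>\<Omega>. g y \<partial>lebesgue) \<le> ennreal L * ?X" by (simp add: add_right_mono)
    then have "enn_powr (\<integral>\<^sup>+y\<in>\<Omega>. g y \<partial>lebesgue) (p / t) \<le> enn_powr (ennreal L * ?X) (p / t)"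
      using p t by (intro enn_powr_mono) auto
    also have "\<dots> = ennreal (L powr (p / t)) * enn_powr ?X (p / t)" by (rule enn_powr_cmult[OF L])
    also have "\<dots> \<le> ennreal (L powr (p / t)) * (ennreal B * energy p \<eta> ?v Q)"
      using bump_nonneg[OF sm _ h] by (intro mult_left_mono powsum[OF Q]) auto
    also have "\<dots> = ennreal (L powr (p / t) * B) * energy p \<eta> ?v Q"
      using B by (simp add: ennreal_mult mult.assoc)
    finally show "inner_term s p q f \<Omega> x \<le> ennreal (L powr (p / t) * B) * energy p \<eta> ?v Q"
      unfolding inner_term_def g_def t_def[symmetric] e_def using q by (simp add: t_def)
  qed
qed

lemma full_inner_term_le:
  assumes s: "0 < s" "s < 1" and p: "1 \<le> p" and q: "1 \<le> (q::ereal)" and \<eta>: "\<eta> > 0"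
  obtains C where "C > 0" "\<And>f z H Q x h. sample s p q f z H \<Longrightarrow> Q \<in> W \<Longrightarrow> x \<in> Q \<Longrightarrow> h \<ge> 0 \<Longrightarrow>
     inner_term s p q f (Shr W \<rho> Q) x = ennreal (h powr p) \<Longrightarrow> \<Omega> \<in> sets lebesgue \<Longrightarrow>
     inner_term s p q f \<Omega> x \<le> ennreal C * energy p \<eta> (bump H Q h) Q"
proof (cases "q = \<infinity>")
  case True
  show thesis by (rule full_inner_term_le_sup[OF s p True \<eta>]) (rule that)
next
  case False
  show thesis by (rule full_inner_term_le_integral[OF s p False q \<eta>]) (rule that)
qed

text \<open>Only the term of \<open>Q\<close> itself changes, and its weight is 1.\<close>

lemma energy_bump_le:
  assumes Q: "Q \<in> W" and H: "\<And>R. R \<in> W \<Longrightarrow> H R \<ge> 0" and h: "h \<ge> 0" and p: "p \<ge> 1"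
  shows "energy p \<eta> (bump H Q h) Q \<le> ennreal (2 powr p) * (energy p \<eta> H Q + ennreal (h powr p))"
proof -
  let ?w = "\<lambda>R. (side R / side Q) powr \<eta>"
  have "energy p \<eta> (bump H Q h) Q \<le> (\<integral>\<^sup>+R. ennreal (2 powr p) * (ennreal (H R powr p * ?w R) + ennreal (h powr p) * indicator {Q} R) \<partial>count_space (up Q))"
    unfolding energy_def
  proof (rule nn_integral_mono)
    fix R assume "R \<in> space (count_space (up Q))"
    then have R: "R \<in> W" using up_subset by auto
    have "bump H Q h R powr p * ?w R \<le> 2 powr p * (H R powr p * ?w R + h powr p * indicator {Q} R)"
    proof (cases "R = Q")
      case True
      have "(H Q + h) powr p \<le> 2 powr p * (H Q powr p + h powr p)" by (rule powr_add_le[OF H[OF Q] h p])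
      then show ?thesis using True side_pos[OF Q] by (simp add: bump_def)
    next
      case False
      have "1 \<le> 2 powr p" using p by (simp add: ge_one_powr_ge_zero)
      then have "1 * (H R powr p * ?w R) \<le> 2 powr p * (H R powr p * ?w R)" by (intro mult_right_mono) auto
      then show ?thesis using False by (simp add: bump_def)
    qed
    then have "ennreal (bump H Q h R powr p * ?w R) \<le> ennreal (2 powr p * (H R powr p * ?w R + h powr p * indicator {Q} R))"
      by (rule ennreal_leI)
    also have "\<dots> = ennreal (2 powr p) * (ennreal (H R powr p * ?w R) + ennreal (h powr p) * indicator {Q} R)"
      by (auto simp: ennreal_mult split: split_indicator)
    finally show "ennreal (bump H Q h R powr p * ?w R) \<le> ennreal (2 powr p) * (ennreal (H R powr p * ?w R) + ennreal (h powr p) * indicator {Q} R)" .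
  qed
  also have "\<dots> = ennreal (2 powr p) * (energy p \<eta> H Q + (\<integral>\<^sup>+R. ennreal (h powr p) * indicator {Q} R \<partial>count_space (up Q)))"
    unfolding energy_def by (subst nn_integral_cmult, simp, subst nn_integral_add) simp_all
  also have "(\<integral>\<^sup>+R. ennreal (h powr p) * indicator {Q} R \<partial>count_space (up Q)) = ennreal (h powr p)"
    using self_up[OF Q] by (subst nn_integral_count_space_single[of Q]) auto
  finally show ?thesis .
qed

section \<open>Integration over the Whitney cubes\<close>

lemma disjoint_sum_eq:
  fixes g :: "'a set \<Rightarrow> 'a \<Rightarrow> ennreal"
  assumes "Q \<in> W" "x \<in> Q"
  shows "(\<integral>\<^sup>+S. g S x * indicator S x \<partial>count_space W) = g Q x"
proof -
  have "g S x * indicator S x = 0" if "S \<in> W" "S \<noteq> Q" for S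
    using that assms W_disjoint unfolding pairwise_def disjnt_def by (auto simp: indicator_def)
  then show ?thesis using assms by (subst nn_integral_count_space_single[of Q]) auto
qed

lemma Omega_sets: "\<Omega> \<in> sets lebesgue"
proof -
  have "open \<Omega>" using unif unfolding uniform_domain_def by auto
  then show ?thesis by (simp add: borel_open)
qed

lemma Shr_subset: "Shr W \<rho> Q \<subseteq> \<Omega>"
  using W_subset unfolding Shr_def SHr_def by blast

lemma inner_term_mono:
  fixes f :: "'a \<Rightarrow> real"
  assumes f: "f \<in> borel_measurable lebesgue" and p: "p \<ge> 1" and q: "1 \<le> q"
    and AB: "A \<subseteq> B" "A \<in> sets lebesgue" "B \<in> sets lebesgue"
  shows "inner_term s p q f A x \<le> inner_term s p q f B x"
proof (cases "q = \<infinity>")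
  case True
  let ?g = "\<lambda>y. ennreal (\<bar>f x - f y\<bar> powr p / dist x y powr (s * p))"
  have "AE y in lebesgue_on B. ?g y \<le> esssup (lebesgue_on B) ?g" by (rule esssup_AE)
  then have "AE y in lebesgue. y \<in> B \<longrightarrow> ?g y \<le> esssup (lebesgue_on B) ?g"
    using AB by (subst (asm) AE_restrict_space_iff) auto
  then have "AE y in lebesgue. y \<in> A \<longrightarrow> ?g y \<le> esssup (lebesgue_on B) ?g"
    by eventually_elim (use AB in auto)
  then have "AE y in lebesgue_on A. ?g y \<le> esssup (lebesgue_on B) ?g"
    using AB by (subst AE_restrict_space_iff) auto
  moreover have "?g \<in> borel_measurable (lebesgue_on A)"
    by (intro measurable_restrict_space1 measurable_compose[OF difference_quotient_measurable_section[OF f] measurable_ennreal])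
  ultimately show ?thesis unfolding inner_term_def using True by (auto intro: esssup_I)
next
  case False
  then have "real_of_ereal q \<ge> 1" using q by (cases q) auto
  then show ?thesis unfolding inner_term_def using False p AB(1)
    by (auto intro!: enn_powr_mono nn_integral_mono mult_left_mono split: split_indicator)
qed

text \<open>The easy direction, with constant 1: the cubes are disjoint and every shadow lies in
  \<Omega>.\<close>

lemma shadow_le_full:
  fixes f :: "'a \<Rightarrow> real"
  assumes f: "f \<in> borel_measurable lebesgue" and p: "p \<ge> 1" and q: "1 \<le> q"
  shows "(\<integral>\<^sup>+Q. (\<integral>\<^sup>+x\<in>Q. inner_term s p q f (Shr W \<rho> Q) x \<partial>lebesgue) \<partial>count_space W)
     \<le> (\<integral>\<^sup>+x\<in>\<Omega>. inner_term s p q f \<Omega> x \<partial>lebesgue)"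
proof -
  have m: "(\<lambda>x. inner_term s p q f (Shr W \<rho> Q) x * indicator Q x) \<in> borel_measurable lebesgue" if "Q \<in> W" for Q
    using inner_term_measurable[OF f Shr_sets] W_sets[OF that] by measurable
  have "(\<integral>\<^sup>+Q. (\<integral>\<^sup>+x\<in>Q. inner_term s p q f (Shr W \<rho> Q) x \<partial>lebesgue) \<partial>count_space W)
     = (\<integral>\<^sup>+x. (\<integral>\<^sup>+Q. inner_term s p q f (Shr W \<rho> Q) x * indicator Q x \<partial>count_space W) \<partial>lebesgue)"
    using m by (intro nn_integral_count_space_nn_integral[symmetric] W_countable) auto
  also have "\<dots> \<le> (\<integral>\<^sup>+x\<in>\<Omega>. inner_term s p q f \<Omega> x \<partial>lebesgue)"
  proof (rule nn_integral_mono)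
    fix x
    show "(\<integral>\<^sup>+Q. inner_term s p q f (Shr W \<rho> Q) x * indicator Q x \<partial>count_space W) \<le> inner_term s p q f \<Omega> x * indicator \<Omega> x"
    proof (cases "\<exists>Q\<in>W. x \<in> Q")
      case True
      then obtain Q where Q: "Q \<in> W" "x \<in> Q" by blast
      have "(\<integral>\<^sup>+Q. inner_term s p q f (Shr W \<rho> Q) x * indicator Q x \<partial>count_space W) = inner_term s p q f (Shr W \<rho> Q) x"
        by (rule disjoint_sum_eq[OF Q])
      also have "\<dots> \<le> inner_term s p q f \<Omega> x"
        by (rule inner_term_mono[OF f p q Shr_subset Shr_sets Omega_sets])
      finally show ?thesis using subsetD[OF W_subset[OF Q(1)] Q(2)] by simp
    next
      case False
      then have "(\<integral>\<^sup>+Q. inner_term s p q f (Shr W \<rho> Q) x * indicator Q x \<partial>count_space W) = (\<integral>\<^sup>+Q. 0 \<partial>count_space W)"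
        by (intro nn_integral_cong) auto
      then show ?thesis by simp
    qed
  qed
  finally show ?thesis .
qed

lemma full_le_shadow:
  assumes s: "0 < s" "s < 1" and p: "1 \<le> p" and q: "1 \<le> (q::ereal)"
  obtains C where "C > 0" "\<And>f. f \<in> borel_measurable lebesgue \<Longrightarrow>
     (\<integral>\<^sup>+x\<in>\<Omega>. inner_term s p q f \<Omega> x \<partial>lebesgue)
       \<le> ennreal C * (\<integral>\<^sup>+Q. (\<integral>\<^sup>+x\<in>Q. inner_term s p q f (Shr W \<rho> Q) x \<partial>lebesgue) \<partial>count_space W)"
proof -
  \<comment> \<open>\<eta> comes from the mass bound; the pointwise estimate, valid for every
    positive exponent, is then taken at this one.\<close>
  obtain \<eta> C2 where \<eta>: "\<eta> > 0" and C2: "C2 > 0" and mass: "\<And>P F. P \<in> W \<Longrightarrow> finite F \<Longrightarrow> F \<subseteq> SH P \<Longrightarrow>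
       (\<Sum>Q\<in>F. side Q ^ DIM('a) * (side P / side Q) powr \<eta>) \<le> C2 * side P ^ DIM('a)"
    using shadow_mass_le by blast
  obtain C1 where C1: "C1 > 0" and full: "\<And>f z H Q x h. sample s p q f z H \<Longrightarrow> Q \<in> W \<Longrightarrow> x \<in> Q \<Longrightarrow> h \<ge> 0 \<Longrightarrow>
     inner_term s p q f (Shr W \<rho> Q) x = ennreal (h powr p) \<Longrightarrow> \<Omega> \<in> sets lebesgue \<Longrightarrow>
     inner_term s p q f \<Omega> x \<le> ennreal C1 * energy p \<eta> (bump H Q h) Q"
    using full_inner_term_le[OF s p q \<eta>] by blast
  define C3 where "C3 = C1 * 2 powr p"
  have C3: "C3 > 0" unfolding C3_def using C1 by simp
  show thesis
  proof (rule that[of "C3 * (C2 + 1)"])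
    show "C3 * (C2 + 1) > 0" using C3 C2 by simp
    fix f :: "'a \<Rightarrow> real" assume f: "f \<in> borel_measurable lebesgue"
    let ?I = "\<lambda>Q. inner_term s p q f (Shr W \<rho> Q)"
    define J where "J Q = (\<integral>\<^sup>+x\<in>Q. ?I Q x \<partial>lebesgue)" for Q
    define T where "T = (\<integral>\<^sup>+Q. J Q \<partial>count_space W)"
    have Im [measurable]: "?I Q \<in> borel_measurable lebesgue" for Q by (rule inner_term_measurable[OF f Shr_sets])
    have main: "(\<integral>\<^sup>+x\<in>\<Omega>. inner_term s p q f \<Omega> x \<partial>lebesgue) \<le> ennreal (C3 * (C2 + 1)) * T"
    proof (cases "T = \<infinity>")
      case True
      then show ?thesis using C3 C2 by (simp add: ennreal_mult_top)
    next
      case False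
      have JT: "J R \<le> T" if "R \<in> W" for R
        using sum_le_nn_integral_count_space[of "{R}" W J] that unfolding T_def by simp
      \<comment> \<open>Finite \<open>T\<close> makes every \<open>J R\<close> finite, so the inner
        term at a point not above the average is finite and has a real p-th root. A pair of the
        point and this root allows a single choice over \<open>W\<close>.\<close>
      have "\<forall>R\<in>W. \<exists>u. fst u \<in> R \<and> 0 \<le> snd u \<and> ?I R (fst u) = ennreal (snd u powr p) \<and> ennreal (snd u powr p) * ennreal (side R ^ DIM('a)) \<le> J R"
      proof
        fix R assume R: "R \<in> W"
        have eR: "emeasure lebesgue R = ennreal (side R ^ DIM('a))" by (rule W_emeasure[OF R])
        have pos: "side R ^ DIM('a) > 0" using side_pos[OF R] by simp
        obtain z where z: "z \<in> R" "?I R z * ennreal (side R ^ DIM('a)) \<le> J R"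
          using exists_le_average[OF Im[of R] W_sets[OF R]] eR pos unfolding J_def by (auto simp: ennreal_less_top)
        have "?I R z \<noteq> \<infinity>"
        proof
          assume "?I R z = \<infinity>"
          then have "J R = \<infinity>" using z(2) side_pos[OF R] by (simp add: ennreal_top_mult top_unique)
          then show False using JT[OF R] False by (simp add: top_unique)
        qed
        then obtain a where a: "a \<ge> 0" "?I R z = ennreal a" by (cases "?I R z") auto
        then have "?I R z = ennreal ((a powr (1 / p)) powr p)" using p by (simp add: powr_powr)
        then show "\<exists>u. fst u \<in> R \<and> 0 \<le> snd u \<and> ?I R (fst u) = ennreal (snd u powr p) \<and> ennreal (snd u powr p) * ennreal (side R ^ DIM('a)) \<le> J R"
          using z by (intro exI[of _ "(z, a powr (1 / p))"]) auto
      qed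
      then obtain u where u: "\<forall>R\<in>W. fst (u R) \<in> R \<and> 0 \<le> snd (u R) \<and> ?I R (fst (u R)) = ennreal (snd (u R) powr p) \<and> ennreal (snd (u R) powr p) * ennreal (side R ^ DIM('a)) \<le> J R"
        by (rule bchoice[THEN exE])
      define z H where "z R = fst (u R)" and "H R = snd (u R)" for R
      have zH: "z R \<in> R" "0 \<le> H R" "?I R (z R) = ennreal (H R powr p)"
        "ennreal (H R powr p) * ennreal (side R ^ DIM('a)) \<le> J R" if "R \<in> W" for R
        using bspec[OF u that] unfolding z_def H_def by simp_all
      have sm: "sample s p q f z H" unfolding sample_def by (intro conjI ballI f zH)
      let ?A = "energy p \<eta> H"
      have point: "inner_term s p q f \<Omega> x \<le> ennreal C3 * (?A Q + ?I Q x)" if Q: "Q \<in> W" "x \<in> Q" for Q x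
      proof (cases "?I Q x")
        case (real a)
        define h where "h = a powr (1 / p)"
        have h: "h \<ge> 0" "?I Q x = ennreal (h powr p)" unfolding h_def using real p by (auto simp: powr_powr)
        have "inner_term s p q f \<Omega> x \<le> ennreal C1 * energy p \<eta> (bump H Q h) Q"
          by (rule full[OF sm Q h Omega_sets])
        also have "\<dots> \<le> ennreal C1 * (ennreal (2 powr p) * (?A Q + ennreal (h powr p)))"
          using zH(2) h p by (intro mult_left_mono energy_bump_le Q) auto
        also have "\<dots> = ennreal C3 * (?A Q + ?I Q x)"
          unfolding C3_def h(2) using C1 by (simp add: ennreal_mult mult.assoc)
        finally show ?thesis .
      qed (use C3 in \<open>simp add: ennreal_mult_top\<close>)
      have "AE x in lebesgue. inner_term s p q f \<Omega> x * indicator \<Omega> x \<le> (\<integral>\<^sup>+Q. (ennreal C3 * (?A Q + ?I Q x)) * indicator Q x \<partial>count_space W)"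
        using AE_W
      proof eventually_elim
        fix x assume xW: "x \<in> \<Omega> \<longrightarrow> (\<exists>S\<in>W. x \<in> S)"
        show "inner_term s p q f \<Omega> x * indicator \<Omega> x \<le> (\<integral>\<^sup>+Q. (ennreal C3 * (?A Q + ?I Q x)) * indicator Q x \<partial>count_space W)"
        proof (cases "x \<in> \<Omega>")
          case True
          then obtain Q where Q: "Q \<in> W" "x \<in> Q" using xW by blast
          show ?thesis using point[OF Q] True by (subst disjoint_sum_eq[OF Q]) auto
        qed simp
      qed
      then have "(\<integral>\<^sup>+x\<in>\<Omega>. inner_term s p q f \<Omega> x \<partial>lebesgue) \<le> (\<integral>\<^sup>+x. (\<integral>\<^sup>+Q. (ennreal C3 * (?A Q + ?I Q x)) * indicator Q x \<partial>count_space W) \<partial>lebesgue)"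
        by (rule nn_integral_mono_AE)
      also have "\<dots> = (\<integral>\<^sup>+Q. (\<integral>\<^sup>+x. (ennreal C3 * (?A Q + ?I Q x)) * indicator Q x \<partial>lebesgue) \<partial>count_space W)"
      proof (intro nn_integral_count_space_nn_integral W_countable)
        fix Q assume "Q \<in> W"
        note [measurable] = W_sets[OF this]
        show "(\<lambda>x. (ennreal C3 * (?A Q + ?I Q x)) * indicator Q x) \<in> borel_measurable lebesgue" by measurable
      qed
      also have "\<dots> = (\<integral>\<^sup>+Q. ennreal C3 * (?A Q * ennreal (side Q ^ DIM('a)) + J Q) \<partial>count_space W)"
      proof (rule nn_integral_cong)
        fix Q assume "Q \<in> space (count_space W)"
        then have Q: "Q \<in> W" by simp
        note [measurable] = W_sets[OF Q]
        have "(\<integral>\<^sup>+x. (ennreal C3 * (?A Q + ?I Q x)) * indicator Q x \<partial>lebesgue) = (\<integral>\<^sup>+x. ennreal C3 * (?A Q * indicator Q x + ?I Q x * indicator Q x) \<partial>lebesgue)"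
          by (intro nn_integral_cong) (auto split: split_indicator)
        also have "\<dots> = ennreal C3 * ((\<integral>\<^sup>+x. ?A Q * indicator Q x \<partial>lebesgue) + J Q)"
          unfolding J_def by (subst nn_integral_cmult, measurable) (subst nn_integral_add, auto)
        also have "(\<integral>\<^sup>+x. ?A Q * indicator Q x \<partial>lebesgue) = ?A Q * ennreal (side Q ^ DIM('a))"
          by (subst nn_integral_cmult_indicator) (auto simp: W_emeasure[OF Q])
        finally show "(\<integral>\<^sup>+x. (ennreal C3 * (?A Q + ?I Q x)) * indicator Q x \<partial>lebesgue) = ennreal C3 * (?A Q * ennreal (side Q ^ DIM('a)) + J Q)" .
      qed
      also have "\<dots> = ennreal C3 * ((\<integral>\<^sup>+Q. ?A Q * ennreal (side Q ^ DIM('a)) \<partial>count_space W) + T)"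
        unfolding T_def by (subst nn_integral_cmult, simp, subst nn_integral_add) simp_all
      \<comment> \<open>After the sums over \<open>Q\<close> and \<open>R\<close> are exchanged, (H
        R)^p stands in front of the weighted mass of the shadow of \<open>R\<close>. That mass is at
        most C2 times the volume of \<open>R\<close>, and the choice of the sample point bounds (H
        R)^p times this volume by \<open>J R\<close>.\<close>
      also have "(\<integral>\<^sup>+Q. ?A Q * ennreal (side Q ^ DIM('a)) \<partial>count_space W) \<le> ennreal C2 * T"
      proof -
        let ?k = "\<lambda>Q R. ennreal (side Q ^ DIM('a) * (side R / side Q) powr \<eta>) * indicator (SH R) Q"
        have "(\<integral>\<^sup>+Q. ?A Q * ennreal (side Q ^ DIM('a)) \<partial>count_space W) = (\<integral>\<^sup>+Q. (\<integral>\<^sup>+R. ennreal (H R powr p) * ?k Q R \<partial>count_space W) \<partial>count_space W)"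
        proof (rule nn_integral_cong)
          fix Q assume "Q \<in> space (count_space W)"
          then have Q: "Q \<in> W" by simp
          have "?A Q * ennreal (side Q ^ DIM('a)) = (\<integral>\<^sup>+R. ennreal (H R powr p * (side R / side Q) powr \<eta>) * indicator (up Q) R * ennreal (side Q ^ DIM('a)) \<partial>count_space W)"
            unfolding energy_def nn_integral_count_space_restrict[OF up_subset] by (subst nn_integral_multc) simp_all
          also have "\<dots> = (\<integral>\<^sup>+R. ennreal (H R powr p) * ?k Q R \<partial>count_space W)"
            using side_pos[OF Q] unfolding up_def
            by (intro nn_integral_cong) (auto simp: ennreal_mult mult_ac split: split_indicator)
          finally show "?A Q * ennreal (side Q ^ DIM('a)) = (\<integral>\<^sup>+R. ennreal (H R powr p) * ?k Q R \<partial>count_space W)" .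
        qed
        also have "\<dots> = (\<integral>\<^sup>+R. (\<integral>\<^sup>+Q. ennreal (H R powr p) * ?k Q R \<partial>count_space W) \<partial>count_space W)"
          by (rule nn_integral_count_space_swap[OF W_countable])
        also have "\<dots> \<le> (\<integral>\<^sup>+R. ennreal C2 * J R \<partial>count_space W)"
        proof (rule nn_integral_mono)
          fix R assume "R \<in> space (count_space W)"
          then have R: "R \<in> W" by simp
          have SHW: "SH R \<subseteq> W" by (auto simp: SHr_def)
          have "(\<integral>\<^sup>+Q. ?k Q R \<partial>count_space W) = (\<integral>\<^sup>+Q. ennreal (side Q ^ DIM('a) * (side R / side Q) powr \<eta>) \<partial>count_space (SH R))"
            by (rule nn_integral_count_space_restrict[OF SHW, symmetric])
          also have "\<dots> \<le> ennreal (C2 * side R ^ DIM('a))"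
          proof (rule nn_integral_count_space_le)
            show "countable (SH R)" using SHW W_countable by (rule countable_subset)
            fix F assume F: "finite F" "F \<subseteq> SH R"
            then have "(\<Sum>Q\<in>F. ennreal (side Q ^ DIM('a) * (side R / side Q) powr \<eta>)) = ennreal (\<Sum>Q\<in>F. side Q ^ DIM('a) * (side R / side Q) powr \<eta>)"
            proof (intro sum_ennreal)
              fix Q assume "Q \<in> F"
              then have "side Q > 0" using F SHW side_pos by blast
              then show "0 \<le> side Q ^ DIM('a) * (side R / side Q) powr \<eta>" by simp
            qed
            also have "\<dots> \<le> ennreal (C2 * side R ^ DIM('a))" by (intro ennreal_leI mass R F)
            finally show "(\<Sum>Q\<in>F. ennreal (side Q ^ DIM('a) * (side R / side Q) powr \<eta>)) \<le> ennreal (C2 * side R ^ DIM('a))" .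
          qed
          finally have "(\<integral>\<^sup>+Q. ennreal (H R powr p) * ?k Q R \<partial>count_space W) \<le> ennreal (H R powr p) * ennreal (C2 * side R ^ DIM('a))"
            by (subst nn_integral_cmult) (auto intro: mult_left_mono)
          also have "\<dots> = ennreal C2 * (ennreal (H R powr p) * ennreal (side R ^ DIM('a)))"
            using C2 side_pos[OF R] by (simp add: ennreal_mult mult_ac)
          also have "\<dots> \<le> ennreal C2 * J R" using zH(4)[OF R] by (rule mult_left_mono) simp
          finally show "(\<integral>\<^sup>+Q. ennreal (H R powr p) * ?k Q R \<partial>count_space W) \<le> ennreal C2 * J R" .
        qed
        also have "\<dots> = ennreal C2 * T" unfolding T_def by (rule nn_integral_cmult) simp
        finally show ?thesis .
      qed
      also have "ennreal C3 * (ennreal C2 * T + T) = ennreal (C3 * (C2 + 1)) * T"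
        using C2 C3 by (simp add: ennreal_mult distrib_right mult.assoc)
      finally show ?thesis by (simp add: add_right_mono mult_left_mono)
    qed
    then show "(\<integral>\<^sup>+x\<in>\<Omega>. inner_term s p q f \<Omega> x \<partial>lebesgue)
       \<le> ennreal (C3 * (C2 + 1)) * (\<integral>\<^sup>+Q. (\<integral>\<^sup>+x\<in>Q. inner_term s p q f (Shr W \<rho> Q) x \<partial>lebesgue) \<partial>count_space W)"
      unfolding T_def J_def .
  qed
qed

section \<open>Measurability from local integrability, and the conclusion\<close>

lemma closure_W_compact: "Q \<in> W \<Longrightarrow> compact (closure Q)"
proof -
  assume Q: "Q \<in> W"
  have "bounded Q" by (subst dyadic_cube_eq_box[OF W_dyadic[OF Q]]) (rule bounded_box)
  then show ?thesis by simp
qed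

text \<open>Local integrability gives measurability on compact subsets of \<Omega>, and the closed
  Whitney cubes are countably many of these that cover it. The indicator removes the values of f
  outside \<Omega>, which are arbitrary.\<close>

lemma locally_integrable_measurable:
  assumes "locally_integrable \<Omega> f"
  shows "(\<lambda>x. indicator \<Omega> x * f x) \<in> borel_measurable lebesgue"
proof (rule measurable_piecewise_restrict[of "insert (- \<Omega>) (closure ` W)"])
  show "countable (insert (- \<Omega>) (closure ` W))" using W_countable by simp
  show "space lebesgue \<subseteq> \<Union> (insert (- \<Omega>) (closure ` W))" using W_cover by auto
  fix A assume A: "A \<in> insert (- \<Omega>) (closure ` W)"
  have cl: "closure Q \<in> sets lebesgue" for Q :: "'a set" by (simp add: borel_closed)
  show AL: "A \<inter> space lebesgue \<in> sets lebesgue" using A cl sets.compl_sets[OF Omega_sets] by (auto simp: Compl_eq_Diff_UNIV)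
  show "(\<lambda>x. indicator \<Omega> x * f x) \<in> borel_measurable (lebesgue_on A)"
  proof (cases "A = - \<Omega>")
    case True
    have "(\<lambda>x. indicator \<Omega> x * f x) \<in> borel_measurable (lebesgue_on A) \<longleftrightarrow> (\<lambda>x. 0 :: real) \<in> borel_measurable (lebesgue_on A)"
      using True by (intro measurable_cong) auto
    then show ?thesis by simp
  next
    case False
    then obtain Q where Q: "Q \<in> W" "A = closure Q" using A by auto
    have sub: "A \<subseteq> \<Omega>" using Q W_cover by auto
    have "set_integrable lebesgue A f"
      using assms closure_W_compact[OF Q(1)] Q sub unfolding locally_integrable_def by auto
    then have "(\<lambda>x. indicator A x *\<^sub>R f x) \<in> borel_measurable lebesgue"
      unfolding set_integrable_def by (rule borel_measurable_integrable)
    then have "f \<in> borel_measurable (lebesgue_on A)"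
      using AL by (subst borel_measurable_restrict_space_iff) auto
    moreover have "(\<lambda>x. indicator \<Omega> x * f x) \<in> borel_measurable (lebesgue_on A) \<longleftrightarrow> f \<in> borel_measurable (lebesgue_on A)"
      using sub by (intro measurable_cong) auto
    ultimately show ?thesis by simp
  qed
qed

end

lemma esssup_cong_space:
  assumes "\<And>x. x \<in> space M \<Longrightarrow> f x = g x"
  shows "esssup M f = esssup M g"
proof -
  \<comment> \<open>\<open>esssup\<close> distinguishes measurable functions from others, so both
    functions must first fall under the same case.\<close>
  have "f \<in> borel_measurable M \<longleftrightarrow> g \<in> borel_measurable M" using assms by (rule measurable_cong)
  moreover have "Limsup (ae_filter M) f = Limsup (ae_filter M) g"
    using assms by (intro Limsup_eq AE_I2) auto
  ultimately show ?thesis unfolding esssup_def by simp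
qed

lemma inner_term_cong:
  assumes "f x = g x" "\<And>y. y \<in> A \<Longrightarrow> f y = g y"
  shows "inner_term s p q f A x = inner_term s p q g A x"
proof -
  have "esssup (lebesgue_on A) (\<lambda>y. ennreal (\<bar>f x - f y\<bar> powr p / dist x y powr (s * p)))
      = esssup (lebesgue_on A) (\<lambda>y. ennreal (\<bar>g x - g y\<bar> powr p / dist x y powr (s * p)))"
    using assms by (intro esssup_cong_space) auto
  moreover have "(\<integral>\<^sup>+y\<in>A. ennreal (\<bar>f x - f y\<bar> powr t / dist x y powr e) \<partial>lebesgue)
     = (\<integral>\<^sup>+y\<in>A. ennreal (\<bar>g x - g y\<bar> powr t / dist x y powr e) \<partial>lebesgue)" for t e
    using assms by (intro nn_integral_cong) (auto split: split_indicator)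
  ultimately show ?thesis unfolding inner_term_def by simp
qed

theorem theoremA2:
  fixes \<Omega> :: "'a::euclidean_space set" and W :: "'a set set"
    and \<epsilon> \<rho> s p :: real and q :: ereal
  assumes unif: "uniform_domain \<epsilon> \<Omega> W"
    and rho: "shadow_param \<epsilon> W \<rho>"
    and s: "0 < s" "s < 1"
    and p: "1 \<le> p"
    and q: "1 \<le> q"
  shows "\<exists>C>0. \<forall>f. locally_integrable \<Omega> f \<longrightarrow>
     enn_powr (\<Sum>\<^sub>\<infinity>Q\<in>W. \<integral>\<^sup>+ x\<in>Q. inner_term s p q f (Shr W \<rho> Q) x \<partial>lebesgue) (1 / p)
       \<le> ennreal C * enn_powr (\<integral>\<^sup>+ x\<in>\<Omega>. inner_term s p q f \<Omega> x \<partial>lebesgue) (1 / p)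
   \<and> enn_powr (\<integral>\<^sup>+ x\<in>\<Omega>. inner_term s p q f \<Omega> x \<partial>lebesgue) (1 / p)
       \<le> ennreal C * enn_powr (\<Sum>\<^sub>\<infinity>Q\<in>W. \<integral>\<^sup>+ x\<in>Q. inner_term s p q f (Shr W \<rho> Q) x \<partial>lebesgue) (1 / p)"
proof -
  interpret uniform_shadow \<Omega> W \<epsilon> \<rho> using unif rho by unfold_locales
  obtain C where C: "C > 0" and le: "\<And>f. f \<in> borel_measurable lebesgue \<Longrightarrow>
     (\<integral>\<^sup>+x\<in>\<Omega>. inner_term s p q f \<Omega> x \<partial>lebesgue)
       \<le> ennreal C * (\<integral>\<^sup>+Q. (\<integral>\<^sup>+x\<in>Q. inner_term s p q f (Shr W \<rho> Q) x \<partial>lebesgue) \<partial>count_space W)"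
    using full_le_shadow[OF s p q] by blast
  \<comment> \<open>The 1 serves the easy inequality, the p-th root of C the other.\<close>
  define D where "D = max 1 (C powr (1 / p))"
  have D: "D \<ge> 1" "C powr (1 / p) \<le> D" unfolding D_def by auto
  show ?thesis
  proof (intro exI[of _ D] conjI allI impI)
    show "0 < D" using D by simp
    fix f :: "'a \<Rightarrow> real" assume f: "locally_integrable \<Omega> f"
    \<comment> \<open>The estimates want a function measurable on the whole space; both sides of the
      claim see f only on \<Omega>, where g agrees with it.\<close>
    define g where "g x = indicator \<Omega> x * f x" for x
    have g: "g \<in> borel_measurable lebesgue" unfolding g_def by (rule locally_integrable_measurable[OF f])
    have fg: "f x = g x" if "x \<in> \<Omega>" for x using that by (simp add: g_def)
    define E where "E = (\<integral>\<^sup>+x\<in>\<Omega>. inner_term s p q g \<Omega> x \<partial>lebesgue)"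
    define T where "T = (\<integral>\<^sup>+Q. (\<integral>\<^sup>+x\<in>Q. inner_term s p q g (Shr W \<rho> Q) x \<partial>lebesgue) \<partial>count_space W)"
    have E: "(\<integral>\<^sup>+x\<in>\<Omega>. inner_term s p q f \<Omega> x \<partial>lebesgue) = E"
      unfolding E_def using fg by (intro nn_integral_cong) (auto intro!: inner_term_cong split: split_indicator)
    have "(\<integral>\<^sup>+x\<in>Q. inner_term s p q f (Shr W \<rho> Q) x \<partial>lebesgue) = (\<integral>\<^sup>+x\<in>Q. inner_term s p q g (Shr W \<rho> Q) x \<partial>lebesgue)"
      if Q: "Q \<in> W" for Q
    proof (rule nn_integral_cong)
      fix x
      have "inner_term s p q f (Shr W \<rho> Q) x = inner_term s p q g (Shr W \<rho> Q) x" if "x \<in> Q"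
        using that Q W_subset Shr_subset fg by (intro inner_term_cong) blast+
      then show "inner_term s p q f (Shr W \<rho> Q) x * indicator Q x = inner_term s p q g (Shr W \<rho> Q) x * indicator Q x"
        by (auto split: split_indicator)
    qed
    then have T: "(\<Sum>\<^sub>\<infinity>Q\<in>W. \<integral>\<^sup>+x\<in>Q. inner_term s p q f (Shr W \<rho> Q) x \<partial>lebesgue) = T"
      unfolding infsum_eq_nn_integral_count_space[OF W_countable] T_def by (rule nn_integral_cong) simp
    have D1: "1 * y \<le> ennreal D * y" for y
      using D by (intro mult_right_mono) (auto simp flip: ennreal_1 intro!: ennreal_leI)
    have "enn_powr T (1 / p) \<le> enn_powr E (1 / p)"
      unfolding T_def E_def using p by (intro enn_powr_mono shadow_le_full[OF g p q]) auto
    then show "enn_powr (\<Sum>\<^sub>\<infinity>Q\<in>W. \<integral>\<^sup>+x\<in>Q. inner_term s p q f (Shr W \<rho> Q) x \<partial>lebesgue) (1 / p)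
       \<le> ennreal D * enn_powr (\<integral>\<^sup>+x\<in>\<Omega>. inner_term s p q f \<Omega> x \<partial>lebesgue) (1 / p)"
      unfolding T E using D1[of "enn_powr E (1 / p)"] by simp
    have "enn_powr E (1 / p) \<le> enn_powr (ennreal C * T) (1 / p)"
      unfolding T_def E_def using p by (intro enn_powr_mono le[OF g]) auto
    also have "\<dots> = ennreal (C powr (1 / p)) * enn_powr T (1 / p)" by (rule enn_powr_cmult[OF C])
    also have "\<dots> \<le> ennreal D * enn_powr T (1 / p)" using D by (intro mult_right_mono ennreal_leI) auto
    finally show "enn_powr (\<integral>\<^sup>+x\<in>\<Omega>. inner_term s p q f \<Omega> x \<partial>lebesgue) (1 / p)
       \<le> ennreal D * enn_powr (\<Sum>\<^sub>\<infinity>Q\<in>W. \<integral>\<^sup>+x\<in>Q. inner_term s p q f (Shr W \<rho> Q) x \<partial>lebesgue) (1 / p)"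
      unfolding T E .
  qed
qed

end
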